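(* (Distribution relation.) For all integers $n_1,\dots,n_r\ge1$ and $\tau$ in the upper half plane, $$\sum_{a_1,\dots,a_r\in\mathbb Z/N\mathbb Z}G^{\sqcup\!\sqcup}\Big(\binom{n_1,\dots,n_r}{a_1,\dots,a_r};\tau\Big)=G^{\sqcup\!\sqcup}_{n_1,\dots,n_r}(N\tau),$$ where $G^{\sqcup\!\sqcup}_{n_1,\dots,n_r}$ denotes the shuffle regularized multiple Eisenstein series of level $1$ (the same construction with $N=1$ and all lower entries $0$).
   Context: Fix $N\ge1$, $\eta=e^{2\pi\sqrt{-1}/N}$. $\mathfrak H=\mathbb Q\langle x,y_a\ (a\in\mathbb Z/N\mathbb Z)\rangle$, $z_{n,a}=y_ax^{n-1}$; $\mathfrak H^1$ is generated under concatenation by all $z_{n,a}$; $\binom{n_1,\dots,n_r}{a_1,\dots,a_r}=z_{n_1,a_1}\cdots z_{n_r,a_r}$; $\mathfrak H^0=\mathbb Q+\sum_ay_a\mathfrak Hx+\sum_{a,\,b\neq0}y_a\mathfrak Hy_b$; $\widetilde{\mathfrak H}^0=\mathbb Q+\sum_{n\ge2,a}\mathfrak H^1z_{n,a}$. Shuffle: $w\sqcup\!\sqcup1=1\sqcup\!\sqcup w=w$, $u_1w_1\sqcup\!\sqcup u_2w_2=u_1(w_1\sqcup\!\sqcup u_2w_2)+u_2(u_1w_1\sqcup\!\sqcup w_2)$. $\rho(z_{n_1,a_1}\cdots z_{n_r,a_r})=z_{n_1,a_1}z_{n_2,a_2-a_1}\cdots z_{n_r,a_r-a_{r-1}}$,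 $w_1\mathbin{\widetilde{\sqcup\!\sqcup}}w_2=\rho^{-1}(\rho w_1\sqcup\!\sqcup\rho w_2)$. $\pi$ is the $\mathbb Q(\eta)$-linear concatenation-multiplicative map with $\pi(z_{n,a})=N^{-1}\sum_b\eta^{-ab}z_{n,b}$. Coproduct $\Delta_\mu$ on $\mathfrak H^1$: with $S=\{\eta,\dots,\eta^N,0\}$, Goncharov's algebra $\mathcal I(S)$ is generated by $\mathbb I(b_0;b_1,\dots,b_m;b_{m+1})$ ($b_i\in S$) modulo $\mathbb I(b;c)=1$, the shuffle product formula, path composition $\mathbb I(b_0;b_1..b_m;b_{m+1})=\sum_{i=0}^m\mathbb I(b_0;b_1..b_i;c)\mathbb I(c;b_{i+1}..b_m;b_{m+1})$ ($c\in S$), and $\mathbb I(b;b_1..b_m;b)=0$ ($m\ge1$); coproduct $\Delta\mathbb I(b_0;b_1..b_m;b_{m+1})=\sum_{0=i_0<\dots<i_{k+1}=m+1}\prod_{p=0}^k\mathbb I(b_{i_p};b_{i_p+1},\dots,b_{i_{p+1}-1};b_{i_{p+1}})\otimes\mathbb I(b_0;b_{i_1},\dots,b_{i_k};b_{m+1})$. $\mathcal I^0$ is the quotient by the ideal generated by $\mathbb I(0;0;b)$, $b\ne0$; $\mathbb I_c\binom{n_1..n_r}{a_1..a_r}=\mathbb I(0;\eta^{a_1},\{0\}^{n_1-1},\dots,\eta^{a_r},\{0\}^{n_r-1};\eta^c)$, $\mathbb I=\mathbb I_0$; $\mathcal I^1$ the span of the $\mathbb I\binom\cdot\cdot$; $\mu$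 the algebra map $\mathbb I_c\binom{n_1..n_r}{a_1..a_r}\mapsto\mathbb I\binom{n_1..n_r}{a_1-c..a_r-c}$; $\Delta_\mu=(\mu\otimes\mu)\Delta|_{\mathcal I^1}$. $\widetilde{\mathbb I}\binom{n_1..n_r}{a_1..a_r}=\frac{(-1)^r}{N^r}\sum_b\eta^{a_1b_1+(a_2-a_1)b_2+\dots+(a_r-a_{r-1})b_r}\mathbb I\binom{n_1..n_r}{b_1..b_r}$; the paper identifies $(\mathfrak H^1,\widetilde{\sqcup\!\sqcup})$ with the span of these via $\binom na\mapsto\widetilde{\mathbb I}\binom na$, which $\Delta_\mu$ preserves, giving $\Delta_\mu$ on $\mathfrak H^1$; $\phi\star\psi=m\circ(\phi\otimes\psi)\circ\Delta_\mu$. $L_{\sqcup\!\sqcup}\binom{n_1..n_r}{a_1..a_r}=\sum_{0<k_1<\dots<k_r}\frac{\eta^{(a_1-a_2)k_1+\dots+(a_{r-1}-a_r)k_{r-1}+a_rk_r}}{k_1^{n_1}\cdots k_r^{n_r}}$ on words of $\mathfrak H^0$; $\hat L$ is its $\mathbb Q(\eta)$-linear extension to $\mathfrak H\otimes\mathbb Q(\eta)$ which is a $\sqcup\!\sqcup$-homomorphism with $\hat L(x)=\hat L(y_0)=0$; $\zeta^{\sqcup\!\sqcup}(w)=\hat L(\pi(\rho(w)))$. $H\binom{n_1..n_r}{a_1..a_r\,;\,u_1..u_r}=\sum_{0<d_1<\dots<d_r}\prod_je^{d_ju_j}\eta^{a_jd_j}\big(\frac{q^{d_j}}{1-q^{d_j}}\big)^{n_j}$;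 $h(a_1..a_r;x_1..x_r)=\sum\frac{1}{i_1!\cdots i_m!}H\binom{i_1..i_m}{A_1..A_m\,;\,X_1..X_m}$ over compositions $i_1+\dots+i_m=r$, $A_k,X_k$ the sums of $a_j,x_j$ over the $k$-th block; $g^{\sqcup\!\sqcup}$ is $\mathbb Q$-linear, $g^{\sqcup\!\sqcup}(1)=1$, defined by $\sum_{k_i\ge1}\big(\frac{N}{-2\pi\sqrt{-1}}\big)^{k_1+\dots+k_r}g^{\sqcup\!\sqcup}\big(\binom{k_1..k_r}{a_1..a_r};q\big)x_1^{k_1-1}\cdots x_r^{k_r-1}=h(a_r-a_{r-1},\dots,a_2-a_1,a_1;\,x_r-x_{r-1},\dots,x_2-x_1,x_1)$. $G^{\sqcup\!\sqcup}(w;\tau)=(\zeta^{\sqcup\!\sqcup}\star g^{\sqcup\!\sqcup})(w;q)$ with $q=e^{2\pi\sqrt{-1}\tau}$. *)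

theory Defs
  imports
    "HOL-Analysis.Analysis"
    "HOL-Algebra.Ideal"
    "HOL-Library.Multiset"
    "HOL-Library.Poly_Mapping"
    "HOL-Library.Product_Plus"
begin

text \<open>
  Lists are a monoid under concatenation, so the convolution product of the type
  \<open>'a list \<Rightarrow>\<^sub>0 complex\<close> is the concatenation product of the free associative
  algebra on \<open>'a\<close>.  Throughout, scalars are extended to the complex numbers, which contain
  \<open>\<rat>(\<eta>)\<close>.  Residue classes modulo \<open>N\<close> are represented by the integers \<open>0, \<dots>, N - 1\<close>.
\<close>

instantiation list :: (type) monoid_add
begin
definition zero_list :: "'a list" where "zero_list = []"
definition plus_list :: "'a list \<Rightarrow> 'a list \<Rightarrow> 'a list" where "plus_list u v = u @ v"
instance by standard (simp_all add: zero_list_def plus_list_def)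
end

definition \<eta> :: "nat \<Rightarrow> complex" where
  "\<eta> N = exp (2 * of_real pi * \<i> / of_nat N)"

definition residues_mod :: "nat \<Rightarrow> int set" where
  "residues_mod N = {0..<int N}"

datatype letter = X | Y int

definition letters :: "nat \<Rightarrow> letter set" where
  "letters N = {X} \<union> Y ` residues_mod N"

text \<open>
  The basis of \<open>\<HH>\<^sup>1\<close>: the list \<open>[(n\<^sub>1,a\<^sub>1),\<dots>,(n\<^sub>r,a\<^sub>r)]\<close> stands for the word
  \<open>z\<^bsub>n\<^sub>1,a\<^sub>1\<^esub> \<cdots> z\<^bsub>n\<^sub>r,a\<^sub>r\<^esub>\<close>, and \<open>word_of\<close> writes it out in the letters \<open>x\<close>, \<open>y\<^sub>a\<close>.
\<close>

type_synonym index_word = "(nat \<times> int) list"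

definition H1_words :: "nat \<Rightarrow> index_word set" where
  "H1_words N = {w. \<forall>(n, a) \<in> set w. n \<ge> 1 \<and> a \<in> residues_mod N}"

definition word_of :: "index_word \<Rightarrow> letter list" where
  "word_of w = concat (map (\<lambda>(n, a). Y a # replicate (n - 1) X) w)"

definition H0_words :: "nat \<Rightarrow> letter list set" where
  "H0_words N = {[]}
     \<union> {[Y a] @ u @ [X] | a u. a \<in> residues_mod N \<and> u \<in> lists (letters N)}
     \<union> {[Y a] @ u @ [Y b] | a u b. a \<in> residues_mod N \<and> u \<in> lists (letters N)
          \<and> b \<in> residues_mod N \<and> b \<noteq> 0}"

text \<open>
  The shuffle product of two words, as the multiset of its terms.  (The library's \<open>shuffles\<close>
  is a set and forgets multiplicities.)
\<close>

fun shuffle :: "'a list \<Rightarrow> 'a list \<Rightarrow> 'a list multiset" where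
  "shuffle [] v = {#v#}"
| "shuffle u [] = {#u#}"
| "shuffle (a # u) (b # v) =
     image_mset ((#) a) (shuffle u (b # v)) + image_mset ((#) b) (shuffle (a # u) v)"

definition linear_ext :: "('a \<Rightarrow> complex) \<Rightarrow> ('a \<Rightarrow>\<^sub>0 complex) \<Rightarrow> complex" where
  "linear_ext f p = (\<Sum>w\<in>Poly_Mapping.keys p. Poly_Mapping.lookup p w * f w)"

text \<open>\<open>[a\<^sub>1, a\<^sub>2 - a\<^sub>1, \<dots>, a\<^sub>r - a\<^bsub>r-1\<^esub>]\<close> (\<open>zip\<close> drops the surplus last entry)\<close>

definition diffs :: "'a::ab_group_add list \<Rightarrow> 'a list" where
  "diffs as = map2 (-) as (0 # as)"

definition rho :: "nat \<Rightarrow> index_word \<Rightarrow> index_word" where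
  "rho N w = zip (map fst w) (map (\<lambda>a. a mod int N) (diffs (map snd w)))"

definition pi_map :: "nat \<Rightarrow> index_word \<Rightarrow> (index_word \<Rightarrow>\<^sub>0 complex)" where
  "pi_map N w = prod_list (map (\<lambda>(n, a).
     \<Sum>b\<in>residues_mod N. Poly_Mapping.single [(n, b)] (\<eta> N powi (- (a * b)) / of_nat N)) w)"

definition index_lists :: "nat \<Rightarrow> nat \<Rightarrow> int list set" where
  "index_lists N r = {as. length as = r \<and> set as \<subseteq> residues_mod N}"

text \<open>
  The triple \<open>(b\<^sub>0, [b\<^sub>1,\<dots>,b\<^sub>m], b\<^bsub>m+1\<^esub>)\<close> is the generator \<open>\<I>(b\<^sub>0;b\<^sub>1,\<dots>,b\<^sub>m;b\<^bsub>m+1\<^esub>)\<close>.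
  Monomials are multisets of generators, so \<open>'g multiset \<Rightarrow>\<^sub>0 complex\<close> is the polynomial algebra
  on \<open>'g\<close>, and \<open>('g multiset \<times> 'g multiset) \<Rightarrow>\<^sub>0 complex\<close> is its tensor square.
  Quotients are handled by congruence of representatives modulo ideals.
\<close>

type_synonym gen = "complex \<times> complex list \<times> complex"
type_synonym poly1 = "gen multiset \<Rightarrow>\<^sub>0 complex"
type_synonym poly2 = "(gen multiset \<times> gen multiset) \<Rightarrow>\<^sub>0 complex"

definition letter_set :: "nat \<Rightarrow> complex set" where
  "letter_set N = {\<eta> N ^ k | k. k \<in> {1..N}} \<union> {0}"

definition gens :: "complex set \<Rightarrow> gen set" where
  "gens S = {(b, bs, c). b \<in> S \<and> set bs \<subseteq> S \<and> c \<in> S}"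

definition var :: "gen \<Rightarrow> poly1" where
  "var g = Poly_Mapping.single {#g#} 1"

abbreviation scalar :: "complex \<Rightarrow> ('m::comm_monoid_add \<Rightarrow>\<^sub>0 complex)" where
  "scalar c \<equiv> Poly_Mapping.single 0 c"

definition ring_on :: "'a::comm_ring_1 set \<Rightarrow> 'a ring" where
  "ring_on A = \<lparr>carrier = A, monoid.mult = (*), one = 1, zero = 0, add = (+)\<rparr>"

definition free1 :: "complex set \<Rightarrow> poly1 ring" where
  "free1 S = ring_on {p. \<forall>m\<in>Poly_Mapping.keys p. set_mset m \<subseteq> gens S}"

definition free2 :: "complex set \<Rightarrow> poly2 ring" where
  "free2 S = ring_on {p. \<forall>(m, m')\<in>Poly_Mapping.keys p. set_mset m \<subseteq> gens S \<and> set_mset m' \<subseteq> gens S}"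

text \<open>the algebra homomorphism out of a polynomial algebra with prescribed values on generators\<close>

definition poly_hom :: "(gen \<Rightarrow> ('m::comm_monoid_add \<Rightarrow>\<^sub>0 complex)) \<Rightarrow> poly1 \<Rightarrow> ('m \<Rightarrow>\<^sub>0 complex)" where
  "poly_hom f p = (\<Sum>m\<in>Poly_Mapping.keys p.
     scalar (Poly_Mapping.lookup p m) * prod_mset (image_mset f m))"

definition tensor :: "poly1 \<Rightarrow> poly1 \<Rightarrow> poly2" where
  "tensor p q = (\<Sum>m\<in>Poly_Mapping.keys p. \<Sum>m'\<in>Poly_Mapping.keys q.
     Poly_Mapping.single (m, m') (Poly_Mapping.lookup p m * Poly_Mapping.lookup q m'))"

text \<open>\<open>F \<otimes> F\<close> for the linear map \<open>F\<close> with the given values on a basis\<close>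

definition tensor_map :: "('a \<Rightarrow> poly1) \<Rightarrow> ('a \<times> 'a \<Rightarrow>\<^sub>0 complex) \<Rightarrow> poly2" where
  "tensor_map F D = (\<Sum>(u, v)\<in>Poly_Mapping.keys D.
     scalar (Poly_Mapping.lookup D (u, v)) * tensor (F u) (F v))"

definition goncharov_relations :: "complex set \<Rightarrow> poly1 set" where
  "goncharov_relations S =
     {var (b, [], c) - 1 | b c. b \<in> S \<and> c \<in> S}
   \<union> {var (b, u, c) * var (b, v, c) - (\<Sum>w\<in>#shuffle u v. var (b, w, c)) | b c u v.
        b \<in> S \<and> c \<in> S \<and> set u \<subseteq> S \<and> set v \<subseteq> S}
   \<union> {var (b, u, d) - (\<Sum>i\<le>length u. var (b, take i u, c) * var (c, drop i u, d)) | b c d u.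
        b \<in> S \<and> c \<in> S \<and> d \<in> S \<and> set u \<subseteq> S}
   \<union> {var (b, u, b) | b u. b \<in> S \<and> set u \<subseteq> S \<and> u \<noteq> []}"

text \<open>
  The quotient of \<open>free1 S\<close> by \<open>ideal_I0 S\<close> is \<open>\<I>\<^sup>0\<close>, and the quotient of \<open>free2 S\<close> by
  \<open>ideal_I0_2 S\<close> is \<open>\<I>\<^sup>0 \<otimes> \<I>\<^sup>0\<close>.
\<close>

definition ideal_I0 :: "complex set \<Rightarrow> poly1 set" where
  "ideal_I0 S = genideal (free1 S)
     (goncharov_relations S \<union> {var (0, [0], b) | b. b \<in> S \<and> b \<noteq> 0})"

definition ideal_I0_2 :: "complex set \<Rightarrow> poly2 set" where
  "ideal_I0_2 S = genideal (free2 S)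
     ({tensor p 1 | p. p \<in> ideal_I0 S} \<union> {tensor 1 p | p. p \<in> ideal_I0 S})"

text \<open>
  In the coproduct, \<open>is = [i\<^sub>0,\<dots>,i\<^bsub>k+1\<^esub>]\<close> lists the chosen positions \<open>A \<subseteq> {1..m}\<close> together
  with the two endpoints \<open>0\<close> and \<open>m + 1\<close>.
\<close>

definition coproduct_gen :: "gen \<Rightarrow> poly2" where
  "coproduct_gen g = (case g of (b, bs, c) \<Rightarrow>
     let B = b # bs @ [c]; m = length bs in
     \<Sum>A\<in>Pow {1..m}.
       let is = 0 # sorted_list_of_set A @ [m + 1] in
       tensor
         (\<Prod>p<length is - 1.
            var (B ! (is ! p), map ((!) B) [is ! p + 1..<is ! (p + 1)], B ! (is ! (p + 1))))
         (var (b, map ((!) B) (sorted_list_of_set A), c)))"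

definition coproduct :: "poly1 \<Rightarrow> poly2" where
  "coproduct = poly_hom coproduct_gen"

definition Isym :: "nat \<Rightarrow> int \<Rightarrow> index_word \<Rightarrow> poly1" where
  "Isym N c w = var (0, concat (map (\<lambda>(n, a). \<eta> N powi a # replicate (n - 1) 0) w), \<eta> N powi c)"

text \<open>
  \<open>\<mu> : \<I>\<^sup>0 \<rightarrow> \<I>\<^sup>1\<close>, lifted to representatives: \<open>poly_hom (mu_gens N)\<close> is an algebra endomorphism
  of the polynomial algebra which respects the ideal and induces \<open>\<mu>\<close> on the quotient.  As the
  elements \<open>\<I>\<^sub>c\<close> generate \<open>\<I>\<^sup>0\<close>, the induced map does not depend on the choice of the lift.
\<close>

definition mu_gens :: "nat \<Rightarrow> gen \<Rightarrow> poly1" where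
  "mu_gens N = (SOME f.
     (\<forall>g\<in>gens (letter_set N). f g \<in> carrier (free1 (letter_set N))) \<and>
     (\<forall>p\<in>ideal_I0 (letter_set N). poly_hom f p \<in> ideal_I0 (letter_set N)) \<and>
     (\<forall>c\<in>residues_mod N. \<forall>w\<in>H1_words N.
        poly_hom f (Isym N c w) - Isym N 0 (map (\<lambda>(n, a). (n, a - c)) w)
          \<in> ideal_I0 (letter_set N)))"

definition mu :: "nat \<Rightarrow> poly1 \<Rightarrow> poly1" where
  "mu N = poly_hom (mu_gens N)"

definition mu_tensor_mu :: "nat \<Rightarrow> poly2 \<Rightarrow> poly2" where
  "mu_tensor_mu N = tensor_map (\<lambda>m. mu N (Poly_Mapping.single m 1))"

definition Itilde :: "nat \<Rightarrow> index_word \<Rightarrow> poly1" where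
  "Itilde N w =
     scalar ((-1) ^ length w / of_nat N ^ length w) *
     (\<Sum>bs\<in>index_lists N (length w).
        scalar (\<eta> N powi (\<Sum>j<length w. (diffs (map snd w) ! j) * (bs ! j)))
        * Isym N 0 (zip (map fst w) bs))"

text \<open>
  The transport of \<open>\<Delta>\<^sub>\<mu>\<close> to \<open>\<HH>\<^sup>1\<close> along the identification of the word \<open>w\<close> with
  \<open>Itilde N w\<close>: the unique element of \<open>\<HH>\<^sup>1 \<otimes> \<HH>\<^sup>1\<close> whose image in \<open>\<I>\<^sup>0 \<otimes> \<I>\<^sup>0\<close> is
  \<open>(\<mu> \<otimes> \<mu>)(\<Delta> (Itilde N w))\<close>.
\<close>

definition Delta_mu :: "nat \<Rightarrow> index_word \<Rightarrow> (index_word \<times> index_word \<Rightarrow>\<^sub>0 complex)" where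
  "Delta_mu N w = (THE D.
     Poly_Mapping.keys D \<subseteq> H1_words N \<times> H1_words N \<and>
     tensor_map (Itilde N) D - mu_tensor_mu N (coproduct (Itilde N w))
       \<in> ideal_I0_2 (letter_set N))"

definition convolution ::
  "nat \<Rightarrow> (index_word \<Rightarrow> complex) \<Rightarrow> (index_word \<Rightarrow> complex) \<Rightarrow> index_word \<Rightarrow> complex" where
  "convolution N \<phi> \<psi> w = linear_ext (\<lambda>(u, v). \<phi> u * \<psi> v) (Delta_mu N w)"

text \<open>
  If \<open>n\<^sub>r = 1\<close> the series is only conditionally convergent; it is summed in the order of the
  largest index \<open>k\<^sub>r\<close>.
\<close>

definition L_series :: "nat \<Rightarrow> index_word \<Rightarrow> complex" where
  "L_series N w =
     (let r = length w; n = (\<lambda>j. fst (w ! j)); a = (\<lambda>j. if j < r then snd (w ! j) else 0) in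
      lim (\<lambda>K. \<Sum>k\<in>{k::nat list. length k = r \<and> sorted_wrt (<) k \<and> set k \<subseteq> {1..K}}.
        \<Prod>j<r. \<eta> N powi ((a j - a (j + 1)) * int (k ! j)) / of_nat (k ! j) ^ n j))"

text \<open>
  A linear map on \<open>\<HH>\<close> is given by its values on words.  The single letters \<open>y\<^sub>b\<close> with
  \<open>b \<noteq> 0\<close> are not of the form \<open>y\<^sub>a u y\<^sub>b\<close>, but their values are forced:
  \<open>y\<^sub>b\<close> shuffled with \<open>y\<^sub>0 x\<close> lies in \<open>\<HH>\<^sup>0\<close>, and \<open>y\<^sub>0 x\<close> is sent to \<open>\<zeta>(2) \<noteq> 0\<close>.
\<close>

definition Lhat :: "nat \<Rightarrow> letter list \<Rightarrow> complex" where
  "Lhat N = (SOME L.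
     (\<forall>w\<in>H1_words N. word_of w \<in> H0_words N \<longrightarrow> L (word_of w) = L_series N w) \<and>
     (\<forall>u\<in>lists (letters N). \<forall>v\<in>lists (letters N). L u * L v = (\<Sum>w\<in>#shuffle u v. L w)) \<and>
     L [X] = 0 \<and> L [Y 0] = 0)"

definition zeta_sh :: "nat \<Rightarrow> index_word \<Rightarrow> complex" where
  "zeta_sh N w = linear_ext (\<lambda>v. Lhat N (word_of v)) (pi_map N (rho N w))"

definition H_series ::
  "nat \<Rightarrow> complex \<Rightarrow> nat list \<Rightarrow> int list \<Rightarrow> complex list \<Rightarrow> complex" where
  "H_series N q ns as us =
     (\<Sum>\<^sub>\<infinity>d\<in>{d::nat list. length d = length ns \<and> sorted_wrt (<) d \<and> (\<forall>i\<in>set d. 0 < i)}.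
        \<Prod>j<length ns. exp (of_nat (d ! j) * us ! j) * \<eta> N powi (as ! j * int (d ! j))
          * (q ^ (d ! j) / (1 - q ^ (d ! j))) ^ (ns ! j))"

definition compositions :: "nat \<Rightarrow> nat list set" where
  "compositions r = {is. (\<forall>i\<in>set is. 1 \<le> i) \<and> sum_list is = r}"

fun block_sums :: "nat list \<Rightarrow> 'a::comm_monoid_add list \<Rightarrow> 'a list" where
  "block_sums [] xs = []"
| "block_sums (i # is) xs = sum_list (take i xs) # block_sums is (drop i xs)"

definition h_series :: "nat \<Rightarrow> complex \<Rightarrow> int list \<Rightarrow> complex list \<Rightarrow> complex" where
  "h_series N q as xs =
     (\<Sum>is\<in>compositions (length as).
        1 / (\<Prod>i\<leftarrow>is. fact i) * H_series N q is (block_sums is as) (block_sums is xs))"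

text \<open>
  The generating series identity is read as a convergent power series expansion in
  \<open>x\<^sub>1, \<dots>, x\<^sub>r\<close> near the origin, which determines the coefficients.
\<close>

definition g_sh :: "nat \<Rightarrow> complex \<Rightarrow> index_word \<Rightarrow> complex" where
  "g_sh N q = (SOME g. g [] = 1 \<and>
     (\<forall>as. set as \<subseteq> residues_mod N \<longrightarrow>
       (\<exists>\<epsilon>>0. \<forall>xs. length xs = length as \<and> (\<forall>x\<in>set xs. norm x < \<epsilon>) \<longrightarrow>
         ((\<lambda>ks. (of_nat N / (- 2 * of_real pi * \<i>)) ^ sum_list ks * g (zip ks as)
             * (\<Prod>j<length as. xs ! j ^ (ks ! j - 1)))
           has_sum h_series N q (rev (diffs as)) (rev (diffs xs)))
         {ks::nat list. length ks = length as \<and> (\<forall>k\<in>set ks. 1 \<le> k)})))"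

definition G_sh :: "nat \<Rightarrow> index_word \<Rightarrow> complex \<Rightarrow> complex" where
  "G_sh N w \<tau> = convolution N (zeta_sh N) (g_sh N (exp (2 * of_real pi * \<i> * \<tau>))) w"

definition G_sh_level1 :: "nat list \<Rightarrow> complex \<Rightarrow> complex" where
  "G_sh_level1 ns \<tau> = G_sh 1 (map (\<lambda>n. (n, 0)) ns) \<tau>"

end

theory Submission
  imports Defs
begin

text \<open>
  Summing over all lower indices is a character sum.  It sends
  \<open>\<Sum>\<^sub>a \<I>~(n; a)\<close> to the single generator with all \<open>a\<^sub>j = 0\<close>, which only involves the letters
  \<open>0\<close> and \<open>1\<close> and is the generator of level \<open>1\<close>; there \<open>\<mu>\<close> is the identity, so \<open>\<Delta>\<^sub>\<mu>\<close> is compatible with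
  \<open>z\<^sub>n \<mapsto> \<Sum>\<^sub>a z\<^bsub>n,a\<^esub>\<close>, and the theorem splits into distribution relations for \<open>\<zeta>\<close> and \<open>g\<close>.
  For \<open>\<zeta>\<close>, \<open>\<pi> \<circ> \<rho>\<close> sends the sum to the word with all \<open>a\<^sub>j = 0\<close>, whose regularised value does not
  depend on the level.  For \<open>g\<close>, the character sum keeps the \<open>d\<^sub>j\<close> divisible by \<open>N\<close>, and
  \<open>d\<^sub>j = N e\<^sub>j\<close> turns \<open>q\<close> into \<open>q\<^sup>N\<close>.

  The choice operators behind these objects are legitimate: \<open>\<Delta>\<^sub>\<mu>\<close> is unique because
  iterated integrals along piecewise linear paths give characters of \<open>\<I>\<^sup>0\<close> that separate words, and
  the regularised value exists because shuffling with a letter \<open>x\<close> determines words with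
  \<open>n + 1\<close> leading letters \<open>x\<close> from words with \<open>n\<close> of them.
\<close>

section \<open>Shuffle products, regularisation in one letter, and characters modulo an
  ideal\<close>

section \<open>Shuffles\<close>

text \<open>\<open>mu_gens\<close>, \<open>Lhat\<close> and \<open>g_sh\<close> are chosen by
  \<open>SOME\<close> and \<open>Delta_mu\<close> by \<open>THE\<close>: each needs a witness before
  its defining property can be used, and the relation has to follow from that property for every
  admissible choice. For \<mu> the choice disappears modulo the ideal, because the symbols running
  from 0 to a root of unity generate the algebra. For the regularised zeta values it disappears on
  words in x and y_0, the only ones left after summation, because the vanishing on x and on y_0
  gives two triangular systems. For g it disappears by uniqueness of power series coefficients in
  several variables. Quotient algebras are replaced by congruences throughout, so characters take
  values in a subring modulo an ideal; the same formalism then yields both the map \<mu> and the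
  complex characters that separate words. On the g side the powers of N fit exactly: the character
  sum gives N^r and rescaling d gives N^(k_j - 1) for each j, together N^k with k = k_1 + ... + k_r,
  which is the ratio between the normalisations (N / (-2 \<pi> i))^k at level N and at level
  1.\<close>

lemma shuffle_Nil_right [simp]: "shuffle u [] = {#u#}"
  by (cases u) auto

lemma sum_mset_bind: "(\<Sum>w\<in>#(\<Sum>v\<in>#M. F v). f w) = (\<Sum>v\<in>#M. \<Sum>w\<in>#F v. f w)"
  by (induction M) auto

lemma image_mset_sum_mset: "image_mset h (\<Sum>v\<in>#M. F v) = (\<Sum>v\<in>#M. image_mset h (F v))"
  by (induction M) auto

lemma sum_mset_singletons: "(\<Sum>v\<in>#M. {#g v#}) = image_mset g M"
  by (induction M) auto

lemma sum_mset_distrib_add: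
  fixes f g :: "'a \<Rightarrow> 'b::comm_monoid_add"
  shows "(\<Sum>w\<in>#M. f w + g w) = (\<Sum>w\<in>#M. f w) + (\<Sum>w\<in>#M. g w)"
  by (induction M) (auto simp: algebra_simps)

lemma shuffle_commute: "shuffle u v = shuffle v u"
  by (induction u v rule: shuffle.induct) (auto simp: add.commute)

text \<open>Both sides are the shuffles of three words, sorted by first letter: the terms beginning
  with a given head are the triple shuffles in which that head has been removed from its word. Hence
  the induction on the total length, with one instance of the hypothesis per head.\<close>

lemma shuffle_assoc: "(\<Sum>w\<in>#shuffle u v. shuffle w z) = (\<Sum>w\<in>#shuffle v z. shuffle u w)"
proof (induction "length u + length v + length z" arbitrary: u v z rule: less_induct)
  case less
  show ?case
  proof (cases "u = [] \<or> v = [] \<or> z = []")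
    case True
    have "shuffle [] = (\<lambda>v. {#v :: 'a list#})"
      by auto
    with True show ?thesis
      using sum_mset_singletons[of "\<lambda>w. w"] by auto
  next
    case False
    then obtain a u' b v' c z' where eq: "u = a # u'" "v = b # v'" "z = c # z'"
      by (metis neq_Nil_conv)
    have IH: "(\<Sum>w\<in>#shuffle u' v. shuffle w z) = (\<Sum>w\<in>#shuffle v z. shuffle u' w)"
      "(\<Sum>w\<in>#shuffle u v'. shuffle w z) = (\<Sum>w\<in>#shuffle v' z. shuffle u w)"
      "(\<Sum>w\<in>#shuffle u v. shuffle w z') = (\<Sum>w\<in>#shuffle v z'. shuffle u w)"
      by (rule less(1); simp add: eq)+
    have A: "image_mset ((#) a) (\<Sum>w\<in>#shuffle u' v. shuffle w z)
       = (\<Sum>w\<in>#shuffle v' z. image_mset ((#) a) (shuffle u' (b # w)))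
       + (\<Sum>w\<in>#shuffle v z'. image_mset ((#) a) (shuffle u' (c # w)))"
      unfolding IH by (simp add: eq image_mset_sum_mset multiset.map_comp comp_def)
    have C: "image_mset ((#) c) (\<Sum>w\<in>#shuffle v z'. shuffle u w)
       = (\<Sum>w\<in>#shuffle u' v. image_mset ((#) c) (shuffle (a # w) z'))
       + (\<Sum>w\<in>#shuffle u v'. image_mset ((#) c) (shuffle (b # w) z'))"
      unfolding IH(3)[symmetric] by (simp add: eq image_mset_sum_mset multiset.map_comp comp_def)
    have B: "image_mset ((#) b) (\<Sum>w\<in>#shuffle u v'. shuffle w z) 
       = (\<Sum>w\<in>#shuffle v' z. image_mset ((#) b) (shuffle u w))"
      unfolding IH by (simp add: image_mset_sum_mset)
    have "(\<Sum>w\<in>#shuffle u v. shuffle w z) =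
       (\<Sum>w\<in>#shuffle u' v. image_mset ((#) a) (shuffle w z))
       + (\<Sum>w\<in>#shuffle u v'. image_mset ((#) b) (shuffle w z))
       + ((\<Sum>w\<in>#shuffle u' v. image_mset ((#) c) (shuffle (a # w) z'))
       + (\<Sum>w\<in>#shuffle u v'. image_mset ((#) c) (shuffle (b # w) z')))"
      by (simp add: eq multiset.map_comp comp_def sum_mset_distrib_add algebra_simps)
    also have "\<dots> = image_mset ((#) a) (\<Sum>w\<in>#shuffle u' v. shuffle w z)
       + image_mset ((#) b) (\<Sum>w\<in>#shuffle u v'. shuffle w z)
       + image_mset ((#) c) (\<Sum>w\<in>#shuffle v z'. shuffle u w)"
      unfolding C by (simp add: image_mset_sum_mset)
    also have "\<dots> = (\<Sum>w\<in>#shuffle v z. shuffle u w)"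
      unfolding A B 
      by (simp add: eq multiset.map_comp comp_def sum_mset_distrib_add algebra_simps image_mset_sum_mset)
    finally show ?thesis .
  qed
qed

text \<open>The recursion at the right end. It shows that reversal respects shuffles
  (\<open>shuffle_rev\<close>), so facts about first letters carry over to last letters.\<close>

lemma shuffle_snoc:
  "shuffle (u @ [a]) (v @ [b]) =
     image_mset (\<lambda>w. w @ [a]) (shuffle u (v @ [b])) + image_mset (\<lambda>w. w @ [b]) (shuffle (u @ [a]) v)"
proof (induction u v rule: shuffle.induct)
  case (1 v)
  show ?case
  proof (induction v)
    case (Cons c v)
    then show ?case by (simp add: multiset.map_comp comp_def)
  qed auto
next
  case (2 c u)
  show ?case
  proof (induction "c # u" arbitrary: c u)
    case (Cons c u)
    then show ?case by (cases u) (auto simp: multiset.map_comp comp_def)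
  qed
next
  case (3 c u d v)
  then show ?case by (simp add: multiset.map_comp comp_def algebra_simps)
qed

lemma shuffle_rev: "shuffle (rev u) (rev v) = image_mset rev (shuffle u v)"
  by (induction u v rule: shuffle.induct) (auto simp: shuffle_snoc multiset.map_comp comp_def)

lemma set_shuffle: "w \<in># shuffle u v \<Longrightarrow> set w = set u \<union> set v"
  by (induction u v arbitrary: w rule: shuffle.induct) auto

lemma length_shuffle: "w \<in># shuffle u v \<Longrightarrow> length w = length u + length v"
  by (induction u v arbitrary: w rule: shuffle.induct) auto

lemma hd_shuffle: "w \<in># shuffle u v \<Longrightarrow> w = [] \<or> (u \<noteq> [] \<and> hd w = hd u) \<or> (v \<noteq> [] \<and> hd w = hd v)"
  by (induction u v arbitrary: w rule: shuffle.induct) auto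

lemma last_shuffle:
  assumes "w \<in># shuffle u v"
  shows "w = [] \<or> (u \<noteq> [] \<and> last w = last u) \<or> (v \<noteq> [] \<and> last w = last v)"
proof -
  have "rev w \<in># shuffle (rev u) (rev v)"
    unfolding shuffle_rev using assms by simp
  from hd_shuffle[OF this] show ?thesis
    by (simp add: hd_rev)
qed

lemma shuffle_map: "shuffle (map f u) (map f v) = image_mset (map f) (shuffle u v)"
  by (induction u v rule: shuffle.induct) (auto simp: multiset.map_comp comp_def)

text \<open>Inserting x into any of the n + 1 gaps of the block in front of c produces the same
  word, whence the multiplicity; otherwise x lands somewhere behind c.\<close>

lemma shuffle_letter_power:
  assumes "c \<noteq> x"
  shows "shuffle [x] (replicate n x @ c # v) =
    repeat_mset (Suc n) {#replicate (Suc n) x @ c # v#}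
      + image_mset (\<lambda>w. replicate n x @ c # w) (shuffle [x] v)"
  using assms by (induction n) (auto simp: multiset.map_comp comp_def)

lemma shuffle_letter_power_Nil:
  "shuffle [x] (replicate n x) = repeat_mset (Suc n) {#replicate (Suc n) x#}"
  by (induction n) auto

lemma split_leading:
  obtains n where "w = replicate n x"
  | n c v where "w = replicate n x @ c # v" "c \<noteq> x"
proof -
  have eq: "w = takeWhile (\<lambda>y. y = x) w @ dropWhile (\<lambda>y. y = x) w" by simp
  have rep: "takeWhile (\<lambda>y. y = x) w = replicate (length (takeWhile (\<lambda>y. y = x) w)) x"
    by (induction w) auto
  show thesis
  proof (cases "dropWhile (\<lambda>y. y = x) w")
    case Nil
    with eq rep that(1) show ?thesis by (metis append_Nil2)
  next
    case (Cons c v)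
    moreover have "c \<noteq> x" using Cons by (metis (full_types) dropWhile_eq_Cons_conv)
    ultimately show ?thesis using eq rep that(2) by metis
  qed
qed

text \<open>Induction on the length of the initial block of x, for all tails at once: the step
  appeals to words with one leading x fewer, but that x reappears behind c. These are exactly the
  lower terms of x shuffled with x^n c v.\<close>

lemma leading_letter_induct [case_names base power step]:
  assumes base: "\<And>w. w = [] \<or> hd w \<noteq> x \<Longrightarrow> P w"
    and power: "\<And>n. P (replicate (Suc n) x)"
    and step: "\<And>n c v. c \<noteq> x \<Longrightarrow> (\<And>w. w \<in># shuffle [x] v \<Longrightarrow> P (replicate n x @ c # w))
      \<Longrightarrow> P (replicate (Suc n) x @ c # v)"
  shows "P w"
proof -
  have P: "P (replicate n x @ c # v)" if "c \<noteq> x" for n c v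
  proof (induction n arbitrary: v)
    case 0
    then show ?case using that by (intro base) auto
  next
    case (Suc n)
    show ?case by (rule step[OF that Suc])
  qed
  show ?thesis
  proof (cases w rule: split_leading[where x = x])
    case (1 n)
    then show ?thesis by (cases n) (use base power in auto)
  next
    case (2 n c v)
    with P show ?thesis by simp
  qed
qed

section \<open>Regularisation\<close>

text \<open>The value on x^n v, where v does not begin with x. An empty v stands for a pure power of
  x, forced to vanish since x shuffled with x^n is a multiple of x^(n+1); otherwise the equation for
  x shuffled with x^(n-1) c v' is solved for its leading term.\<close>

primrec reg_aux :: "'a \<Rightarrow> ('a list \<Rightarrow> complex) \<Rightarrow> nat \<Rightarrow> 'a list \<Rightarrow> complex" where
  "reg_aux x L 0 v = L v"
| "reg_aux x L (Suc n) v = (case v of [] \<Rightarrow> 0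
     | c # v' \<Rightarrow> - (\<Sum>w\<in>#shuffle [x] v'. reg_aux x L n (c # w)) / of_nat (Suc n))"

text \<open>
  The extension of \<open>L\<close> by the requirement that every shuffle \<open>[x] \<squnion> A\<close> is sent to \<open>0\<close>:
  \<open>x \<squnion> x\<^sup>n c v\<close> is \<open>n + 1\<close> times \<open>x\<^bsup>n+1\<^esup> c v\<close> plus words with only \<open>n\<close> leading letters \<open>x\<close>.
\<close>

definition regularise :: "'a \<Rightarrow> ('a list \<Rightarrow> complex) \<Rightarrow> 'a list \<Rightarrow> complex" where
  "regularise x L w =
     reg_aux x L (length (takeWhile (\<lambda>y. y = x) w)) (dropWhile (\<lambda>y. y = x) w)"

lemma regularise_base: "w = [] \<or> hd w \<noteq> x \<Longrightarrow> regularise x L w = L w"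
  by (cases w) (auto simp: regularise_def)

lemma regularise_power: "regularise x L (replicate (Suc n) x) = 0"
proof -
  have "takeWhile (\<lambda>y. y = x) (replicate n x) = replicate n x" for n
    by (induction n) auto
  moreover have "dropWhile (\<lambda>y. y = x) (replicate n x) = []" for n
    by (induction n) auto
  ultimately show ?thesis by (simp add: regularise_def)
qed

lemma regularise_letter:
  assumes "c \<noteq> x"
  shows "regularise x L (replicate n x @ c # v) = reg_aux x L n (c # v)"
proof -
  have "takeWhile (\<lambda>y. y = x) (replicate n x @ c # v) = replicate n x"
    using assms by (induction n) auto
  moreover have "dropWhile (\<lambda>y. y = x) (replicate n x @ c # v) = c # v"
    using assms by (induction n) auto
  ultimately show ?thesis by (simp add: regularise_def)
qed

lemma sum_mset_repeat:
  fixes f :: "'a \<Rightarrow> 'b::semiring_1"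
  shows "(\<Sum>w\<in>#repeat_mset n M. f w) = of_nat n * (\<Sum>w\<in>#M. f w)"
  by (induction n) (auto simp: algebra_simps)

lemma sum_shuffle_letter_power:
  fixes f :: "'a list \<Rightarrow> 'b::comm_ring_1"
  assumes "c \<noteq> x"
  shows "(\<Sum>w\<in>#shuffle [x] (replicate n x @ c # v). f w) =
    of_nat (Suc n) * f (replicate (Suc n) x @ c # v)
      + (\<Sum>w\<in>#shuffle [x] v. f (replicate n x @ c # w))"
  unfolding shuffle_letter_power[OF assms] image_mset_union sum_mset.union sum_mset_repeat
  by (simp add: multiset.map_comp comp_def)

lemma sum_shuffle_letter_power_Nil:
  fixes f :: "'a list \<Rightarrow> 'b::comm_ring_1"
  shows "(\<Sum>w\<in>#shuffle [x] (replicate n x). f w) = of_nat (Suc n) * f (replicate (Suc n) x)"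
  unfolding shuffle_letter_power_Nil sum_mset_repeat by simp

lemma regularise_step:
  assumes "c \<noteq> x"
  shows "of_nat (Suc n) * regularise x L (replicate (Suc n) x @ c # v) =
    - (\<Sum>w\<in>#shuffle [x] v. regularise x L (replicate n x @ c # w))"
  unfolding regularise_letter[OF assms] by (simp del: of_nat_Suc)

lemma regularise_shuffle_letter: "(\<Sum>w\<in>#shuffle [x] A. regularise x L w) = 0"
proof (cases A rule: split_leading[where x = x])
  case (1 n)
  then show ?thesis
    unfolding 1 sum_shuffle_letter_power_Nil regularise_power by simp
next
  case (2 n c v)
  show ?thesis
    unfolding 2(1) sum_shuffle_letter_power[OF 2(2)] regularise_step[OF 2(2)] by simp
qed

text \<open>Multiplicativity spreads from words u without leading x to all u, with v fixed. Since
  \<open>R\<close> vanishes on every shuffle with x, associativity gives 0 for the triple shuffle of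
  x, A and v; expanding x shuffled with A isolates the word with one more leading x. The set
  \<open>W\<close> records where the base case is available.\<close>

lemma regularise_mult_aux:
  assumes W_sh: "\<And>u v. u \<in> W \<Longrightarrow> v \<in> W \<Longrightarrow> set_mset (shuffle u v) \<subseteq> W"
    and W_tl: "\<And>A. x # A \<in> W \<Longrightarrow> A \<in> W" and x: "[x] \<in> W"
    and base: "\<And>u. u \<in> W \<Longrightarrow> u = [] \<or> hd u \<noteq> x
      \<Longrightarrow> R u * R v = (\<Sum>w\<in>#shuffle u v. R w)"
    and R: "R = regularise x L"
    and u: "u \<in> W"
  shows "R u * R v = (\<Sum>w\<in>#shuffle u v. R w)"
  using u
proof (induction u rule: leading_letter_induct[where x = x])
  case (base w)
  then show ?case using assms(4) by blast
next
  case (power n)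
  have "of_nat (Suc n) * (\<Sum>w\<in>#shuffle (replicate (Suc n) x) v. R w) =
      (\<Sum>y\<in>#shuffle [x] (replicate n x). \<Sum>w\<in>#shuffle y v. R w)"
    unfolding sum_shuffle_letter_power_Nil ..
  also have "\<dots> = (\<Sum>y\<in>#shuffle (replicate n x) v. \<Sum>w\<in>#shuffle [x] y. R w)"
    by (metis (no_types) shuffle_assoc sum_mset_bind)
  also have "\<dots> = 0" unfolding R regularise_shuffle_letter by simp
  finally have "(\<Sum>w\<in>#shuffle (replicate (Suc n) x) v. R w) = 0"
    by (simp del: of_nat_Suc replicate.simps)
  then show ?case by (simp add: R regularise_power del: replicate.simps)
next
  case (step n c u)
  let ?A = "replicate n x @ c # u" and ?u = "replicate (Suc n) x @ c # u"
  have A: "?A \<in> W" using step.prems W_tl by auto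
  have "0 = (\<Sum>y\<in>#shuffle ?A v. \<Sum>w\<in>#shuffle [x] y. R w)"
    unfolding R regularise_shuffle_letter by simp
  also have "\<dots> = (\<Sum>y\<in>#shuffle [x] ?A. \<Sum>w\<in>#shuffle y v. R w)"
    by (metis (no_types) shuffle_assoc sum_mset_bind)
  also have "\<dots> = of_nat (Suc n) * (\<Sum>w\<in>#shuffle ?u v. R w)
      + (\<Sum>y\<in>#shuffle [x] u. \<Sum>w\<in>#shuffle (replicate n x @ c # y) v. R w)"
    unfolding sum_shuffle_letter_power[OF step(1)] ..
  also have "(\<Sum>y\<in>#shuffle [x] u. \<Sum>w\<in>#shuffle (replicate n x @ c # y) v. R w) =
      (\<Sum>y\<in>#shuffle [x] u. R (replicate n x @ c # y) * R v)"
  proof (intro arg_cong[where f = sum_mset] image_mset_cong)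
    fix y assume y: "y \<in># shuffle [x] u"
    have "replicate n x @ c # y \<in># shuffle [x] ?A"
      unfolding shuffle_letter_power[OF step(1)] using y by auto
    then have "replicate n x @ c # y \<in> W" using W_sh[OF x A] by auto
    from step(2)[OF y this]
    show "(\<Sum>w\<in>#shuffle (replicate n x @ c # y) v. R w) = R (replicate n x @ c # y) * R v" ..
  qed
  also have "\<dots> = (\<Sum>y\<in>#shuffle [x] u. R (replicate n x @ c # y)) * R v"
    by (simp add: sum_mset_distrib_right)
  also have "(\<Sum>y\<in>#shuffle [x] u. R (replicate n x @ c # y)) = - (of_nat (Suc n) * R ?u)"
    using regularise_step[OF step(1), of n L u] unfolding R by simp
  finally have *: "0 = of_nat (Suc n) * (\<Sum>w\<in>#shuffle ?u v. R w) + - (of_nat (Suc n) * R ?u) * R v" .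
  have "N * (a * b) = N * S" if "0 = N * S + - (N * a) * b" for N S a b :: complex
    using that by (simp add: algebra_simps)
  from this[OF *] have "of_nat (Suc n) * (R ?u * R v) = of_nat (Suc n) * (\<Sum>w\<in>#shuffle ?u v. R w)"
    .
  moreover have "of_nat (Suc n) \<noteq> (0 :: complex)" by (rule of_nat_neq_0)
  ultimately show ?case by (rule iffD1[OF mult_left_cancel, rotated])
qed

lemma regularise_mult:
  assumes W_sh: "\<And>u v. u \<in> W \<Longrightarrow> v \<in> W \<Longrightarrow> set_mset (shuffle u v) \<subseteq> W"
    and W_tl: "\<And>A. x # A \<in> W \<Longrightarrow> A \<in> W" and x: "[x] \<in> W"
    and base: "\<And>u v. u \<in> W \<Longrightarrow> v \<in> W \<Longrightarrow> u = [] \<or> hd u \<noteq> x \<Longrightarrow> v = [] \<or> hd v \<noteq> x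
      \<Longrightarrow> L u * L v = (\<Sum>w\<in>#shuffle u v. L w)"
    and u: "u \<in> W" and v: "v \<in> W"
  shows "regularise x L u * regularise x L v = (\<Sum>w\<in>#shuffle u v. regularise x L w)"
proof -
  define R where "R = regularise x L"
  have base': "R u * R v = (\<Sum>w\<in>#shuffle u v. R w)"
    if "u \<in> W" "v \<in> W" "u = [] \<or> hd u \<noteq> x" "v = [] \<or> hd v \<noteq> x" for u v
  proof -
    have "R w = L w" if "w \<in># shuffle u v" for w
      unfolding R_def
    proof (rule regularise_base)
      show "w = [] \<or> hd w \<noteq> x"
        using hd_shuffle[OF that] \<open>u = [] \<or> hd u \<noteq> x\<close> \<open>v = [] \<or> hd v \<noteq> x\<close> by auto
    qed
    then have "(\<Sum>w\<in>#shuffle u v. R w) = (\<Sum>w\<in>#shuffle u v. L w)"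
      by (intro arg_cong[where f = sum_mset] image_mset_cong)
    moreover have "R u = L u" "R v = L v" unfolding R_def using that by (simp_all add: regularise_base)
    ultimately show ?thesis using base[OF that] by simp
  qed
  \<comment> \<open>The extension lemma is applied once for each factor: here the left factor
    becomes arbitrary while the right one still has no leading x; exchanging the two factors by
    commutativity then frees the right one.\<close>
  have half: "R u * R v = (\<Sum>w\<in>#shuffle u v. R w)"
    if "u \<in> W" "v \<in> W" "v = [] \<or> hd v \<noteq> x" for u v
    by (rule regularise_mult_aux[OF W_sh W_tl x _ R_def that(1)]) (use base' that in blast)+
  have "R u * R v = (\<Sum>w\<in>#shuffle u v. R w)"
  proof (rule regularise_mult_aux[OF W_sh W_tl x _ R_def u])
    fix u assume "u \<in> W" "u = [] \<or> hd u \<noteq> x"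
    from half[OF v this] show "R u * R v = (\<Sum>w\<in>#shuffle u v. R w)"
      by (simp add: mult.commute shuffle_commute)
  qed
  then show ?thesis by (simp add: R_def)
qed

text \<open>Vanishing on all shuffles with x is a linear system, triangular in the number of leading
  letters x with diagonal entries n + 1. Its solutions are determined by the words without leading
  x.\<close>

lemma regularisation_unique:
  fixes L L' :: "'a list \<Rightarrow> complex"
  assumes W_sh: "\<And>u v. u \<in> W \<Longrightarrow> v \<in> W \<Longrightarrow> set_mset (shuffle u v) \<subseteq> W"
    and W_tl: "\<And>A. x # A \<in> W \<Longrightarrow> A \<in> W" and x: "[x] \<in> W"
    and L: "\<And>A. A \<in> W \<Longrightarrow> (\<Sum>w\<in>#shuffle [x] A. L w) = 0"
    and L': "\<And>A. A \<in> W \<Longrightarrow> (\<Sum>w\<in>#shuffle [x] A. L' w) = 0"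
    and base: "\<And>u. u \<in> W \<Longrightarrow> u = [] \<or> hd u \<noteq> x \<Longrightarrow> L u = L' u"
    and u: "u \<in> W"
  shows "L u = L' u"
  using u
proof (induction u rule: leading_letter_induct[where x = x])
  case (base w)
  then show ?case using assms(6) by blast
next
  case (power n)
  then have "replicate n x \<in> W" using W_tl by simp
  from L[OF this] L'[OF this] show ?case
    unfolding sum_shuffle_letter_power_Nil by (simp del: of_nat_Suc replicate.simps)
next
  case (step n c v)
  let ?A = "replicate n x @ c # v"
  have A: "?A \<in> W" using step.prems W_tl by auto
  have "L (replicate n x @ c # y) = L' (replicate n x @ c # y)" if y: "y \<in># shuffle [x] v" for y
  proof -
    have "replicate n x @ c # y \<in># shuffle [x] ?A"
      unfolding shuffle_letter_power[OF step(1)] using y by auto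
    then show ?thesis using W_sh[OF x A] step(2)[OF y] by auto
  qed
  then have "(\<Sum>w\<in>#shuffle [x] v. L (replicate n x @ c # w)) =
      (\<Sum>w\<in>#shuffle [x] v. L' (replicate n x @ c # w))"
    by (intro arg_cong[where f = sum_mset] image_mset_cong)
  with L[OF A] L'[OF A]
  have "of_nat (Suc n) * L (replicate (Suc n) x @ c # v) = of_nat (Suc n) * L' (replicate (Suc n) x @ c # v)"
    unfolding sum_shuffle_letter_power[OF step(1)] by (metis add_right_imp_eq)
  then show ?case by (simp del: of_nat_Suc replicate.simps append.simps)
qed

section \<open>Characters of the shuffle algebra modulo an ideal\<close>

text \<open>Dual to deconcatenation of words, or equally the product of two noncommutative
  generating series. Together with \<open>counit\<close> and \<open>antipode\<close> it describes
  the group of characters of the shuffle Hopf algebra.\<close>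

definition conv :: "('a list \<Rightarrow> 'r) \<Rightarrow> ('a list \<Rightarrow> 'r) \<Rightarrow> 'a list \<Rightarrow> 'r::comm_ring_1" where
  "conv \<phi> \<psi> w = (\<Sum>i\<le>length w. \<phi> (take i w) * \<psi> (drop i w))"

definition counit :: "'a list \<Rightarrow> 'r::comm_ring_1" where
  "counit w = (if w = [] then 1 else 0)"

definition antipode :: "('a list \<Rightarrow> 'r) \<Rightarrow> 'a list \<Rightarrow> 'r::comm_ring_1" where
  "antipode \<phi> w = (- 1) ^ length w * \<phi> (rev w)"

lemma conv_Nil [simp]: "conv \<phi> \<psi> [] = \<phi> [] * \<psi> []"
  by (simp add: conv_def)

lemma conv_Cons: "conv \<phi> \<psi> (a # w) = \<phi> [] * \<psi> (a # w) + conv (\<lambda>u. \<phi> (a # u)) \<psi> w"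
  by (simp add: conv_def sum.atMost_Suc_shift del: sum.atMost_Suc)

text \<open>Removing the first letter turns a convolution into a linear combination of two functions
  of the tail, which is the form met in the induction for associativity.\<close>

lemma conv_linear_left:
  "conv (\<lambda>u. k * f u + g u) \<theta> w = k * conv f \<theta> w + conv g \<theta> w"
  by (simp add: conv_def sum.distrib sum_distrib_left algebra_simps)

lemma conv_assoc: "conv (conv \<phi> \<psi>) \<theta> w = conv \<phi> (conv \<psi> \<theta>) w"
  by (induction w arbitrary: \<phi> \<psi>) (simp_all add: conv_Cons conv_linear_left algebra_simps)

lemma conv_counit_left [simp]: "conv counit \<phi> w = \<phi> w"
proof (cases w)
  case (Cons a v)
  then show ?thesis by (simp add: conv_Cons) (simp add: conv_def counit_def)
qed (simp add: counit_def)

text \<open>Cutting a shuffle of u and v into two pieces amounts to cutting u and v separately and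
  shuffling prefixes with prefixes and suffixes with suffixes: deconcatenation is multiplicative for
  the shuffle product.\<close>

lemma conv_shuffle:
  fixes \<phi> \<psi> :: "'a list \<Rightarrow> 'r::comm_ring_1"
  shows "(\<Sum>w\<in>#shuffle u v. conv \<phi> \<psi> w) =
    (\<Sum>i\<le>length u. \<Sum>j\<le>length v. (\<Sum>w\<in>#shuffle (take i u) (take j v). \<phi> w)
       * (\<Sum>w\<in>#shuffle (drop i u) (drop j v). \<psi> w))"
proof (induction u v arbitrary: \<phi> rule: shuffle.induct)
  case (1 v)
  then show ?case by (simp add: conv_def)
next
  case (2 a u)
  then show ?case by (simp add: conv_def)
next
  case (3 a u b v)
  let ?P = "\<lambda>i j. \<Sum>w\<in>#shuffle (drop i (a # u)) (drop j (b # v)). \<psi> w"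
  let ?L = "\<lambda>i j. (\<Sum>w\<in>#shuffle (take i u) (take j (b # v)). \<phi> (a # w))"
  let ?R = "\<lambda>i j. (\<Sum>w\<in>#shuffle (take i (a # u)) (take j v). \<phi> (b # w))"
  let ?F = "\<lambda>i j. (\<Sum>w\<in>#shuffle (take i (a # u)) (take j (b # v)). \<phi> w)"
  \<comment> \<open>On the grid of cut positions, \<open>?L\<close> and \<open>?R\<close> collect
    the prefix shuffles beginning with a and with b. The corner is the empty prefix, and each edge
    carries only one of the two kinds.\<close>
  have F: "?F 0 0 = \<phi> []" "?F (Suc i) 0 = ?L i 0" "?F 0 (Suc j) = ?R 0 j"
    "?F (Suc i) (Suc j) = ?L i (Suc j) + ?R (Suc i) j" for i j
    by (simp_all add: multiset.map_comp comp_def)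
  have "(\<Sum>w\<in>#shuffle (a # u) (b # v). conv \<phi> \<psi> w) =
     \<phi> [] * (\<Sum>w\<in>#shuffle (a # u) (b # v). \<psi> w)
     + (\<Sum>w\<in>#shuffle u (b # v). conv (\<lambda>y. \<phi> (a # y)) \<psi> w)
     + (\<Sum>w\<in>#shuffle (a # u) v. conv (\<lambda>y. \<phi> (b # y)) \<psi> w)"
    unfolding shuffle.simps(3) image_mset_union sum_mset.union multiset.map_comp comp_def conv_Cons
      sum_mset_distrib_add sum_mset_distrib_left[symmetric] distrib_left
    by (simp only: ac_simps)
  also have "\<dots> = \<phi> [] * ?P 0 0
     + (\<Sum>i\<le>length u. \<Sum>j\<le>Suc (length v). ?L i j * ?P (Suc i) j)
     + (\<Sum>i\<le>Suc (length u). \<Sum>j\<le>length v. ?R i j * ?P i (Suc j))"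
    unfolding 3 by (simp del: sum.atMost_Suc)
  also have "(\<Sum>i\<le>length u. \<Sum>j\<le>Suc (length v). ?L i j * ?P (Suc i) j) =
     (\<Sum>i\<le>length u. ?L i 0 * ?P (Suc i) 0) + (\<Sum>i\<le>length u. \<Sum>j\<le>length v. ?L i (Suc j) * ?P (Suc i) (Suc j))"
    by (simp add: sum.atMost_Suc_shift sum.distrib del: sum.atMost_Suc)
  also have "(\<Sum>i\<le>Suc (length u). \<Sum>j\<le>length v. ?R i j * ?P i (Suc j)) =
     (\<Sum>j\<le>length v. ?R 0 j * ?P 0 (Suc j)) + (\<Sum>i\<le>length u. \<Sum>j\<le>length v. ?R (Suc i) j * ?P (Suc i) (Suc j))"
    by (simp add: sum.atMost_Suc_shift sum.distrib del: sum.atMost_Suc)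
  also have "\<phi> [] * ?P 0 0
     + ((\<Sum>i\<le>length u. ?L i 0 * ?P (Suc i) 0) + (\<Sum>i\<le>length u. \<Sum>j\<le>length v. ?L i (Suc j) * ?P (Suc i) (Suc j)))
     + ((\<Sum>j\<le>length v. ?R 0 j * ?P 0 (Suc j)) + (\<Sum>i\<le>length u. \<Sum>j\<le>length v. ?R (Suc i) j * ?P (Suc i) (Suc j)))
     = ?F 0 0 * ?P 0 0 + (\<Sum>j\<le>length v. ?F 0 (Suc j) * ?P 0 (Suc j))
     + ((\<Sum>i\<le>length u. ?F (Suc i) 0 * ?P (Suc i) 0)
       + (\<Sum>i\<le>length u. \<Sum>j\<le>length v. ?F (Suc i) (Suc j) * ?P (Suc i) (Suc j)))"
    unfolding F distrib_right sum.distrib by (simp only: ac_simps)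
  also have "\<dots> = (\<Sum>i\<le>Suc (length u). \<Sum>j\<le>Suc (length v). ?F i j * ?P i j)"
    by (simp add: sum.atMost_Suc_shift sum.distrib del: sum.atMost_Suc)
  finally show ?case by simp
qed

locale subring_of =
  fixes C :: "'r::comm_ring_1 set"
  assumes C_one: "1 \<in> C" and C_add: "\<And>x y. x \<in> C \<Longrightarrow> y \<in> C \<Longrightarrow> x + y \<in> C"
    and C_uminus: "\<And>x. x \<in> C \<Longrightarrow> - x \<in> C" and C_mult: "\<And>x y. x \<in> C \<Longrightarrow> y \<in> C \<Longrightarrow> x * y \<in> C"
begin

lemma C_zero: "0 \<in> C" using C_add[OF C_one C_uminus[OF C_one]] by simp

lemma C_diff: "x \<in> C \<Longrightarrow> y \<in> C \<Longrightarrow> x - y \<in> C"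
  using C_add[of x "- y"] C_uminus by simp

lemma C_sum: "(\<And>i. i \<in> I \<Longrightarrow> f i \<in> C) \<Longrightarrow> (\<Sum>i\<in>I. f i) \<in> C"
  by (induction I rule: infinite_finite_induct) (auto simp: C_zero C_add)

lemma C_prod: "(\<And>i. i \<in> I \<Longrightarrow> f i \<in> C) \<Longrightarrow> (\<Prod>i\<in>I. f i) \<in> C"
  by (induction I rule: infinite_finite_induct) (auto simp: C_one C_mult)

lemma C_power: "x \<in> C \<Longrightarrow> x ^ n \<in> C"
  by (induction n) (auto simp: C_one C_mult)

lemma C_sum_mset: "(\<And>i. i \<in># M \<Longrightarrow> f i \<in> C) \<Longrightarrow> (\<Sum>i\<in>#M. f i) \<in> C"
  by (induction M) (auto simp: C_zero C_add)

lemma C_prod_mset: "(\<And>i. i \<in># M \<Longrightarrow> f i \<in> C) \<Longrightarrow> (\<Prod>i\<in>#M. f i) \<in> C"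
  by (induction M) (auto simp: C_one C_mult)

lemma C_sign: "(- 1) ^ n \<in> C"
  by (intro C_power C_uminus C_one)

end

text \<open>The quotient C / J is never formed: maps into it are functions into C whose identities
  hold modulo J. Taking for J a Goncharov ideal or {0} in the complex numbers covers both
  uses.\<close>

locale ideal_of_subring = subring_of C for C :: "'r::comm_ring_1 set" +
  fixes J :: "'r set"
  assumes J_sub: "J \<subseteq> C" and J_zero: "0 \<in> J" and J_add: "\<And>x y. x \<in> J \<Longrightarrow> y \<in> J \<Longrightarrow> x + y \<in> J"
    and J_mult: "\<And>x y. x \<in> C \<Longrightarrow> y \<in> J \<Longrightarrow> x * y \<in> J"
begin

definition cg :: "'r \<Rightarrow> 'r \<Rightarrow> bool" (infix "\<equiv>\<^sub>J" 50) where
  "x \<equiv>\<^sub>J y \<longleftrightarrow> x - y \<in> J"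

lemma J_mult_right: "x \<in> J \<Longrightarrow> y \<in> C \<Longrightarrow> x * y \<in> J"
  using J_mult[of y x] by (simp add: mult.commute)

lemma J_uminus: "x \<in> J \<Longrightarrow> - x \<in> J"
  using J_mult[of "- 1" x] C_uminus[OF C_one] by simp

lemma J_diff: "x \<in> J \<Longrightarrow> y \<in> J \<Longrightarrow> x - y \<in> J"
  using J_add[of x "- y"] J_uminus by simp

lemma J_sum: "(\<And>i. i \<in> I \<Longrightarrow> f i \<in> J) \<Longrightarrow> (\<Sum>i\<in>I. f i) \<in> J"
  by (induction I rule: infinite_finite_induct) (auto simp: J_zero J_add)

lemma cg_refl [simp]: "x \<equiv>\<^sub>J x" by (simp add: cg_def J_zero)

lemma cg_sym: "x \<equiv>\<^sub>J y \<Longrightarrow> y \<equiv>\<^sub>J x"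
  unfolding cg_def using J_uminus by fastforce

lemma cg_trans [trans]: "x \<equiv>\<^sub>J y \<Longrightarrow> y \<equiv>\<^sub>J z \<Longrightarrow> x \<equiv>\<^sub>J z"
  unfolding cg_def using J_add by fastforce

lemma cg_trans' [trans]: "x \<equiv>\<^sub>J y \<Longrightarrow> y = z \<Longrightarrow> x \<equiv>\<^sub>J z" "x = y \<Longrightarrow> y \<equiv>\<^sub>J z \<Longrightarrow> x \<equiv>\<^sub>J z"
  by auto

lemma cg_mult:
  assumes "x \<equiv>\<^sub>J y" "x' \<equiv>\<^sub>J y'" "x \<in> C" "y' \<in> C"
  shows "x * x' \<equiv>\<^sub>J y * y'"
proof -
  have "x * x' - y * y' = x * (x' - y') + (x - y) * y'" by (simp add: algebra_simps)
  then show ?thesis unfolding cg_def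
    using J_add[OF J_mult[OF assms(3)] J_mult_right[OF _ assms(4)]] assms(1,2)[unfolded cg_def]
    by simp
qed

lemma cg_sum: "(\<And>i. i \<in> I \<Longrightarrow> f i \<equiv>\<^sub>J g i) \<Longrightarrow> (\<Sum>i\<in>I. f i) \<equiv>\<^sub>J (\<Sum>i\<in>I. g i)"
  unfolding cg_def sum_subtractf[symmetric] by (rule J_sum)

definition is_char :: "'a set \<Rightarrow> ('a list \<Rightarrow> 'r) \<Rightarrow> bool" where
  "is_char S \<phi> \<longleftrightarrow> (\<forall>u\<in>lists S. \<phi> u \<in> C) \<and> \<phi> [] \<equiv>\<^sub>J 1 \<and>
     (\<forall>u\<in>lists S. \<forall>v\<in>lists S. \<phi> u * \<phi> v \<equiv>\<^sub>J (\<Sum>w\<in>#shuffle u v. \<phi> w))"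

lemma lists_shuffle: "w \<in># shuffle u v \<Longrightarrow> u \<in> lists S \<Longrightarrow> v \<in> lists S \<Longrightarrow> w \<in> lists S"
  using set_shuffle[of w u v] by (auto simp: in_lists_conv_set)

lemma lists_take_drop: "u \<in> lists S \<Longrightarrow> take i u \<in> lists S" "u \<in> lists S \<Longrightarrow> drop i u \<in> lists S"
  by (auto simp: in_lists_conv_set dest: in_set_takeD in_set_dropD)

lemma lists_rev: "u \<in> lists S \<Longrightarrow> rev u \<in> lists S"
  by (auto simp: in_lists_conv_set)

lemma is_char_counit: "is_char S counit"
proof -
  have "counit u * counit v = (\<Sum>w\<in>#shuffle u v. counit w :: 'r)" for u v :: "'a list"
    by (cases u; cases v) (auto simp: counit_def multiset.map_comp comp_def)
  moreover have "counit u \<in> C" for u :: "'a list" by (simp add: counit_def C_zero C_one)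
  moreover have "counit ([] :: 'a list) = (1 :: 'r)" by (simp add: counit_def)
  ultimately show ?thesis unfolding is_char_def by simp
qed

lemma is_char_C: "is_char S \<phi> \<Longrightarrow> u \<in> lists S \<Longrightarrow> \<phi> u \<in> C"
  by (simp add: is_char_def)

lemma is_char_Nil: "is_char S \<phi> \<Longrightarrow> \<phi> [] \<equiv>\<^sub>J 1"
  by (simp add: is_char_def)

lemma is_char_mult:
  "is_char S \<phi> \<Longrightarrow> u \<in> lists S \<Longrightarrow> v \<in> lists S \<Longrightarrow> \<phi> u * \<phi> v \<equiv>\<^sub>J (\<Sum>w\<in>#shuffle u v. \<phi> w)"
  by (simp add: is_char_def)

lemma is_char_C_shuffle:
  "is_char S \<phi> \<Longrightarrow> u \<in> lists S \<Longrightarrow> v \<in> lists S \<Longrightarrow> (\<Sum>w\<in>#shuffle u v. \<phi> w) \<in> C"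
  by (rule C_sum_mset, rule is_char_C, assumption, rule lists_shuffle)

lemma C_conv:
  assumes "\<And>u. u \<in> lists S \<Longrightarrow> \<phi> u \<in> C" "\<And>u. u \<in> lists S \<Longrightarrow> \<psi> u \<in> C" "w \<in> lists S"
  shows "conv \<phi> \<psi> w \<in> C"
  unfolding conv_def by (intro C_sum C_mult assms lists_take_drop)

lemma cg_conv:
  assumes "\<And>u. u \<in> lists S \<Longrightarrow> \<phi> u \<equiv>\<^sub>J \<phi>' u" "\<And>u. u \<in> lists S \<Longrightarrow> \<psi> u \<equiv>\<^sub>J \<psi>' u"
    "\<And>u. u \<in> lists S \<Longrightarrow> \<phi> u \<in> C" "\<And>u. u \<in> lists S \<Longrightarrow> \<psi>' u \<in> C"
    "w \<in> lists S"
  shows "conv \<phi> \<psi> w \<equiv>\<^sub>J conv \<phi>' \<psi>' w"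
  unfolding conv_def by (intro cg_sum cg_mult assms lists_take_drop)

lemma is_char_conv:
  assumes \<phi>: "is_char S \<phi>" and \<psi>: "is_char S \<psi>"
  shows "is_char S (conv \<phi> \<psi>)"
proof -
  have \<phi>C: "\<phi> u \<in> C" if "u \<in> lists S" for u using \<phi> that by (simp add: is_char_def)
  have \<psi>C: "\<psi> u \<in> C" if "u \<in> lists S" for u using \<psi> that by (simp add: is_char_def)
  have "conv \<phi> \<psi> u * conv \<phi> \<psi> v \<equiv>\<^sub>J (\<Sum>w\<in>#shuffle u v. conv \<phi> \<psi> w)"
    if u: "u \<in> lists S" and v: "v \<in> lists S" for u v
  proof -
    have "conv \<phi> \<psi> u * conv \<phi> \<psi> v = (\<Sum>i\<le>length u. \<Sum>j\<le>length v.
       (\<phi> (take i u) * \<phi> (take j v)) * (\<psi> (drop i u) * \<psi> (drop j v)))"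
      by (simp add: conv_def sum_product algebra_simps)
    also have "\<dots> \<equiv>\<^sub>J (\<Sum>i\<le>length u. \<Sum>j\<le>length v. (\<Sum>w\<in>#shuffle (take i u) (take j v). \<phi> w)
       * (\<Sum>w\<in>#shuffle (drop i u) (drop j v). \<psi> w))"
      by (intro cg_sum cg_mult C_mult \<phi>C lists_take_drop is_char_mult[OF \<phi>] is_char_mult[OF \<psi>]
          is_char_C_shuffle[OF \<psi>] u v)
    finally show ?thesis by (simp add: conv_shuffle)
  qed
  moreover have "\<phi> [] * \<psi> [] \<equiv>\<^sub>J 1 * 1"
    using \<phi> \<psi> C_one by (intro cg_mult) (auto simp: is_char_def)
  ultimately show ?thesis unfolding is_char_def by (auto intro!: C_conv \<phi>C \<psi>C)
qed

lemma is_char_antipode: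
  assumes \<phi>: "is_char S \<phi>"
  shows "is_char S (antipode \<phi>)"
proof -
  have "antipode \<phi> u * antipode \<phi> v \<equiv>\<^sub>J (\<Sum>w\<in>#shuffle u v. antipode \<phi> w)"
    if u: "u \<in> lists S" and v: "v \<in> lists S" for u v
  proof -
    have "antipode \<phi> u * antipode \<phi> v = (- 1) ^ (length u + length v) * (\<phi> (rev u) * \<phi> (rev v))"
      by (simp add: antipode_def power_add)
    also have "\<dots> \<equiv>\<^sub>J (- 1) ^ (length u + length v) * (\<Sum>w\<in>#shuffle (rev u) (rev v). \<phi> w)"
      by (intro cg_mult C_sign cg_refl lists_rev is_char_mult[OF \<phi>] is_char_C_shuffle[OF \<phi>] u v)
    also have "\<dots> = (\<Sum>w\<in>#shuffle u v. (- 1) ^ (length u + length v) * \<phi> (rev w))"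
      unfolding shuffle_rev by (simp add: multiset.map_comp comp_def sum_mset_distrib_left)
    also have "\<dots> = (\<Sum>w\<in>#shuffle u v. antipode \<phi> w)"
      by (intro arg_cong[where f = sum_mset] image_mset_cong) (simp add: antipode_def length_shuffle)
    finally show ?thesis .
  qed
  moreover have "antipode \<phi> u \<in> C" if "u \<in> lists S" for u
    unfolding antipode_def by (intro C_mult C_sign is_char_C[OF \<phi>] lists_rev that)
  moreover have "antipode \<phi> [] \<equiv>\<^sub>J 1" using is_char_Nil[OF \<phi>] by (simp add: antipode_def)
  ultimately show ?thesis unfolding is_char_def by simp
qed

text \<open>For nonempty w, the shuffle of a reversed prefix with the complementary suffix splits by
  first letter into two parts, and the second part at a cut is the first part at the next cut. With
  the signs of the antipode the sum over all cuts telescopes.\<close>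

lemma conv_antipode_left:
  assumes \<phi>: "is_char S \<phi>" and w: "w \<in> lists S"
  shows "conv (antipode \<phi>) \<phi> w \<equiv>\<^sub>J counit w"
proof (cases "w = []")
  case True
  have "\<phi> [] * \<phi> [] \<equiv>\<^sub>J 1 * 1" using \<phi> C_one by (intro cg_mult) (auto simp: is_char_def)
  then show ?thesis using True by (simp add: antipode_def counit_def)
next
  case False
  define n where "n = length w"
  have n: "n > 0" using False by (simp add: n_def)
  \<comment> \<open>The words that begin with the last letter of the prefix \<open>take i w\<close>.
    The value 0 at i = 0 and i = n + 1 makes the splitting \<open>T\<close> hold at both ends, where
    only one kind of first letter exists.\<close>
  define B where "B i = (if i = 0 \<or> i > n then 0 else
    \<Sum>y\<in>#shuffle (rev (take (i - 1) w)) (drop i w). \<phi> (w ! (i - 1) # y))" for i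
  have T: "(\<Sum>y\<in>#shuffle (rev (take i w)) (drop i w). \<phi> y) = B i + B (Suc i)" if "i \<le> n" for i
  proof -
    have d: "drop i w = w ! i # drop (Suc i) w" if "i < n"
      using that by (simp add: n_def Cons_nth_drop_Suc)
    have t: "rev (take i w) = w ! (i - 1) # rev (take (i - 1) w)" if "i > 0"
      using that \<open>i \<le> n\<close> by (cases i) (simp_all add: n_def take_Suc_conv_app_nth)
    consider "i = 0" | "i = n" "i > 0" | "0 < i" "i < n" using \<open>i \<le> n\<close> by linarith
    then show ?thesis
    proof cases
      case 1
      then show ?thesis using n by (cases w) (simp_all add: B_def n_def)
    next
      case 2
      then have e: "drop i w = []" by (simp add: n_def)
      show ?thesis unfolding e t[OF 2(2)] using 2 by (simp add: B_def e[unfolded 2(1)])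
    next
      case 3
      have "shuffle (rev (take i w)) (drop i w) =
         image_mset ((#) (w ! (i - 1))) (shuffle (rev (take (i - 1) w)) (drop i w))
         + image_mset ((#) (w ! i)) (shuffle (rev (take i w)) (drop (Suc i) w))"
        using shuffle.simps(3)[of "w ! (i - 1)" "rev (take (i - 1) w)" "w ! i" "drop (Suc i) w"]
        unfolding t[OF 3(1), symmetric] d[OF 3(2), symmetric] .
      moreover have "B i = (\<Sum>y\<in>#shuffle (rev (take (i - 1) w)) (drop i w). \<phi> (w ! (i - 1) # y))"
        "B (Suc i) = (\<Sum>y\<in>#shuffle (rev (take i w)) (drop (Suc i) w). \<phi> (w ! i # y))"
        using 3 by (simp_all add: B_def)
      ultimately show ?thesis by (simp only: image_mset_union sum_mset.union multiset.map_comp comp_def)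
    qed
  qed
  have tel: "(\<Sum>i\<le>m. (- 1) ^ i * (B i + B (Suc i))) = (- 1) ^ m * B (Suc m)" for m
  proof (induction m)
    case 0
    show ?case by (simp add: B_def)
  next
    case (Suc m)
    then show ?case by (simp add: algebra_simps)
  qed
  have "conv (antipode \<phi>) \<phi> w = (\<Sum>i\<le>n. (- 1) ^ i * (\<phi> (rev (take i w)) * \<phi> (drop i w)))"
    unfolding conv_def antipode_def n_def by (intro sum.cong) (simp_all add: min_def mult.assoc)
  also have "\<dots> \<equiv>\<^sub>J (\<Sum>i\<le>n. (- 1) ^ i * (\<Sum>y\<in>#shuffle (rev (take i w)) (drop i w). \<phi> y))"
    by (intro cg_sum cg_mult C_sign cg_refl lists_rev lists_take_drop is_char_mult[OF \<phi>]
        is_char_C_shuffle[OF \<phi>] w)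
  also have "\<dots> = (\<Sum>i\<le>n. (- 1) ^ i * (B i + B (Suc i)))"
    using T by (intro sum.cong) auto
  also have "\<dots> = 0" unfolding tel by (simp add: B_def)
  finally show ?thesis using False by (simp add: counit_def)
qed

lemma conv_antipode_right:
  assumes "is_char S \<phi>" "w \<in> lists S"
  shows "conv \<phi> (antipode \<phi>) w \<equiv>\<^sub>J counit w"
proof -
  have "antipode (antipode \<phi>) = \<phi>"
    by (simp add: antipode_def fun_eq_iff)
  with conv_antipode_left[OF is_char_antipode[OF assms(1)] assms(2)] show ?thesis by simp
qed

end

section \<open>Polynomial algebras, tensor squares and Goncharov's ideals\<close>

section \<open>Linear maps on finitely supported functions\<close>

abbreviation "lookup \<equiv> Poly_Mapping.lookup"
abbreviation "keys \<equiv> Poly_Mapping.keys"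
abbreviation "single \<equiv> Poly_Mapping.single"

lemma pm_expand:
  fixes p :: "'a \<Rightarrow>\<^sub>0 'b::comm_monoid_add"
  shows "p = (\<Sum>k\<in>keys p. single k (lookup p k))"
proof (rule poly_mapping_eqI)
  fix k
  have "(\<Sum>k'\<in>keys p. lookup (single k' (lookup p k')) k) = (\<Sum>k'\<in>keys p. if k' = k then lookup p k else 0)"
    by (intro sum.cong) (auto simp: lookup_single when_def)
  then show "lookup p k = lookup (\<Sum>k\<in>keys p. single k (lookup p k)) k"
    by (auto simp: lookup_sum sum.delta in_keys_iff)
qed

lemma pm_induct [case_names zero single add]:
  fixes p :: "'a \<Rightarrow>\<^sub>0 'b::comm_monoid_add"
  assumes "P 0" "\<And>k c. P (single k c)" "\<And>p q. P p \<Longrightarrow> P q \<Longrightarrow> P (p + q)"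
  shows "P p"
proof -
  have "P (\<Sum>k\<in>A. single k (lookup p k))" for A
    by (induction A rule: infinite_finite_induct) (auto intro: assms)
  from this[of "keys p"] show ?thesis by (simp flip: pm_expand)
qed

lemma additive_diff:
  fixes h :: "'a::ab_group_add \<Rightarrow> 'b::ab_group_add"
  assumes "\<And>p q. h (p + q) = h p + h q"
  shows "h (p - q) = h p - h q"
  using assms[of "p - q" q] by simp

lemma additive_sum:
  fixes h :: "'a::ab_group_add \<Rightarrow> 'b::ab_group_add"
  assumes "\<And>p q. h (p + q) = h p + h q"
  shows "h (\<Sum>i\<in>I. f i) = (\<Sum>i\<in>I. h (f i))"
proof -
  have "h 0 = 0" using assms[of 0 0] by simp
  then show ?thesis by (induction I rule: infinite_finite_induct) (auto simp: assms)
qed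

lemma additive_sum_mset:
  fixes h :: "'a::ab_group_add \<Rightarrow> 'b::ab_group_add"
  assumes "\<And>p q. h (p + q) = h p + h q"
  shows "h (\<Sum>i\<in>#M. f i) = (\<Sum>i\<in>#M. h (f i))"
proof -
  have "h 0 = 0" using assms[of 0 0] by simp
  then show ?thesis by (induction M) (auto simp: assms)
qed

lemma single_sum: "single k (\<Sum>i\<in>I. f i) = (\<Sum>i\<in>I. single k (f i))"
  by (induction I rule: infinite_finite_induct) (auto simp: single_add)

lemma scalar_mult: "scalar (c * d) = scalar c * scalar d"
  by (simp add: mult_single)

lemma multiplicative_ext:
  fixes h :: "('m::monoid_add \<Rightarrow>\<^sub>0 complex) \<Rightarrow> 'r::comm_ring_1"
  assumes add: "\<And>p q. h (p + q) = h p + h q"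
    and mult: "\<And>k l c d. h (single k c * single l d) = h (single k c) * h (single l d)"
  shows "h (p * q) = h p * h q"
proof (induction p rule: pm_induct)
  case zero
  show ?case using add[of 0 0] by simp
next
  case (single k c)
  show ?case
  proof (induction q rule: pm_induct)
    case zero
    show ?case using add[of 0 0] by simp
  next
    case (single l d)
    show ?case by (rule mult)
  next
    case (add q r)
    then show ?case by (simp add: distrib_left assms(1))
  qed
next
  case (add p r)
  then show ?case by (simp add: distrib_right assms(1))
qed

lemma linear_ext_add: "linear_ext f (p + q) = linear_ext f p + linear_ext f q"
  unfolding linear_ext_def
  by (rule setsum_keys_plus_distrib[where f = "\<lambda>w a. a * f w"]) (auto simp: algebra_simps)

lemma linear_ext_zero [simp]: "linear_ext f 0 = 0"
  by (simp add: linear_ext_def)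

lemma linear_ext_single [simp]: "linear_ext f (single k c) = c * f k"
  by (cases "c = 0") (simp_all add: linear_ext_def)

lemma linear_ext_sum: "linear_ext f (\<Sum>i\<in>I. p i) = (\<Sum>i\<in>I. linear_ext f (p i))"
  by (rule additive_sum) (rule linear_ext_add)

lemma linear_ext_mult:
  fixes f :: "'m::comm_monoid_add \<Rightarrow> complex"
  assumes "\<And>a b. f (a + b) = f a * f b"
  shows "linear_ext f (p * q) = linear_ext f p * linear_ext f q"
  by (rule multiplicative_ext) (simp_all add: linear_ext_add mult_single assms)

text \<open>The common shape of \<open>poly_hom\<close> and \<open>tensor_map\<close>, so that their
  linearity is established once.\<close>

definition lin_map :: "('a \<Rightarrow> ('m::comm_monoid_add \<Rightarrow>\<^sub>0 complex)) \<Rightarrow> ('a \<Rightarrow>\<^sub>0 complex) \<Rightarrow> ('m \<Rightarrow>\<^sub>0 complex)" where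
  "lin_map F D = (\<Sum>u\<in>keys D. scalar (lookup D u) * F u)"

lemma lin_map_add: "lin_map F (p + q) = lin_map F p + lin_map F q"
  unfolding lin_map_def
  by (rule setsum_keys_plus_distrib[where f = "\<lambda>w a. scalar a * F w"]) (auto simp: algebra_simps single_add)

lemma lin_map_zero [simp]: "lin_map F 0 = 0"
  by (simp add: lin_map_def)

lemma lin_map_single [simp]: "lin_map F (single k c) = scalar c * F k"
  by (cases "c = 0") (simp_all add: lin_map_def)

lemma lin_map_sum: "lin_map F (\<Sum>i\<in>I. p i) = (\<Sum>i\<in>I. lin_map F (p i))"
  by (rule additive_sum) (rule lin_map_add)

lemma lin_map_diff: "lin_map F (p - q) = lin_map F p - lin_map F q"
  by (rule additive_diff) (rule lin_map_add)

lemma poly_hom_eq_lin_map: "poly_hom f = lin_map (\<lambda>m. prod_mset (image_mset f m))"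
  by (simp add: fun_eq_iff poly_hom_def lin_map_def)

lemma tensor_map_eq_lin_map: "tensor_map F = lin_map (\<lambda>(u, v). tensor (F u) (F v))"
  by (simp add: fun_eq_iff tensor_map_def lin_map_def case_prod_unfold)

lemma poly_hom_add: "poly_hom f (p + q) = poly_hom f p + poly_hom f q"
  unfolding poly_hom_eq_lin_map by (rule lin_map_add)

lemma poly_hom_mult: "poly_hom f (p * q) = poly_hom f p * poly_hom f q"
  unfolding poly_hom_eq_lin_map
proof (rule multiplicative_ext)
  fix k l c d
  let ?h = "lin_map (\<lambda>m. prod_mset (image_mset f m))"
  have "?h (single k c * single l d) = scalar (c * d) * (prod_mset (image_mset f k) * prod_mset (image_mset f l))"
    by (simp add: mult_single)
  also have "\<dots> = ?h (single k c) * ?h (single l d)"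
    by (simp only: scalar_mult lin_map_single ac_simps)
  finally show "?h (single k c * single l d) = ?h (single k c) * ?h (single l d)" .
qed (rule lin_map_add)

lemma poly_hom_scalar [simp]: "poly_hom f (scalar c) = scalar c"
  by (simp add: poly_hom_eq_lin_map)

lemma poly_hom_one [simp]: "poly_hom f 1 = 1"
  using poly_hom_scalar[of f 1] by simp

lemma poly_hom_var [simp]: "poly_hom f (var g) = f g"
  by (simp add: poly_hom_eq_lin_map var_def)

lemma poly_hom_sum: "poly_hom f (\<Sum>i\<in>I. p i) = (\<Sum>i\<in>I. poly_hom f (p i))"
  by (rule additive_sum) (rule poly_hom_add)

lemma single_eq_prod_var: "single m 1 = (\<Prod>g\<in>#m. var g)"
proof (induction m)
  case empty
  then show ?case by simp
next
  case (add g m)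
  have "single (add_mset g m) (1 :: complex) = single {#g#} 1 * single m 1" by (simp add: mult_single)
  with add.IH show ?case by (simp add: var_def)
qed

lemma single_eq_scalar_mult: "single m c = scalar c * single m 1"
  by (simp add: mult_single)

section \<open>Tensors\<close>

lemma tensor_add_left: "tensor (p + p') q = tensor p q + tensor p' q"
  unfolding tensor_def
  by (rule setsum_keys_plus_distrib[where f = "\<lambda>m a. \<Sum>m'\<in>keys q. single (m, m') (a * lookup q m')"])
    (simp_all add: distrib_right single_add sum.distrib)

lemma tensor_add_right: "tensor p (q + q') = tensor p q + tensor p q'"
proof -
  have eq: "tensor p q = (\<Sum>m'\<in>keys q. \<Sum>m\<in>keys p. single (m, m') (lookup p m * lookup q m'))" for q
    unfolding tensor_def by (rule sum.swap)
  show ?thesis unfolding eq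
    by (rule setsum_keys_plus_distrib[where f = "\<lambda>m' a. \<Sum>m\<in>keys p. single (m, m') (lookup p m * a)"])
      (simp_all add: distrib_left single_add sum.distrib)
qed

lemma tensor_zero [simp]: "tensor 0 q = 0" "tensor p 0 = 0"
  by (simp_all add: tensor_def)

lemma tensor_single: "tensor (single m a) (single m' b) = single (m, m') (a * b)"
  by (cases "a = 0"; cases "b = 0") (simp_all add: tensor_def)

lemma tensor_diff_left: "tensor (p - p') q = tensor p q - tensor p' q"
  by (rule additive_diff[where h = "\<lambda>p. tensor p q"]) (rule tensor_add_left)

lemma tensor_diff_right: "tensor p (q - q') = tensor p q - tensor p q'"
  by (rule additive_diff[where h = "tensor p"]) (rule tensor_add_right)

lemma tensor_sum_left: "tensor (\<Sum>i\<in>I. f i) q = (\<Sum>i\<in>I. tensor (f i) q)"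
  by (rule additive_sum[where h = "\<lambda>p. tensor p q"]) (rule tensor_add_left)

lemma tensor_sum_right: "tensor p (\<Sum>i\<in>I. f i) = (\<Sum>i\<in>I. tensor p (f i))"
  by (rule additive_sum[where h = "tensor p"]) (rule tensor_add_right)

text \<open>Writes a pure tensor as a product, so that membership in \<open>ideal_I0_2\<close>
  follows from its generators, which are tensors with 1.\<close>

lemma tensor_eq_mult: "tensor p q = tensor p 1 * tensor 1 q"
proof -
  have one: "(1 :: poly1) = single 0 1" by simp
  show ?thesis
  proof (induction p rule: pm_induct)
    case zero
    show ?case by simp
  next
    case (single k c)
    show ?case
    proof (induction q rule: pm_induct)
      case zero
      show ?case by simp
    next
      case (single l d)
      show ?case unfolding one tensor_single mult_single by simp
    next
      case (add q r)
      then show ?case by (simp add: tensor_add_right distrib_left)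
    qed
  next
    case (add p r)
    then show ?case by (simp add: tensor_add_left distrib_right)
  qed
qed

lemma tensor_scalar_left: "tensor (scalar c * p) q = scalar c * tensor p q"
proof (induction p rule: pm_induct)
  case zero
  show ?case by simp
next
  case (single k d)
  show ?case
  proof (induction q rule: pm_induct)
    case (single l e)
    show ?case by (simp add: mult_single tensor_single zero_prod_def mult.assoc)
  qed (simp_all add: tensor_add_right distrib_left)
next
  case (add p q)
  then show ?case by (simp add: tensor_add_left distrib_left)
qed

lemma tensor_scalar_right: "tensor p (scalar c * q) = scalar c * tensor p q"
proof (induction q rule: pm_induct)
  case zero
  show ?case by simp
next
  case (single k d)
  show ?case
  proof (induction p rule: pm_induct)
    case (single l e)
    show ?case by (simp add: mult_single tensor_single zero_prod_def mult.left_commute)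
  qed (simp_all add: tensor_add_left distrib_left)
next
  case (add p q)
  then show ?case by (simp add: tensor_add_right distrib_left)
qed

section \<open>The ideals\<close>

lemma ring_on_ring:
  assumes "subring_of A"
  shows "ring (ring_on A)"
proof -
  interpret subring_of A by fact
  have inv: "\<exists>y\<in>A. y + x = 0" "\<exists>y\<in>A. x + y = 0" if "x \<in> A" for x
    using C_uminus[OF that] by (auto intro: bexI[of _ "- x"])
  show ?thesis
    unfolding ring_on_def
    by (intro ringI abelian_groupI Group.monoidI)
      (auto simp: C_one C_add C_mult C_zero algebra_simps inv)
qed

lemma ideal_of_subring_imp_ideal:
  assumes "ideal_of_subring A K"
  shows "ideal K (ring_on A)"
proof -
  interpret ideal_of_subring A K by fact
  interpret R: ring "ring_on A" by (rule ring_on_ring) (rule subring_of_axioms)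
  have minus: "inv\<^bsub>add_monoid (ring_on A)\<^esub> x \<in> K" if "x \<in> K" for x
  proof -
    have xA: "x \<in> carrier (ring_on A)" using that J_sub by (auto simp: ring_on_def)
    have "x \<oplus>\<^bsub>ring_on A\<^esub> (- x) = \<zero>\<^bsub>ring_on A\<^esub>" by (simp add: ring_on_def)
    moreover have "- x \<in> carrier (ring_on A)" using that J_sub C_uminus by (auto simp: ring_on_def)
    ultimately have "\<ominus>\<^bsub>ring_on A\<^esub> x = - x" using xA by (metis R.minus_equality R.a_comm)
    then show ?thesis using J_uminus[OF that] by (simp add: a_inv_def)
  qed
  show ?thesis
  proof (rule idealI[OF R.ring_axioms])
    show "subgroup K (add_monoid (ring_on A))"
      using J_sub J_zero J_add minus by (intro subgroup.intro) (auto simp: ring_on_def)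
  qed (auto simp: ring_on_def J_mult J_mult_right)
qed

lemma ideal_imp_ideal_of_subring:
  assumes "subring_of A" "ideal K (ring_on A)"
  shows "ideal_of_subring A K"
proof -
  interpret ideal K "ring_on A" by fact
  show ?thesis
    unfolding ideal_of_subring_def ideal_of_subring_axioms_def
    using assms(1) a_subset additive_subgroup.zero_closed[OF is_additive_subgroup]
      additive_subgroup.a_closed[OF is_additive_subgroup] I_l_closed by (auto simp: ring_on_def)
qed

text \<open>Passage from generated ideals in record-based rings to plain sets. The third part is the
  tool for proving a property of all elements of the ideal: those having it form an ideal that
  contains the generators.\<close>

lemma genideal_on:
  assumes "subring_of A" "Z \<subseteq> A"
  shows "ideal_of_subring A (genideal (ring_on A) Z)" "Z \<subseteq> genideal (ring_on A) Z"
    "\<And>K. ideal_of_subring A K \<Longrightarrow> Z \<subseteq> K \<Longrightarrow> genideal (ring_on A) Z \<subseteq> K"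
proof -
  interpret R: ring "ring_on A" by (rule ring_on_ring) fact
  have Z: "Z \<subseteq> carrier (ring_on A)" using assms(2) by (simp add: ring_on_def)
  show "ideal_of_subring A (genideal (ring_on A) Z)"
    by (rule ideal_imp_ideal_of_subring[OF assms(1) R.genideal_ideal[OF Z]])
  show "Z \<subseteq> genideal (ring_on A) Z" by (rule R.genideal_self[OF Z])
  show "genideal (ring_on A) Z \<subseteq> K" if "ideal_of_subring A K" "Z \<subseteq> K" for K
    by (rule R.genideal_minimal[OF ideal_of_subring_imp_ideal[OF that(1)] that(2)])
qed

definition F1 :: "complex set \<Rightarrow> poly1 set" where
  "F1 S = {p. \<forall>m\<in>keys p. set_mset m \<subseteq> gens S}"

definition F2 :: "complex set \<Rightarrow> poly2 set" where
  "F2 S = {p. \<forall>(m, m')\<in>keys p. set_mset m \<subseteq> gens S \<and> set_mset m' \<subseteq> gens S}"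

lemma free1_eq: "free1 S = ring_on (F1 S)" and free2_eq: "free2 S = ring_on (F2 S)"
  by (simp_all add: free1_def F1_def free2_def F2_def)

lemma subring_F1: "subring_of (F1 S)"
proof
  fix p q assume p: "p \<in> F1 S" and q: "q \<in> F1 S"
  show "p + q \<in> F1 S" using p q keys_add[of p q] by (auto simp: F1_def)
  show "- p \<in> F1 S" using p by (auto simp: F1_def in_keys_iff)
  show "p * q \<in> F1 S" using p q keys_mult[of p q] by (fastforce simp: F1_def)
qed (auto simp: F1_def)

lemma subring_F2: "subring_of (F2 S)"
proof
  fix p q assume p: "p \<in> F2 S" and q: "q \<in> F2 S"
  show "p + q \<in> F2 S" using p q keys_add[of p q] unfolding F2_def by blast
  show "- p \<in> F2 S" using p by (auto simp: F2_def in_keys_iff)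
  show "p * q \<in> F2 S" using p q keys_mult[of p q] by (fastforce simp: F2_def)
qed (auto simp: F2_def zero_prod_def)

lemma scalar_F1 [simp]: "scalar c \<in> F1 S"
  by (cases "c = 0") (auto simp: F1_def)

lemma scalar_F2 [simp]: "scalar c \<in> F2 S"
  by (cases "c = 0") (auto simp: F2_def zero_prod_def)

lemma var_F1 [simp]: "var g \<in> F1 S \<longleftrightarrow> g \<in> gens S"
  by (simp add: F1_def var_def)

lemma tensor_F2: "p \<in> F1 S \<Longrightarrow> q \<in> F1 S \<Longrightarrow> tensor p q \<in> F2 S"
  unfolding tensor_def
  by (intro subring_of.C_sum[OF subring_F2]) (auto simp: F1_def F2_def split: if_splits)

lemma F1_mono: "T \<subseteq> S \<Longrightarrow> F1 T \<subseteq> F1 S" and F2_mono: "T \<subseteq> S \<Longrightarrow> F2 T \<subseteq> F2 S"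
  by (fastforce simp: F1_def F2_def gens_def)+

definition all_relations :: "complex set \<Rightarrow> poly1 set" where
  "all_relations S = goncharov_relations S \<union> {var (0, [0], b) | b. b \<in> S \<and> b \<noteq> 0}"

lemma all_relations_subset:
  assumes "\<And>b c. b \<in> S \<Longrightarrow> c \<in> S \<Longrightarrow> var (b, [], c) - 1 \<in> K"
    and "\<And>b c u v. b \<in> S \<Longrightarrow> c \<in> S \<Longrightarrow> set u \<subseteq> S \<Longrightarrow> set v \<subseteq> S \<Longrightarrow>
      var (b, u, c) * var (b, v, c) - (\<Sum>w\<in>#shuffle u v. var (b, w, c)) \<in> K"
    and "\<And>b c d u. b \<in> S \<Longrightarrow> c \<in> S \<Longrightarrow> d \<in> S \<Longrightarrow> set u \<subseteq> S \<Longrightarrow>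
      var (b, u, d) - (\<Sum>i\<le>length u. var (b, take i u, c) * var (c, drop i u, d)) \<in> K"
    and "\<And>b u. b \<in> S \<Longrightarrow> set u \<subseteq> S \<Longrightarrow> u \<noteq> [] \<Longrightarrow> var (b, u, b) \<in> K"
    and "\<And>b. b \<in> S \<Longrightarrow> b \<noteq> 0 \<Longrightarrow> var (0, [0], b) \<in> K"
  shows "all_relations S \<subseteq> K"
  unfolding all_relations_def goncharov_relations_def
  by (intro Un_least subsetI; elim CollectE exE conjE; hypsubst; rule assms; assumption)

lemma relations_F1: "0 \<in> S \<Longrightarrow> all_relations S \<subseteq> F1 S"
proof -
  assume 0: "0 \<in> S"
  interpret subring_of "F1 S" by (rule subring_F1)
  have *: "(\<Sum>w\<in>#shuffle u v. var (b, w, c)) \<in> F1 S"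
    if "b \<in> S" "c \<in> S" "set u \<subseteq> S" "set v \<subseteq> S" for b c u v
  proof (rule C_sum_mset)
    fix w assume "w \<in># shuffle u v"
    from set_shuffle[OF this] show "var (b, w, c) \<in> F1 S" using that by (simp add: gens_def)
  qed
  have **: "(\<Sum>i\<le>length u. var (b, take i u, c) * var (c, drop i u, d)) \<in> F1 S"
    if "b \<in> S" "c \<in> S" "d \<in> S" "set u \<subseteq> S" for b c d u
    using that set_take_subset[of _ u] set_drop_subset[of _ u]
    by (intro C_sum C_mult) (simp_all add: gens_def subset_trans[OF _ that(4)])
  show ?thesis
  proof (rule all_relations_subset)
    show "var (b, [], c) - 1 \<in> F1 S" if "b \<in> S" "c \<in> S" for b c
      using that by (intro C_diff C_one) (simp add: gens_def)
    show "var (b, u, c) * var (b, v, c) - (\<Sum>w\<in>#shuffle u v. var (b, w, c)) \<in> F1 S"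
      if "b \<in> S" "c \<in> S" "set u \<subseteq> S" "set v \<subseteq> S" for b c u v
      using that by (intro C_diff C_mult *) (simp_all add: gens_def)
    show "var (b, u, d) - (\<Sum>i\<le>length u. var (b, take i u, c) * var (c, drop i u, d)) \<in> F1 S"
      if "b \<in> S" "c \<in> S" "d \<in> S" "set u \<subseteq> S" for b c d u
      using that by (intro C_diff **) (simp_all add: gens_def)
  qed (use 0 in \<open>simp_all add: gens_def\<close>)
qed

lemma all_relations_mono: "T \<subseteq> S \<Longrightarrow> all_relations T \<subseteq> all_relations S"
  unfolding all_relations_def goncharov_relations_def
  by (intro Un_mono Collect_mono impI; elim exE conjE; intro exI conjI, assumption; simp add: subset_iff)

lemma ideal_I0_eq: "ideal_I0 S = genideal (ring_on (F1 S)) (all_relations S)"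
  by (simp add: ideal_I0_def free1_eq all_relations_def)

lemma ideal_I0: "0 \<in> S \<Longrightarrow> ideal_of_subring (F1 S) (ideal_I0 S)"
  unfolding ideal_I0_eq by (intro genideal_on subring_F1 relations_F1)

lemma relations_ideal_I0: "0 \<in> S \<Longrightarrow> all_relations S \<subseteq> ideal_I0 S"
  unfolding ideal_I0_eq by (intro genideal_on subring_F1 relations_F1)

lemma ideal_I0_minimal:
  "0 \<in> S \<Longrightarrow> ideal_of_subring (F1 S) K \<Longrightarrow> all_relations S \<subseteq> K \<Longrightarrow> ideal_I0 S \<subseteq> K"
  unfolding ideal_I0_eq by (intro genideal_on(3) subring_F1 relations_F1)

text \<open>Lets congruences at level 1 be read at level N, whose letters include 0 and 1. The level
  N ideal, cut down to polynomials in the smaller alphabet, is an ideal there and contains the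
  smaller set of relations.\<close>

lemma ideal_I0_mono:
  assumes "T \<subseteq> S" "0 \<in> T"
  shows "ideal_I0 T \<subseteq> ideal_I0 S"
proof -
  have "0 \<in> S" using assms by auto
  interpret S: ideal_of_subring "F1 S" "ideal_I0 S" by (rule ideal_I0) fact
  interpret T: subring_of "F1 T" by (rule subring_F1)
  have "ideal_of_subring (F1 T) (F1 T \<inter> ideal_I0 S)"
  proof unfold_locales
    fix x y assume "x \<in> F1 T" "y \<in> F1 T \<inter> ideal_I0 S"
    then show "x * y \<in> F1 T \<inter> ideal_I0 S"
      using F1_mono[OF assms(1)] S.J_mult[of x y] T.C_mult[of x y] by blast
  qed (simp_all add: S.J_zero S.J_add T.C_zero T.C_add)
  then show ?thesis
    using ideal_I0_minimal[OF assms(2)] relations_F1[OF assms(2)]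
      all_relations_mono[OF assms(1)] relations_ideal_I0[OF \<open>0 \<in> S\<close>] by blast
qed

lemma
  assumes "0 \<in> S"
  shows ideal_I0_2: "ideal_of_subring (F2 S) (ideal_I0_2 S)"
    and tensor_ideal_left: "\<And>p q. p \<in> ideal_I0 S \<Longrightarrow> q \<in> F1 S \<Longrightarrow> tensor p q \<in> ideal_I0_2 S"
    and tensor_ideal_right: "\<And>p q. p \<in> F1 S \<Longrightarrow> q \<in> ideal_I0 S \<Longrightarrow> tensor p q \<in> ideal_I0_2 S"
    and ideal_I0_2_minimal: "\<And>K. ideal_of_subring (F2 S) K \<Longrightarrow>
      (\<And>p. p \<in> ideal_I0 S \<Longrightarrow> tensor p 1 \<in> K) \<Longrightarrow> (\<And>p. p \<in> ideal_I0 S \<Longrightarrow> tensor 1 p \<in> K)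
      \<Longrightarrow> ideal_I0_2 S \<subseteq> K"
proof -
  interpret I: ideal_of_subring "F1 S" "ideal_I0 S" by (rule ideal_I0) fact
  let ?Z = "{tensor p 1 | p. p \<in> ideal_I0 S} \<union> {tensor 1 p | p. p \<in> ideal_I0 S}"
  have Z: "?Z \<subseteq> F2 S" using I.J_sub I.C_one by (auto intro!: tensor_F2)
  have eq: "ideal_I0_2 S = genideal (ring_on (F2 S)) ?Z" by (simp add: ideal_I0_2_def free2_eq)
  note gen = genideal_on[OF subring_F2 Z, folded eq]
  show I2: "ideal_of_subring (F2 S) (ideal_I0_2 S)" by (rule gen(1))
  interpret I2: ideal_of_subring "F2 S" "ideal_I0_2 S" by (rule I2)
  show "tensor p q \<in> ideal_I0_2 S" if "p \<in> ideal_I0 S" "q \<in> F1 S" for p q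
    using I2.J_mult_right[of "tensor p 1" "tensor 1 q"] gen(2) that tensor_F2[OF I.C_one that(2)]
    by (subst tensor_eq_mult) blast
  show "tensor p q \<in> ideal_I0_2 S" if "p \<in> F1 S" "q \<in> ideal_I0 S" for p q
    using I2.J_mult[of "tensor p 1" "tensor 1 q"] gen(2) that tensor_F2[OF that(1) I.C_one]
    by (subst tensor_eq_mult) blast
  show "ideal_I0_2 S \<subseteq> K" if "ideal_of_subring (F2 S) K"
      "\<And>p. p \<in> ideal_I0 S \<Longrightarrow> tensor p 1 \<in> K" "\<And>p. p \<in> ideal_I0 S \<Longrightarrow> tensor 1 p \<in> K" for K
    by (rule gen(3)[OF that(1)]) (use that in blast)
qed

section \<open>Characters of Goncharov's algebra\<close>

definition path_char :: "('e \<Rightarrow> 'a list \<Rightarrow> 'r::comm_ring_1) \<Rightarrow> 'e \<times> 'a list \<times> 'e \<Rightarrow> 'r" where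
  "path_char g = (\<lambda>(b, u, c). conv (antipode (g b)) (g c) u)"

context ideal_of_subring
begin

text \<open>
  Think of \<open>g c\<close> as the transport from the base point \<open>0\<close> to \<open>c\<close>; the transport from
  \<open>b\<close> to \<open>c\<close> is then \<open>(g b)\<^sup>-\<^sup>1 g c\<close>.
\<close>

lemma path_char_ideal:
  fixes h :: "poly1 \<Rightarrow> 'r" and g :: "complex \<Rightarrow> complex list \<Rightarrow> 'r"
  assumes S: "0 \<in> S"
    and g: "\<And>c. c \<in> S \<Longrightarrow> is_char S (g c)" and g0: "g 0 = counit" and gx: "\<And>c. c \<in> S \<Longrightarrow> g c [0] \<in> J"
    and h_add: "\<And>p q. h (p + q) = h p + h q" and h_mult: "\<And>p q. h (p * q) = h p * h q"
    and h_one: "h 1 = 1" and h_var: "\<And>a. a \<in> gens S \<Longrightarrow> h (var a) = path_char g a"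
    and h_C: "\<And>p. p \<in> F1 S \<Longrightarrow> h p \<in> C" and p: "p \<in> ideal_I0 S"
  shows "h p \<in> J"
proof -
  interpret F: subring_of "F1 S" by (rule subring_F1)
  have h_zero: "h 0 = 0" using h_add[of 0 0] by simp
  note h_diff = additive_diff[of h, OF h_add] and h_sum = additive_sum[of h, OF h_add]
    and h_sum_mset = additive_sum_mset[of h, OF h_add]
  let ?e = "\<lambda>b u c. conv (antipode (g b)) (g c) u"
  have e: "h (var (b, u, c)) = ?e b u c" if "b \<in> S" "c \<in> S" "set u \<subseteq> S" for b u c
    using that by (simp add: h_var gens_def path_char_def)
  have e_char: "is_char S (conv (antipode (g b)) (g c))" if "b \<in> S" "c \<in> S" for b c
    using that by (intro is_char_conv is_char_antipode g)
  have r1: "h (var (b, [], c) - 1) \<in> J" if "b \<in> S" "c \<in> S" for b c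
    using is_char_Nil[OF e_char[OF that]] that
    by (simp only: h_diff e h_one cg_def list.set empty_subsetI)
  have r2: "h (var (b, u, c) * var (b, v, c) - (\<Sum>w\<in>#shuffle u v. var (b, w, c))) \<in> J"
    if "b \<in> S" "c \<in> S" "set u \<subseteq> S" "set v \<subseteq> S" for b c u v
  proof -
    have "(\<Sum>w\<in>#shuffle u v. h (var (b, w, c))) = (\<Sum>w\<in>#shuffle u v. ?e b w c)"
      by (intro arg_cong[where f = sum_mset] image_mset_cong e that)
        (use that set_shuffle in fastforce)
    then show ?thesis
      using is_char_mult[OF e_char[OF that(1,2)], of u v] that
      by (simp add: h_diff h_mult h_sum_mset e cg_def in_lists_conv_set subset_iff)
  qed
  have r3: "h (var (b, u, d) - (\<Sum>i\<le>length u. var (b, take i u, c) * var (c, drop i u, d))) \<in> J"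
    if S: "b \<in> S" "c \<in> S" "d \<in> S" and u: "set u \<subseteq> S" for b c d u
  proof -
    have ul: "u \<in> lists S" using u by auto
    have "(\<Sum>i\<le>length u. h (var (b, take i u, c) * var (c, drop i u, d))) =
        conv (conv (antipode (g b)) (g c)) (conv (antipode (g c)) (g d)) u"
      unfolding conv_def[of "conv (antipode (g b)) (g c)" "conv (antipode (g c)) (g d)"]
      using S u set_take_subset[of _ u] set_drop_subset[of _ u]
      by (intro sum.cong refl) (simp add: h_mult e subset_trans[OF _ u])
    \<comment> \<open>Path composition is the cancellation of \<open>g c\<close> against its inverse
      in the group of characters; it holds modulo J only, so it must be inserted by congruence
      inside the outer convolutions.\<close>
    also have "\<dots> = conv (antipode (g b)) (conv (conv (g c) (antipode (g c))) (g d)) u"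
      by (simp only: conv_assoc[THEN ext])
    also have "\<dots> \<equiv>\<^sub>J conv (antipode (g b)) (conv counit (g d)) u"
    proof (rule cg_conv[where S = S])
      fix u assume u: "u \<in> lists S"
      show "conv (conv (g c) (antipode (g c))) (g d) u \<equiv>\<^sub>J conv counit (g d) u"
        by (rule cg_conv[where S = S], erule conv_antipode_right[OF g[OF S(2)]], rule cg_refl,
            erule is_char_C[OF is_char_conv[OF g[OF S(2)] is_char_antipode[OF g[OF S(2)]]]],
            erule is_char_C[OF g[OF S(3)]], rule u)
      show "conv counit (g d) u \<in> C"
        unfolding conv_counit_left by (rule is_char_C[OF g[OF S(3)] u])
      show "antipode (g b) u \<in> C" by (rule is_char_C[OF is_char_antipode[OF g[OF S(1)]] u])
    qed (use ul in simp_all)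
    also have "\<dots> = h (var (b, u, d))" using S u by (simp add: e conv_counit_left[THEN ext])
    finally show ?thesis using cg_sym by (simp add: h_diff h_sum cg_def)
  qed
  have r4: "h (var (b, u, b)) \<in> J" if "b \<in> S" "set u \<subseteq> S" "u \<noteq> []" for b u
    using conv_antipode_left[OF g[OF that(1)], of u] that
    by (simp add: e cg_def counit_def in_lists_conv_set subset_iff)
  have ac: "antipode counit = (counit :: complex list \<Rightarrow> 'r)"
    by (auto simp: antipode_def counit_def fun_eq_iff)
  have r5: "h (var (0, [0], b)) \<in> J" if "b \<in> S" for b
    using gx[OF that] S that by (simp add: e g0 ac)
  \<comment> \<open>The preimage of J under h is an ideal containing every relation, hence the whole
    ideal generated by them.\<close>
  have "ideal_of_subring (F1 S) {p \<in> F1 S. h p \<in> J}"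
    by unfold_locales
      (auto simp: F.C_zero F.C_add F.C_mult h_zero J_zero h_add J_add h_mult intro: J_mult h_C)
  moreover have "all_relations S \<subseteq> {p. h p \<in> J}"
    by (rule all_relations_subset) (rule CollectI, rule r1 r2 r3 r4 r5; assumption)+
  then have "all_relations S \<subseteq> {p \<in> F1 S. h p \<in> J}"
    using relations_F1[OF S] by blast
  ultimately have "ideal_I0 S \<subseteq> {p \<in> F1 S. h p \<in> J}" by (intro ideal_I0_minimal S)
  with p show ?thesis by auto
qed

end

section \<open>Generation\<close>

lemma scalar_of_nat_Suc:
  fixes p :: "'a::comm_monoid_add \<Rightarrow>\<^sub>0 complex"
  shows "scalar (1 / of_nat (Suc n)) * (of_nat (Suc n) * p) = p"
proof -
  have "(1 / of_nat (Suc n)) * of_nat (Suc n) = (1 :: complex)" by (simp del: of_nat_Suc)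
  then have "scalar ((1 / of_nat (Suc n)) * of_nat (Suc n)) = (1 :: 'a \<Rightarrow>\<^sub>0 complex)"
    by (simp only: single_one)
  then have "scalar (1 / of_nat (Suc n)) * scalar (of_nat (Suc n)) * p = p"
    by (simp only: scalar_mult mult_1)
  then show ?thesis by (simp only: mult.assoc single_of_nat)
qed

lemma sum_mset_closed:
  assumes "0 \<in> K" "\<And>p q. p \<in> K \<Longrightarrow> q \<in> K \<Longrightarrow> p + q \<in> K" "\<And>i. i \<in># M \<Longrightarrow> f i \<in> K"
  shows "(\<Sum>i\<in>#M. f i) \<in> K"
  using assms(3) by (induction M) (auto simp: assms(1,2))

locale goncharov =
  fixes S :: "complex set"
  assumes zero_S: "0 \<in> S"
begin

sublocale ideal_of_subring "F1 S" "ideal_I0 S" by (rule ideal_I0) (rule zero_S)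

sublocale J2: ideal_of_subring "F2 S" "ideal_I0_2 S" by (rule ideal_I0_2) (rule zero_S)

lemma relation_in_ideal: "p \<in> all_relations S \<Longrightarrow> p \<in> ideal_I0 S"
  using relations_ideal_I0[OF zero_S] by blast

lemma var_Nil: "b \<in> S \<Longrightarrow> c \<in> S \<Longrightarrow> var (b, [], c) - 1 \<in> ideal_I0 S"
  by (rule relation_in_ideal, unfold all_relations_def goncharov_relations_def, (rule UnI1)+)
    (intro CollectI exI conjI, rule refl, assumption+)

lemma var_shuffle: "b \<in> S \<Longrightarrow> c \<in> S \<Longrightarrow> set u \<subseteq> S \<Longrightarrow> set v \<subseteq> S \<Longrightarrow>
    var (b, u, c) * var (b, v, c) - (\<Sum>w\<in>#shuffle u v. var (b, w, c)) \<in> ideal_I0 S"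
  by (rule relation_in_ideal, unfold all_relations_def goncharov_relations_def,
      rule UnI1, rule UnI1, rule UnI1, rule UnI2)
    (intro CollectI exI conjI, rule refl, assumption+)

lemma var_path: "b \<in> S \<Longrightarrow> c \<in> S \<Longrightarrow> d \<in> S \<Longrightarrow> set u \<subseteq> S \<Longrightarrow>
    var (b, u, d) - (\<Sum>i\<le>length u. var (b, take i u, c) * var (c, drop i u, d)) \<in> ideal_I0 S"
  by (rule relation_in_ideal, unfold all_relations_def goncharov_relations_def,
      rule UnI1, rule UnI1, rule UnI2)
    (intro CollectI exI conjI, rule refl, assumption+)

lemma var_loop: "b \<in> S \<Longrightarrow> set u \<subseteq> S \<Longrightarrow> u \<noteq> [] \<Longrightarrow> var (b, u, b) \<in> ideal_I0 S"
  by (rule relation_in_ideal, unfold all_relations_def goncharov_relations_def,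
      rule UnI1, rule UnI2)
    (intro CollectI exI conjI, rule refl, assumption+)

lemma var_zero: "b \<in> S \<Longrightarrow> b \<noteq> 0 \<Longrightarrow> var (0, [0], b) \<in> ideal_I0 S"
  by (rule relation_in_ideal, unfold all_relations_def goncharov_relations_def, rule UnI2)
    (intro CollectI exI conjI, rule refl, assumption+)

lemma J_of_diff: "x - y \<in> ideal_I0 S \<Longrightarrow> x \<in> ideal_I0 S \<Longrightarrow> y \<in> ideal_I0 S"
  using J_diff[of x "x - y"] by simp

text \<open>I(0;0;c) vanishes in the quotient, so the shuffle relation with it expresses a symbol
  with n + 1 leading zeros by symbols with n of them. Closure of \<open>K\<close> under sums and
  scalars suffices for this, which allows \<open>K\<close> to be the span of symbols as well as a
  subalgebra.\<close>

lemma subspace_leading_zeros: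
  assumes K_J: "ideal_I0 S \<subseteq> K" and K_add: "\<And>p q. p \<in> K \<Longrightarrow> q \<in> K \<Longrightarrow> p + q \<in> K"
    and K_scalar: "\<And>p c. p \<in> K \<Longrightarrow> scalar c * p \<in> K"
    and c: "c \<in> S" "c \<noteq> 0"
    and base: "\<And>u. u \<in> lists S \<Longrightarrow> u = [] \<or> hd u \<noteq> 0 \<Longrightarrow> var (0, u, c) \<in> K"
    and u: "u \<in> lists S"
  shows "var (0, u, c) \<in> K"
  using u
proof (induction u rule: leading_letter_induct[where x = 0])
  case (base w)
  then show ?case using assms(6) by blast
next
  case (power n)
  have "var (0, [0], c) * var (0, replicate n 0, c) -
      (\<Sum>w\<in>#shuffle [0] (replicate n 0). var (0, w, c)) \<in> ideal_I0 S"
    by (rule var_shuffle) (use zero_S c in auto)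
  moreover have "var (0, [0], c) * var (0, replicate n 0, c) \<in> ideal_I0 S"
    by (intro J_mult_right var_zero c) (use c zero_S in \<open>auto simp: gens_def\<close>)
  ultimately have "of_nat (Suc n) * var (0, replicate (Suc n) 0, c) \<in> ideal_I0 S"
    unfolding sum_shuffle_letter_power_Nil by (rule J_of_diff)
  then have "of_nat (Suc n) * var (0, replicate (Suc n) 0, c) \<in> K" using K_J by blast
  from K_scalar[OF this, of "1 / of_nat (Suc n)"] show ?case by (simp only: scalar_of_nat_Suc)
next
  case (step n d v)
  let ?A = "replicate n 0 @ d # v"
  have A: "set ?A \<subseteq> S" and v: "v \<in> lists S" using step.prems by auto
  have sum: "(\<Sum>w\<in>#shuffle [0] v. var (0, replicate n 0 @ d # w, c)) \<in> K"
  proof -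
    have *: "var (0, replicate n 0 @ d # w, c) \<in> K" if "w \<in># shuffle [0] v" for w
    proof -
      have "w \<in> lists S" using lists_shuffle[OF that _ v] zero_S by simp
      then show ?thesis using step.prems by (intro step(2)[OF that]) simp
    qed
    have "0 \<in> K" using K_J J_zero by auto
    show ?thesis by (rule sum_mset_closed[OF \<open>0 \<in> K\<close> K_add *])
  qed
  have "var (0, [0], c) * var (0, ?A, c) - (\<Sum>w\<in>#shuffle [0] ?A. var (0, w, c)) \<in> ideal_I0 S"
    by (rule var_shuffle) (use zero_S c A in auto)
  moreover have "var (0, [0], c) * var (0, ?A, c) \<in> ideal_I0 S"
    by (intro J_mult_right var_zero c) (use c zero_S A in \<open>auto simp: gens_def\<close>)
  ultimately have "of_nat (Suc n) * var (0, replicate (Suc n) 0 @ d # v, c)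
      + (\<Sum>w\<in>#shuffle [0] v. var (0, replicate n 0 @ d # w, c)) \<in> ideal_I0 S"
    unfolding sum_shuffle_letter_power[OF step(1)] by (rule J_of_diff)
  then have *: "of_nat (Suc n) * var (0, replicate (Suc n) 0 @ d # v, c)
      + (\<Sum>w\<in>#shuffle [0] v. var (0, replicate n 0 @ d # w, c)) \<in> K" using K_J by blast
  have "- (\<Sum>w\<in>#shuffle [0] v. var (0, replicate n 0 @ d # w, c)) \<in> K"
    using K_scalar[OF sum, of "- 1"] by (simp add: single_uminus)
  from K_add[OF * this] have "of_nat (Suc n) * var (0, replicate (Suc n) 0 @ d # v, c) \<in> K"
    by (simp only: add.assoc add.right_inverse add_0_right)
  from K_scalar[OF this, of "1 / of_nat (Suc n)"] show ?case by (simp only: scalar_of_nat_Suc)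
qed

text \<open>Path composition through 0 reduces a symbol to symbols that start or end at 0. Those
  from 0 to c \<noteq> 0 lose their leading zeros; those from b to 0 are obtained inductively,
  because the loop I(b;u;b) vanishes and its decomposition through 0 contains I(b;u;0) besides terms
  with shorter words from b to 0.\<close>

lemma generation:
  assumes K_J: "ideal_I0 S \<subseteq> K" and K_F: "K \<subseteq> F1 S"
    and K_add: "\<And>p q. p \<in> K \<Longrightarrow> q \<in> K \<Longrightarrow> p + q \<in> K"
    and K_mult: "\<And>p q. p \<in> K \<Longrightarrow> q \<in> K \<Longrightarrow> p * q \<in> K"
    and K_scalar: "\<And>c. scalar c \<in> K"
    and base: "\<And>c u. c \<in> S \<Longrightarrow> c \<noteq> 0 \<Longrightarrow> u \<in> lists S \<Longrightarrow> u = [] \<or> hd u \<noteq> 0 \<Longrightarrow> var (0, u, c) \<in> K"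
    and p: "p \<in> F1 S"
  shows "p \<in> K"
proof -
  have K_one: "1 \<in> K" using K_scalar[of 1] by simp
  have K_uminus: "- p \<in> K" if "p \<in> K" for p
    using K_mult[OF K_scalar[of "- 1"] that] by (simp add: single_uminus)
  have K_diff: "p - q \<in> K" if "p \<in> K" "q \<in> K" for p q
    using K_add[OF that(1) K_uminus[OF that(2)]] by simp
  interpret K: subring_of K by unfold_locales (auto intro: K_one K_add K_mult K_uminus)
  have nil: "var (b, [], c) \<in> K" if "b \<in> S" "c \<in> S" for b c
    using var_Nil[OF that] K_J K_add[of "var (b, [], c) - 1" 1] K_one by auto
  have from0: "var (0, u, c) \<in> K" if "c \<in> S" "u \<in> lists S" for u c
  proof (cases "c = 0")
    case True
    then show ?thesis using nil[of 0 0] var_loop[of 0 u] that K_J zero_S by (cases "u = []") auto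
  next
    case False
    show ?thesis
      by (rule subspace_leading_zeros[OF K_J K_add _ that(1) False]) (use K_mult K_scalar base that False in auto)
  qed
  have to0: "var (b, u, 0) \<in> K" if b: "b \<in> S" and u: "u \<in> lists S" for u b
    using u
  proof (induction "length u" arbitrary: u rule: less_induct)
    case less
    show ?case
    proof (cases "u = []")
      case True
      then show ?thesis using nil b zero_S by simp
    next
      case False
      let ?n = "length u"
      have "var (b, u, b) - (\<Sum>i\<le>?n. var (b, take i u, 0) * var (0, drop i u, b)) \<in> K"
        using var_path[of b 0 b u] b zero_S less.prems K_J by auto
      moreover have "var (b, u, b) \<in> K" using var_loop[of b u] False b less.prems K_J by auto
      ultimately have all: "(\<Sum>i\<le>?n. var (b, take i u, 0) * var (0, drop i u, b)) \<in> K"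
        using K_diff[of "var (b, u, b)" "var (b, u, b) - (\<Sum>i\<le>?n. var (b, take i u, 0) * var (0, drop i u, b))"]
        by simp
      have part: "(\<Sum>i<?n. var (b, take i u, 0) * var (0, drop i u, b)) \<in> K"
        by (intro K.C_sum K_mult from0 less.hyps lists_take_drop) (use less.prems b in auto)
      \<comment> \<open>The term i = length u is the wanted symbol times I(0; ;b), and the second
        factor is 1 modulo the ideal.\<close>
      have "(\<Sum>i\<le>?n. var (b, take i u, 0) * var (0, drop i u, b)) =
          (\<Sum>i<?n. var (b, take i u, 0) * var (0, drop i u, b)) + var (b, u, 0) * var (0, [], b)"
        by (simp flip: lessThan_Suc_atMost)
      with K_diff[OF all part] have "var (b, u, 0) * var (0, [], b) \<in> K" by simp
      moreover have "var (b, u, 0) * (var (0, [], b) - 1) \<in> K"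
        using J_mult[of "var (b, u, 0)" "var (0, [], b) - 1"] var_Nil[OF zero_S b] K_J b less.prems zero_S
        by (auto simp: gens_def)
      ultimately have "var (b, u, 0) * var (0, [], b) - var (b, u, 0) * (var (0, [], b) - 1) \<in> K"
        by (rule K_diff)
      then show ?thesis by (simp add: algebra_simps)
    qed
  qed
  have var: "var g \<in> K" if "g \<in> gens S" for g
  proof -
    obtain b u c where g0: "g = (b, u, c)" by (cases g)
    with that have g: "g = (b, u, c)" "b \<in> S" "c \<in> S" "u \<in> lists S"
      by (auto simp: gens_def in_lists_conv_set)
    have "var (b, u, c) - (\<Sum>i\<le>length u. var (b, take i u, 0) * var (0, drop i u, c)) \<in> K"
      using var_path[of b 0 c u] g zero_S K_J by auto
    moreover have "(\<Sum>i\<le>length u. var (b, take i u, 0) * var (0, drop i u, c)) \<in> K"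
      by (intro K.C_sum K_mult from0 to0 lists_take_drop) (use g in auto)
    ultimately have "var (b, u, c) - (\<Sum>i\<le>length u. var (b, take i u, 0) * var (0, drop i u, c))
        + (\<Sum>i\<le>length u. var (b, take i u, 0) * var (0, drop i u, c)) \<in> K" by (rule K_add)
    then show ?thesis using g by simp
  qed
  have "single m c \<in> K" if "set_mset m \<subseteq> gens S" for m c
    unfolding single_eq_scalar_mult[of m c] single_eq_prod_var
    by (intro K_mult K_scalar K.C_prod_mset var) (use that in auto)
  then have "(\<Sum>m\<in>keys p. single m (lookup p m)) \<in> K"
    using p by (intro K.C_sum) (auto simp: F1_def)
  then show ?thesis by (simp flip: pm_expand)
qed

end

section \<open>Level N: Fourier sums over residues, index words and the map \<mu>\<close>

section \<open>Roots of unity and index lists\<close>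

locale level =
  fixes N :: nat
  assumes N: "N \<ge> 1"
begin

lemma eta_nonzero [simp]: "\<eta> N \<noteq> 0"
  by (simp add: \<eta>_def)

lemma eta_powi: "\<eta> N powi k = exp (2 * of_real pi * \<i> * of_int k / of_nat N)"
  by (simp add: \<eta>_def exp_power_int algebra_simps)

lemma eta_powi_eq_1: "\<eta> N powi k = 1 \<longleftrightarrow> int N dvd k"
proof
  assume "\<eta> N powi k = 1"
  then obtain n :: int where "Im (2 * of_real pi * \<i> * of_int k / of_nat N) = of_int (2 * n) * pi"
    unfolding eta_powi exp_eq_1 by blast
  then have "real_of_int k = real_of_int (n * int N)" using N by (simp add: field_simps)
  then have "k = n * int N" by (simp only: of_int_eq_iff)
  then show "int N dvd k" by simp
next
  assume "int N dvd k"
  then obtain n where k: "k = int N * n" by blast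
  have "\<eta> N powi k = exp (of_int (2 * n) * of_real pi * \<i>)"
    unfolding eta_powi k using N by (simp add: field_simps)
  also have "\<dots> = 1" unfolding exp_eq_1 by (auto intro!: exI[of _ n])
  finally show "\<eta> N powi k = 1" .
qed

lemma eta_powi_eq_iff: "\<eta> N powi a = \<eta> N powi b \<longleftrightarrow> int N dvd a - b"
  by (simp add: power_int_diff flip: eta_powi_eq_1)

lemma eta_powi_mod: "\<eta> N powi (a mod int N) = \<eta> N powi a"
  unfolding eta_powi_eq_iff by (simp add: mod_eq_dvd_iff flip: mod_eq_dvd_iff)

lemma eta_powi_inj: "a \<in> residues_mod N \<Longrightarrow> b \<in> residues_mod N \<Longrightarrow> int N dvd a - b \<Longrightarrow> a = b"
  by (auto simp: residues_mod_def mod_eq_dvd_iff[symmetric])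

lemma mod_residues: "a mod int N \<in> residues_mod N"
  using N by (simp add: residues_mod_def)

lemma finite_residues [simp]: "finite (residues_mod N)"
  by (simp add: residues_mod_def)

lemma sum_eta: "(\<Sum>a\<in>residues_mod N. \<eta> N powi (a * m)) = (if int N dvd m then of_nat N else 0)"
proof -
  have "residues_mod N = int ` {..<N}"
    by (simp add: residues_mod_def image_int_atLeastLessThan lessThan_atLeast0)
  then have "(\<Sum>a\<in>residues_mod N. \<eta> N powi (a * m)) = (\<Sum>a<N. \<eta> N powi (int a * m))"
    by (simp add: sum.reindex)
  also have "\<dots> = (\<Sum>a<N. (\<eta> N powi m) ^ a)"
    by (intro sum.cong refl) (simp add: mult.commute power_int_mult)
  also have "\<dots> = (if int N dvd m then of_nat N else 0)"
  proof (cases "int N dvd m")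
    case True
    then have "\<eta> N powi m = 1" by (simp add: eta_powi_eq_1)
    with True show ?thesis by simp
  next
    case False
    then have "\<eta> N powi m \<noteq> 1" by (simp add: eta_powi_eq_1)
    moreover have "(\<eta> N powi m) ^ N = \<eta> N powi (m * int N)" by (simp add: power_int_mult)
    then have "(\<eta> N powi m) ^ N = 1" by (simp add: eta_powi_eq_1)
    ultimately show ?thesis using False by (simp add: geometric_sum)
  qed
  finally show ?thesis .
qed

lemma letter_set_iff: "x \<in> letter_set N \<longleftrightarrow> x = 0 \<or> (\<exists>a\<in>residues_mod N. x = \<eta> N powi a)"
proof
  assume "x \<in> letter_set N"
  then consider "x = 0" | k where "x = \<eta> N powi int k" by (auto simp: letter_set_def)
  then show "x = 0 \<or> (\<exists>a\<in>residues_mod N. x = \<eta> N powi a)"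
  proof cases
    case (2 k)
    then show ?thesis using eta_powi_mod[of "int k"] mod_residues[of "int k"] by metis
  qed simp
next
  assume "x = 0 \<or> (\<exists>a\<in>residues_mod N. x = \<eta> N powi a)"
  then consider "x = 0" | a where "a \<in> residues_mod N" "x = \<eta> N powi a" by blast
  then show "x \<in> letter_set N"
  proof cases
    case (2 a)
    \<comment> \<open>Residues start at 0, whereas \<open>letter_set\<close> takes exponents from 1
      to N; the residue 0 becomes the exponent N.\<close>
    define k where "k = (if a = 0 then N else nat a)"
    have "int N dvd int k - a" using 2 by (auto simp: k_def residues_mod_def)
    then have "x = \<eta> N powi int k" using 2 eta_powi_eq_iff by metis
    moreover have "k \<in> {1..N}" using 2 N by (auto simp: k_def residues_mod_def)
    ultimately show ?thesis by (auto simp: letter_set_def)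
  qed (simp add: letter_set_def)
qed

lemma eta_powi_letter [simp]: "\<eta> N powi k \<in> letter_set N"
  unfolding letter_set_iff using mod_residues[of k] eta_powi_mod[of k] by metis

lemma zero_letter [simp]: "0 \<in> letter_set N"
  by (simp add: letter_set_iff)

lemma one_letter [simp]: "1 \<in> letter_set N"
  using eta_powi_letter[of 0] by simp

text \<open>Serves the rotation of letters by \<mu>. For y = 0 the convention x / 0 = 0 gives a
  letter again.\<close>

lemma letter_divide: "x \<in> letter_set N \<Longrightarrow> y \<in> letter_set N \<Longrightarrow> x / y \<in> letter_set N"
proof -
  assume "x \<in> letter_set N" "y \<in> letter_set N"
  then consider "x / y = 0" | a b where "x = \<eta> N powi a" "y = \<eta> N powi b"
    by (auto simp: letter_set_iff)
  then show ?thesis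
  proof cases
    case (2 a b)
    then show ?thesis by (simp flip: power_int_diff)
  qed (metis zero_letter)
qed

end

lemma index_lists_0 [simp]: "index_lists N 0 = {[]}"
  by (auto simp: index_lists_def)

lemma index_lists_Suc:
  "index_lists N (Suc r) = (\<lambda>(a, as). a # as) ` (residues_mod N \<times> index_lists N r)"
  by (force simp: index_lists_def length_Suc_conv image_iff)

lemma finite_index_lists [simp]: "finite (index_lists N r)"
  by (induction r) (simp_all add: index_lists_Suc residues_mod_def)

lemma sum_index_lists_Suc:
  "(\<Sum>as\<in>index_lists N (Suc r). F as) = (\<Sum>a\<in>residues_mod N. \<Sum>as\<in>index_lists N r. F (a # as))"
proof -
  have "inj_on (\<lambda>(a, as). a # as) (residues_mod N \<times> index_lists N r)"
    by (auto simp: inj_on_def)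
  then show ?thesis
    unfolding index_lists_Suc by (simp add: sum.reindex sum.cartesian_product case_prod_unfold)
qed

definition dot :: "int list \<Rightarrow> int list \<Rightarrow> int" where
  "dot as bs = (\<Sum>j<length as. as ! j * bs ! j)"

lemma dot_Nil [simp]: "dot [] bs = 0"
  by (simp add: dot_def)

lemma dot_Cons [simp]: "dot (a # as) (b # bs) = a * b + dot as bs"
  unfolding dot_def by (simp add: sum.lessThan_Suc_shift del: sum.lessThan_Suc)

lemma dot_commute: "length as = length bs \<Longrightarrow> dot as bs = dot bs as"
  by (simp add: dot_def mult.commute)

lemma dot_diff:
  assumes "length as = length bs" "length bs = length cs"
  shows "dot (map2 (-) as bs) cs = dot as cs - dot bs cs"
  using assms by (induction as bs cs rule: list_induct3) (simp_all add: algebra_simps)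

text \<open>\<open>diffs\<close> with an arbitrary entry c in front of the list, the generalisation
  that inductions over the list require.\<close>

definition diffs_from :: "'a::ab_group_add \<Rightarrow> 'a list \<Rightarrow> 'a list" where
  "diffs_from c as = map2 (-) as (c # as)"

lemma diffs_from_simps [simp]:
  "diffs_from c [] = []" "diffs_from c (a # as) = (a - c) # diffs_from a as"
  by (simp_all add: diffs_from_def)

lemma diffs_eq: "diffs as = diffs_from 0 as"
  by (simp add: diffs_def diffs_from_def)

lemma length_diffs_from [simp]: "length (diffs_from c as) = length as"
  by (induction as arbitrary: c) auto

lemma length_diffs [simp]: "length (diffs (as :: 'a::ab_group_add list)) = length as"
  by (simp add: diffs_def)

context level
begin

lemma sum_eta_dot:
  "(\<Sum>as\<in>index_lists N (length ms). \<eta> N powi dot as ms) =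
     (if \<forall>m\<in>set ms. int N dvd m then of_nat N ^ length ms else 0)"
proof (induction ms)
  case (Cons m ms)
  have "(\<Sum>as\<in>index_lists N (length (m # ms)). \<eta> N powi dot as (m # ms)) =
     (\<Sum>a\<in>residues_mod N. \<eta> N powi (a * m)) * (\<Sum>as\<in>index_lists N (length ms). \<eta> N powi dot as ms)"
    by (simp add: sum_index_lists_Suc power_int_add sum_product)
  then show ?case unfolding Cons.IH sum_eta by simp
qed simp

lemma sum_eta_dot':
  "(\<Sum>bs\<in>index_lists N (length ms). \<eta> N powi dot ms bs) =
     (if \<forall>m\<in>set ms. int N dvd m then of_nat N ^ length ms else 0)"
  unfolding sum_eta_dot[symmetric]
  by (intro sum.cong refl) (simp add: index_lists_def dot_commute)

text \<open>Differences modulo N are a triangular change of variables, hence a bijection of index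
  lists: given the preceding entry, each new entry is translated by a constant. This removes
  \<open>rho\<close> from sums over all lower indices.\<close>

lemma sum_diffs_from:
  "(\<Sum>as\<in>index_lists N r. F (map (\<lambda>a. a mod int N) (diffs_from c as))) = (\<Sum>as\<in>index_lists N r. F as)"
proof (induction r arbitrary: c F)
  case (Suc r)
  have "(\<Sum>as\<in>index_lists N (Suc r). F (map (\<lambda>a. a mod int N) (diffs_from c as))) =
      (\<Sum>a\<in>residues_mod N. \<Sum>as\<in>index_lists N r. F ((a - c) mod int N # as))"
    unfolding sum_index_lists_Suc using Suc[of "\<lambda>as. F ((_ - c) mod int N # as)"] by simp
  also have "\<dots> = (\<Sum>a\<in>residues_mod N. \<Sum>as\<in>index_lists N r. F (a # as))"
    by (rule sum.reindex_bij_witness[where i = "\<lambda>a. (a + c) mod int N" and j = "\<lambda>a. (a - c) mod int N"])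
      (use N in \<open>auto simp: residues_mod_def mod_simps\<close>)
  finally show ?case unfolding sum_index_lists_Suc .
qed simp

lemma eta_dot_mod:
  assumes "length xs = length ms"
  shows "\<eta> N powi dot (map (\<lambda>a. a mod int N) xs) ms = \<eta> N powi dot xs ms"
  using assms
proof (induction xs ms rule: list_induct2)
  case (Cons x xs m ms)
  have "\<eta> N powi (x mod int N * m) = \<eta> N powi (x * m)"
    unfolding power_int_mult eta_powi_mod ..
  with Cons.IH show ?case by (simp add: power_int_add)
qed simp

lemma sum_eta_diffs:
  assumes "length ms = r"
  shows "(\<Sum>as\<in>index_lists N r. \<eta> N powi dot (diffs as) ms) =
     (if \<forall>m\<in>set ms. int N dvd m then of_nat N ^ r else 0)"
proof -
  have "(\<Sum>as\<in>index_lists N r. \<eta> N powi dot (diffs as) ms) =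
      (\<Sum>as\<in>index_lists N r. \<eta> N powi dot (map (\<lambda>a. a mod int N) (diffs_from 0 as)) ms)"
    unfolding diffs_eq
    by (intro sum.cong refl eta_dot_mod[symmetric]) (use assms in \<open>simp add: index_lists_def\<close>)
  also have "\<dots> = (\<Sum>as\<in>index_lists N r. \<eta> N powi dot as ms)"
    by (rule sum_diffs_from)
  finally show ?thesis using sum_eta_dot[of ms] assms by simp
qed

lemma diffs_from_inj:
  assumes "length as = length bs" "set as \<subseteq> residues_mod N" "set bs \<subseteq> residues_mod N"
    and "\<forall>m\<in>set (map2 (-) (diffs_from c as) (diffs_from c bs)). int N dvd m"
  shows "as = bs"
  using assms
proof (induction as bs arbitrary: c rule: list_induct2)
  case (Cons a as b bs)
  then have "a = b" by (intro eta_powi_inj) auto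
  with Cons show ?case by auto
qed simp

text \<open>The rows of the Fourier matrix that defines \<open>Itilde\<close> are orthogonal; for
  this, congruent differences must force equal index lists, entry by entry from the left.\<close>

lemma sum_eta_diffs_orthogonal:
  assumes as: "as \<in> index_lists N r" and as': "as' \<in> index_lists N r"
  shows "(\<Sum>bs\<in>index_lists N r. \<eta> N powi (dot (diffs as) bs - dot (diffs as') bs)) =
    (if as = as' then of_nat N ^ r else 0)"
proof -
  let ?ms = "map2 (-) (diffs as) (diffs as')"
  have len: "length as = r" "length as' = r" using as as' by (simp_all add: index_lists_def)
  have "(\<Sum>bs\<in>index_lists N r. \<eta> N powi (dot (diffs as) bs - dot (diffs as') bs)) =
      (\<Sum>bs\<in>index_lists N (length ?ms). \<eta> N powi dot ?ms bs)"
    using len by (intro sum.cong) (simp_all add: dot_diff index_lists_def)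
  also have "\<dots> = (if \<forall>m\<in>set ?ms. int N dvd m then of_nat N ^ r else 0)"
    unfolding sum_eta_dot' using len by simp
  also have "(\<forall>m\<in>set ?ms. int N dvd m) \<longleftrightarrow> as = as'"
  proof
    assume "\<forall>m\<in>set ?ms. int N dvd m"
    then show "as = as'"
      using as as' unfolding diffs_eq by (intro diffs_from_inj) (auto simp: index_lists_def)
  next
    assume "as = as'"
    then show "\<forall>m\<in>set ?ms. int N dvd m" by (auto simp: set_zip)
  qed
  finally show ?thesis .
qed

end

section \<open>Words over the roots of unity\<close>

definition cletters :: "nat \<Rightarrow> index_word \<Rightarrow> complex list" where
  "cletters N w = concat (map (\<lambda>(n, a). \<eta> N powi a # replicate (n - 1) 0) w)"

lemma cletters_simps [simp]:
  "cletters N [] = []" "cletters N ((n, a) # w) = \<eta> N powi a # replicate (n - 1) 0 @ cletters N w"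
  by (simp_all add: cletters_def)

lemma Isym_eq: "Isym N c w = var (0, cletters N w, \<eta> N powi c)"
  by (simp add: Isym_def cletters_def)

lemma H1_words_simps [simp]:
  "[] \<in> H1_words N" "(n, a) # w \<in> H1_words N \<longleftrightarrow> n \<ge> 1 \<and> a \<in> residues_mod N \<and> w \<in> H1_words N"
  by (auto simp: H1_words_def)

lemma zip_H1_words:
  assumes "\<forall>n\<in>set ns. n \<ge> 1" "as \<in> index_lists N (length ns)"
  shows "zip ns as \<in> H1_words N"
  using assms by (auto simp: H1_words_def index_lists_def dest: set_zip_leftD set_zip_rightD)

lemma H1_words_snd: "w \<in> H1_words N \<Longrightarrow> map snd w \<in> index_lists N (length w)"
  by (auto simp: H1_words_def index_lists_def)

lemma H1_words_fst: "w \<in> H1_words N \<Longrightarrow> \<forall>n\<in>set (map fst w). n \<ge> 1"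
  by (auto simp: H1_words_def)

lemma replicate_append_eq:
  assumes "replicate m x @ u = replicate n x @ v" "u = [] \<or> hd u \<noteq> x" "v = [] \<or> hd v \<noteq> x"
  shows "m = n \<and> u = v"
  using assms
proof (induction m arbitrary: n)
  case 0
  then show ?case by (cases n) auto
next
  case (Suc m)
  then show ?case by (cases n) auto
qed

context level
begin

lemma hd_cletters: "cletters N w = [] \<or> hd (cletters N w) \<noteq> 0"
  by (cases w) auto

lemma cletters_lists: "cletters N w \<in> lists (letter_set N)"
  by (induction w) auto

lemma set_cletters: "set (cletters N w) \<subseteq> letter_set N"
  using cletters_lists by auto

lemma cletters_inj:
  "w \<in> H1_words N \<Longrightarrow> w' \<in> H1_words N \<Longrightarrow> cletters N w = cletters N w' \<Longrightarrow> w = w'"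
proof (induction w arbitrary: w')
  case Nil
  then show ?case by (cases w') auto
next
  case (Cons p w)
  obtain n a where p: "p = (n, a)" by (cases p)
  obtain n' a' w'' where w': "w' = (n', a') # w''" using Cons.prems p by (cases w') auto
  have "a = a'" using Cons.prems p w' by (auto intro: eta_powi_inj simp: eta_powi_eq_iff)
  moreover have "n - 1 = n' - 1 \<and> cletters N w = cletters N w''"
    using Cons.prems p w' hd_cletters by (intro replicate_append_eq[where x = 0]) auto
  ultimately show ?case using Cons p w' by auto
qed

text \<open>Every root of unity in the word opens a block consisting of itself and the k zeros
  behind it, which is the pair (k + 1, a). Only words beginning with 0 are missed.\<close>

lemma cletters_surj:
  "u \<in> lists (letter_set N) \<Longrightarrow> u = [] \<or> hd u \<noteq> 0 \<Longrightarrow> \<exists>w\<in>H1_words N. cletters N w = u"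
proof (induction "length u" arbitrary: u rule: less_induct)
  case less
  show ?case
  proof (cases u)
    case (Cons x u')
    then obtain a where a: "a \<in> residues_mod N" "x = \<eta> N powi a"
      using less.prems by (auto simp: letter_set_iff)
    obtain k v where u': "u' = replicate k 0 @ v" "v = [] \<or> hd v \<noteq> 0"
      by (rule split_leading[of u' 0]) (metis append_Nil2, metis list.sel(1))
    then obtain w where "w \<in> H1_words N" "cletters N w = v"
      using less.hyps[of v] less.prems Cons by auto
    then show ?thesis using a u' Cons by (intro bexI[of _ "(Suc k, a) # w"]) auto
  qed (auto intro!: bexI[of _ "[]"])
qed

end

lemma Itilde_eq:
  "Itilde N w = scalar ((-1) ^ length w / of_nat N ^ length w) *
     (\<Sum>bs\<in>index_lists N (length w). scalar (\<eta> N powi dot (diffs (map snd w)) bs) * Isym N 0 (zip (map fst w) bs))"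
  by (simp add: Itilde_def dot_def)

text \<open>Characters sum to zero except for \<open>bs = 0\<close>, where both levels use the letters \<open>0\<close> and \<open>1\<close> only.\<close>

lemma sum_Itilde:
  assumes "N \<ge> 1"
  shows "(\<Sum>as\<in>index_lists N (length ns). Itilde N (zip ns as)) = Itilde 1 (map (\<lambda>n. (n, 0)) ns)"
proof -
  interpret level N by standard fact
  let ?r = "length ns" and ?z = "replicate (length ns) (0 :: int)"
  have 0: "?z \<in> index_lists N ?r" if "N \<ge> 1" for N
    using that by (auto simp: index_lists_def residues_mod_def)
  have zero: "(\<forall>m\<in>set bs. int N dvd m) \<longleftrightarrow> bs = ?z" if "bs \<in> index_lists N ?r" for bs
  proof
    assume dvd: "\<forall>m\<in>set bs. int N dvd m"
    have "m = 0" if "m \<in> set bs" for m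
      using that dvd \<open>bs \<in> index_lists N ?r\<close> eta_powi_inj[of m 0] N
      by (auto simp: index_lists_def residues_mod_def)
    then show "bs = ?z" using \<open>bs \<in> index_lists N ?r\<close>
      by (metis (mono_tags, lifting) index_lists_def mem_Collect_eq replicate_eqI)
  qed auto
  have I0: "Isym N 0 (zip ns ?z) = Isym 1 0 (map (\<lambda>n. (n, 0)) ns)"
  proof -
    have "cletters N (zip ns ?z) = cletters 1 (map (\<lambda>n. (n, 0)) ns)" by (induction ns) auto
    then show ?thesis by (simp add: Isym_eq)
  qed
  let ?c = "(-1) ^ ?r / of_nat N ^ ?r :: complex"
  have "(\<Sum>as\<in>index_lists N ?r. Itilde N (zip ns as)) =
     (\<Sum>as\<in>index_lists N ?r. scalar ?c * (\<Sum>bs\<in>index_lists N ?r. scalar (\<eta> N powi dot (diffs as) bs) * Isym N 0 (zip ns bs)))"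
    unfolding Itilde_eq by (intro sum.cong refl) (auto simp: index_lists_def)
  also have "\<dots> = scalar ?c * (\<Sum>bs\<in>index_lists N ?r. \<Sum>as\<in>index_lists N ?r. scalar (\<eta> N powi dot (diffs as) bs) * Isym N 0 (zip ns bs))"
    unfolding sum_distrib_left[symmetric] by (subst sum.swap) (rule refl)
  also have "\<dots> = scalar ?c * (\<Sum>bs\<in>index_lists N ?r. scalar (\<Sum>as\<in>index_lists N ?r. \<eta> N powi dot (diffs as) bs) * Isym N 0 (zip ns bs))"
    by (simp only: single_sum sum_distrib_right)
  also have "\<dots> = scalar ?c * (\<Sum>bs\<in>index_lists N ?r. if bs = ?z then scalar (of_nat N ^ ?r) * Isym N 0 (zip ns bs) else 0)"
  proof (intro arg_cong[where f = "\<lambda>x. scalar ?c * x"] sum.cong refl)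
    fix bs assume bs: "bs \<in> index_lists N ?r"
    then have "length bs = ?r" by (simp add: index_lists_def)
    show "scalar (\<Sum>as\<in>index_lists N ?r. \<eta> N powi dot (diffs as) bs) * Isym N 0 (zip ns bs) =
        (if bs = ?z then scalar (of_nat N ^ ?r) * Isym N 0 (zip ns bs) else 0)"
      unfolding sum_eta_diffs[OF \<open>length bs = ?r\<close>] zero[OF bs] by simp
  qed
  also have "\<dots> = scalar ?c * (scalar (of_nat N ^ ?r) * Isym N 0 (zip ns ?z))"
    using 0[OF N] by (simp add: sum.delta)
  \<comment> \<open>The N^r of the character sum cancels the denominator in \<open>Itilde\<close>.
    The sign (-1)^r remains and is the whole normalisation at level 1.\<close>
  also have "\<dots> = scalar ((-1) ^ ?r) * Isym 1 0 (map (\<lambda>n. (n, 0)) ns)"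
    using N unfolding I0 by (simp flip: mult.assoc scalar_mult)
  also have "\<dots> = Itilde 1 (map (\<lambda>n. (n, 0)) ns)"
  proof -
    have "bs = ?z" if "bs \<in> index_lists 1 ?r" for bs
      by (rule replicate_eqI) (use that in \<open>fastforce simp: index_lists_def residues_mod_def\<close>)+
    with 0[of 1] have "index_lists 1 ?r = {?z}" by blast
    moreover have "zip (map fst (map (\<lambda>n. (n, 0 :: int)) ns)) ?z = map (\<lambda>n. (n, 0)) ns"
      by (induction ns) auto
    moreover have "\<eta> 1 powi k = 1" for k using level.eta_powi_eq_1[of 1 k] by (simp add: level_def)
    ultimately show ?thesis unfolding Itilde_eq by simp
  qed
  finally show ?thesis .
qed

section \<open>The map \<open>\<mu>\<close>\<close>

lemma lin_map_scale:
  fixes D :: "'a::monoid_add \<Rightarrow>\<^sub>0 complex"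
  shows "lin_map F (single 0 c * D) = scalar c * lin_map F D"
proof (induction D rule: pm_induct)
  case (single k d)
  have "single 0 c * single k d = single k (c * d)" by (simp add: mult_single)
  then show ?case by (simp only: lin_map_single scalar_mult mult.assoc)
qed (simp_all add: distrib_left lin_map_add)

lemma lin_map_F1:
  assumes "\<And>u. u \<in> keys D \<Longrightarrow> F u \<in> F1 S"
  shows "lin_map F D \<in> F1 S"
  unfolding lin_map_def
  by (intro subring_of.C_sum[OF subring_F1] subring_of.C_mult[OF subring_F1] scalar_F1 assms)

lemma lin_map_F2:
  assumes "\<And>u. u \<in> keys D \<Longrightarrow> F u \<in> F2 S"
  shows "lin_map F D \<in> F2 S"
  unfolding lin_map_def
  by (intro subring_of.C_sum[OF subring_F2] subring_of.C_mult[OF subring_F2] scalar_F2 assms)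

lemma poly_hom_F1:
  assumes "\<And>g. g \<in> gens T \<Longrightarrow> f g \<in> F1 S" "p \<in> F1 T"
  shows "poly_hom f p \<in> F1 S"
  unfolding poly_hom_eq_lin_map
  by (intro lin_map_F1 subring_of.C_prod_mset[OF subring_F1] assms(1)) (use assms(2) in \<open>auto simp: F1_def\<close>)

sublocale level \<subseteq> goncharov "letter_set N"
  by unfold_locales simp

context level
begin

abbreviation "S \<equiv> letter_set N"
abbreviation "I0 \<equiv> ideal_I0 (letter_set N)"

lemma Isym_F1: "Isym N c w \<in> F1 S"
  using set_cletters by (simp add: Isym_eq gens_def)

text \<open>The witness is the path character of the rotated symbols g c u = I(0; u / c; 1), with g
  0 the counit. For a path starting at 0 the inverse factor is trivial, so the value on I_c is the
  prescribed rotation exactly, not just modulo the ideal.\<close>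

lemma mu_gens_exists:
  "\<exists>f. (\<forall>g\<in>gens S. f g \<in> carrier (free1 S)) \<and> (\<forall>p\<in>I0. poly_hom f p \<in> I0) \<and>
     (\<forall>c\<in>residues_mod N. \<forall>w\<in>H1_words N.
        poly_hom f (Isym N c w) - Isym N 0 (map (\<lambda>(n, a). (n, a - c)) w) \<in> I0)"
proof -
  define g :: "complex \<Rightarrow> complex list \<Rightarrow> poly1" where
    "g c = (if c = 0 then counit else (\<lambda>u. var (0, map (\<lambda>x. x / c) u, 1)))" for c
  have map_S: "set (map (\<lambda>x. x / c) u) \<subseteq> S" if "c \<in> S" "u \<in> lists S" for c u
    using that letter_divide by auto
  have char: "is_char S (g c)" if c: "c \<in> S" for c
  proof (cases "c = 0")
    case True
    then show ?thesis by (simp add: g_def is_char_counit)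
  next
    case False
    have "var (0, map (\<lambda>x. x / c) u, 1) \<in> F1 S" if "u \<in> lists S" for u
      using map_S[OF c that] by (simp add: gens_def)
    moreover have "cg (var (0, [], 1)) 1" unfolding cg_def by (intro var_Nil) auto
    moreover have "cg (var (0, map (\<lambda>x. x / c) u, 1) * var (0, map (\<lambda>x. x / c) v, 1))
        (\<Sum>w\<in>#shuffle u v. var (0, map (\<lambda>x. x / c) w, 1))" if "u \<in> lists S" "v \<in> lists S" for u v
    proof -
      have "(\<Sum>w\<in>#shuffle u v. var (0, map (\<lambda>x. x / c) w, 1)) =
         (\<Sum>w\<in>#shuffle (map (\<lambda>x. x / c) u) (map (\<lambda>x. x / c) v). var (0, w, 1))"
        unfolding shuffle_map by (simp add: multiset.map_comp comp_def)
      then show ?thesis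
        unfolding cg_def using var_shuffle[OF zero_letter one_letter map_S[OF c that(1)] map_S[OF c that(2)]]
        by (simp only:)
    qed
    ultimately show ?thesis using False by (simp add: g_def is_char_def)
  qed
  define f where "f = path_char g"
  have f_F1: "f h \<in> F1 S" if "h \<in> gens S" for h
  proof -
    obtain b u c where h: "h = (b, u, c)" by (cases h)
    with that have "b \<in> S" "c \<in> S" "u \<in> lists S" by (auto simp: gens_def)
    then show ?thesis unfolding h f_def path_char_def
      using is_char_C[OF is_char_conv[OF is_char_antipode[OF char] char]] by simp
  qed
  have ph_F1: "poly_hom f p \<in> F1 S" if "p \<in> F1 S" for p
    by (rule poly_hom_F1[OF f_F1 that])
  have "poly_hom f p \<in> I0" if "p \<in> I0" for p
  proof (rule path_char_ideal[where S = S and g = g and h = "poly_hom f" and p = p])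
    \<comment> \<open>Rotation fixes the letter 0, so for c \<noteq> 0 this is the relation I(0;0;1)
      = 0.\<close>
    show "g c [0] \<in> I0" if "c \<in> S" for c
      using var_zero[OF one_letter] J_zero by (simp add: g_def counit_def)
  qed (use that f_F1 in \<open>simp_all add: char poly_hom_add poly_hom_mult f_def[symmetric] ph_F1, simp add: g_def\<close>)
  moreover have "poly_hom f (Isym N c w) = Isym N 0 (map (\<lambda>(n, a). (n, a - c)) w)" for c w
  proof -
    have anti: "antipode (g 0) = counit"
      by (auto simp: g_def antipode_def counit_def fun_eq_iff)
    have "map (\<lambda>x. x / \<eta> N powi c) (cletters N w) = cletters N (map (\<lambda>(n, a). (n, a - c)) w)"
      by (induction w) (auto simp: power_int_diff)
    then show ?thesis
      by (simp add: Isym_eq f_def path_char_def anti) (simp add: g_def)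
  qed
  ultimately show ?thesis
    using f_F1 J_zero by (intro exI[of _ f]) (auto simp: free1_eq ring_on_def)
qed

lemma
  shows mu_gens_F1: "g \<in> gens S \<Longrightarrow> mu_gens N g \<in> F1 S"
    and mu_I0: "p \<in> I0 \<Longrightarrow> mu N p \<in> I0"
    and mu_Isym: "c \<in> residues_mod N \<Longrightarrow> w \<in> H1_words N \<Longrightarrow>
      mu N (Isym N c w) - Isym N 0 (map (\<lambda>(n, a). (n, a - c)) w) \<in> I0"
  using someI_ex[OF mu_gens_exists, folded mu_gens_def] unfolding mu_def free1_eq
  by (simp_all add: ring_on_def)

lemma mu_F1: "p \<in> F1 S \<Longrightarrow> mu N p \<in> F1 S"
  unfolding mu_def by (rule poly_hom_F1[OF mu_gens_F1])

lemma mu_add: "mu N (p + q) = mu N p + mu N q"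
  and mu_mult: "mu N (p * q) = mu N p * mu N q"
  and mu_scalar: "mu N (scalar c) = scalar c"
  by (simp_all add: mu_def poly_hom_add poly_hom_mult)

section \<open>The space spanned by the \<open>\<I>\<close>\<close>

text \<open>Representatives of the span of the symbols with end point 1. The ideal is included so
  that membership depends on the class only.\<close>

inductive_set I1 :: "poly1 set" where
  ideal: "p \<in> I0 \<Longrightarrow> p \<in> I1"
| Isym: "w \<in> H1_words N \<Longrightarrow> Isym N 0 w \<in> I1"
| add: "p \<in> I1 \<Longrightarrow> q \<in> I1 \<Longrightarrow> p + q \<in> I1"
| scalar: "p \<in> I1 \<Longrightarrow> scalar c * p \<in> I1"

lemma I1_F1: "p \<in> I1 \<Longrightarrow> p \<in> F1 S"
  by (induction rule: I1.induct) (use J_sub in \<open>auto simp: Isym_F1 C_add C_mult\<close>)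

lemma I1_cong: "p - q \<in> I0 \<Longrightarrow> q \<in> I1 \<Longrightarrow> p \<in> I1"
  using I1.add[OF I1.ideal, of "p - q" q] by simp

lemma var_I1:
  assumes "u \<in> lists S"
  shows "var (0, u, 1) \<in> I1"
proof (rule subspace_leading_zeros[OF _ I1.add I1.scalar _ _ _ assms])
  fix u assume "u \<in> lists S" "u = [] \<or> hd u \<noteq> 0"
  then obtain w where "w \<in> H1_words N" "cletters N w = u" using cletters_surj by blast
  then show "var (0, u, 1) \<in> I1" using I1.Isym[of w] by (simp add: Isym_eq)
qed (auto intro: I1.ideal)

lemma Isym_I1: "Isym N 0 w \<in> I1"
  unfolding Isym_eq using var_I1[OF cletters_lists] by simp

lemma Isym_mult_I1: "Isym N 0 u * Isym N 0 v \<in> I1"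
proof (rule I1_cong)
  let ?u = "cletters N u" and ?v = "cletters N v"
  show "Isym N 0 u * Isym N 0 v - (\<Sum>w\<in>#shuffle ?u ?v. var (0, w, 1)) \<in> I0"
    unfolding Isym_eq using var_shuffle[OF zero_letter one_letter set_cletters set_cletters] by simp
  show "(\<Sum>w\<in>#shuffle ?u ?v. var (0, w, 1)) \<in> I1"
    by (rule sum_mset_closed[OF I1.ideal[OF J_zero] I1.add var_I1])
      (assumption | rule lists_shuffle[OF _ cletters_lists cletters_lists])+
qed

text \<open>The shuffle relation turns a product of two symbols with the same end points into a sum
  of such symbols, so the span is a subalgebra.\<close>

lemma I1_mult: "p \<in> I1 \<Longrightarrow> q \<in> I1 \<Longrightarrow> p * q \<in> I1"
proof (induction rule: I1.induct)
  case (ideal p)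
  then show ?case using I1.ideal[OF J_mult_right[OF _ I1_F1]] by blast
next
  case (Isym w)
  from this(2) show ?case
  proof (induction rule: I1.induct)
    case (ideal p)
    then show ?case by (rule I1.ideal[OF J_mult[OF Isym_F1]])
  next
    case (scalar p c)
    then show ?case using I1.scalar[of "Isym N 0 w * p" c] by (simp add: mult.left_commute)
  qed (auto simp: Isym_mult_I1 distrib_left intro: I1.add)
qed (auto simp: distrib_right mult.assoc intro: I1.add I1.scalar)

lemma scalar_I1: "scalar c \<in> I1"
proof -
  have "1 \<in> I1"
    by (rule I1_cong[of _ "var (0, [], 1)"])
      (use J_uminus[OF var_Nil[OF zero_letter one_letter]] var_I1[of "[]"] in auto)
  from I1.scalar[OF this, of c] show ?thesis by simp
qed

text \<open>The elements sent into the span form a subalgebra, and by \<open>generation\<close> only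
  the symbols I_c remain to be checked, on which \<mu> is prescribed up to congruence.\<close>

lemma mu_I1:
  assumes "p \<in> F1 S"
  shows "mu N p \<in> I1"
proof -
  have "p \<in> {p \<in> F1 S. mu N p \<in> I1}"
  proof (rule generation[OF _ _ _ _ _ _ assms])
    fix c u assume c: "c \<in> S" "c \<noteq> 0" and u: "u \<in> lists S" "u = [] \<or> hd u \<noteq> 0"
    obtain a where a: "a \<in> residues_mod N" "c = \<eta> N powi a" using c by (auto simp: letter_set_iff)
    obtain w where w: "w \<in> H1_words N" "cletters N w = u" using u cletters_surj by blast
    have eq: "var (0, u, c) = Isym N a w" using a w by (simp add: Isym_eq)
    have "mu N (Isym N a w) \<in> I1" by (rule I1_cong[OF mu_Isym[OF a(1) w(1)] Isym_I1])
    then show "var (0, u, c) \<in> {p \<in> F1 S. mu N p \<in> I1}" unfolding eq using Isym_F1 by simp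
  qed (use J_sub mu_I0 in \<open>auto simp: mu_add mu_mult mu_scalar C_add C_mult scalar_I1 intro: I1.intros I1_mult\<close>)
  then show ?thesis by simp
qed

lemma Itilde_F1: "Itilde N w \<in> F1 S"
  unfolding Itilde_eq by (intro C_mult C_sum scalar_F1 Isym_F1)

text \<open>Fourier inversion of the definition of \<open>Itilde\<close>. The summation runs over
  the indices of \<open>Itilde\<close>, so the columns of the matrix must be orthogonal, in contrast
  to the rows in \<open>sum_eta_diffs_orthogonal\<close>.\<close>

lemma Isym_eq_sum_Itilde:
  assumes w: "w \<in> H1_words N"
  shows "Isym N 0 w = (\<Sum>as\<in>index_lists N (length w).
    scalar ((-1) ^ length w * \<eta> N powi (- dot (diffs as) (map snd w))) * Itilde N (zip (map fst w) as))"
proof -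
  let ?r = "length w" and ?bs = "map snd w" and ?ns = "map fst w"
  let ?c = "(-1) ^ ?r / of_nat N ^ ?r :: complex"
  have bs: "?bs \<in> index_lists N ?r" by (rule H1_words_snd) fact
  have orth: "(\<Sum>as\<in>index_lists N ?r. \<eta> N powi (- dot (diffs as) ?bs) * \<eta> N powi dot (diffs as) bs) =
      (if bs = ?bs then of_nat N ^ ?r else 0)" if b: "bs \<in> index_lists N ?r" for bs
  proof -
    let ?ms = "map2 (-) bs ?bs"
    have len: "length bs = ?r" using b by (simp add: index_lists_def)
    have "(\<Sum>as\<in>index_lists N ?r. \<eta> N powi (- dot (diffs as) ?bs) * \<eta> N powi dot (diffs as) bs) =
        (\<Sum>as\<in>index_lists N ?r. \<eta> N powi dot (diffs as) ?ms)"
    proof (intro sum.cong refl)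
      fix as assume "as \<in> index_lists N ?r"
      then have la: "length as = ?r" by (simp add: index_lists_def)
      have "dot (diffs as) ?ms = dot ?ms (diffs as)" using la len by (intro dot_commute) simp
      also have "\<dots> = dot bs (diffs as) - dot ?bs (diffs as)" using la len by (intro dot_diff) simp_all
      also have "\<dots> = dot (diffs as) bs - dot (diffs as) ?bs"
        using la len by (simp add: dot_commute)
      finally show "\<eta> N powi (- dot (diffs as) ?bs) * \<eta> N powi dot (diffs as) bs = \<eta> N powi dot (diffs as) ?ms"
        by (simp flip: power_int_add)
    qed
    also have "\<dots> = (if \<forall>m\<in>set ?ms. int N dvd m then of_nat N ^ ?r else 0)"
      by (rule sum_eta_diffs) (use len in simp)
    also have "(\<forall>m\<in>set ?ms. int N dvd m) \<longleftrightarrow> bs = ?bs"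
    proof
      assume dvd: "\<forall>m\<in>set ?ms. int N dvd m"
      show "bs = ?bs"
      proof (rule nth_equalityI)
        fix i assume i: "i < length bs"
        have "bs ! i - ?bs ! i \<in> set ?ms" using i len nth_mem[of i ?ms] by simp
        then have "int N dvd bs ! i - ?bs ! i" using dvd by blast
        moreover have "bs ! i \<in> residues_mod N" "?bs ! i \<in> residues_mod N"
          using b bs i len nth_mem[of i bs] nth_mem[of i ?bs] by (auto simp: index_lists_def simp del: nth_map)
        ultimately show "bs ! i = ?bs ! i" by (intro eta_powi_inj)
      qed (use len in simp)
    next
      assume "bs = ?bs"
      then show "\<forall>m\<in>set ?ms. int N dvd m" by (auto simp: set_zip)
    qed
    finally show ?thesis .
  qed
  have "(\<Sum>as\<in>index_lists N ?r.
      scalar ((-1) ^ ?r * \<eta> N powi (- dot (diffs as) ?bs)) * Itilde N (zip ?ns as)) =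
    (\<Sum>as\<in>index_lists N ?r. scalar ((-1) ^ ?r * \<eta> N powi (- dot (diffs as) ?bs)) *
      (scalar ?c * (\<Sum>bs\<in>index_lists N ?r. scalar (\<eta> N powi dot (diffs as) bs) * Isym N 0 (zip ?ns bs))))"
    by (intro sum.cong refl) (auto simp: Itilde_eq index_lists_def)
  also have "\<dots> = (\<Sum>bs\<in>index_lists N ?r. \<Sum>as\<in>index_lists N ?r.
      scalar ((-1) ^ ?r * ?c) * scalar (\<eta> N powi (- dot (diffs as) ?bs) * \<eta> N powi dot (diffs as) bs) * Isym N 0 (zip ?ns bs))"
    by (subst sum.swap) (simp only: sum_distrib_left scalar_mult ac_simps)
  also have "\<dots> = (\<Sum>bs\<in>index_lists N ?r. scalar ((-1) ^ ?r * ?c) * scalar (\<Sum>as\<in>index_lists N ?r.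
      \<eta> N powi (- dot (diffs as) ?bs) * \<eta> N powi dot (diffs as) bs) * Isym N 0 (zip ?ns bs))"
    by (simp only: single_sum sum_distrib_left sum_distrib_right)
  also have "\<dots> = (\<Sum>bs\<in>index_lists N ?r. if bs = ?bs then
      scalar ((-1) ^ ?r * ?c) * scalar (of_nat N ^ ?r) * Isym N 0 (zip ?ns bs) else 0)"
    by (intro sum.cong refl, subst orth) auto
  also have "\<dots> = scalar ((-1) ^ ?r * ?c) * scalar (of_nat N ^ ?r) * Isym N 0 (zip ?ns ?bs)"
    using bs by (simp add: sum.delta)
  also have "\<dots> = scalar ((-1) ^ ?r * ?c * of_nat N ^ ?r) * Isym N 0 w"
    by (simp only: scalar_mult zip_map_fst_snd)
  also have "(-1) ^ ?r * ?c * of_nat N ^ ?r = 1" using N by simp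
  finally show ?thesis by simp
qed

lemma I1_span: "p \<in> I1 \<Longrightarrow> \<exists>D. keys D \<subseteq> H1_words N \<and> p - lin_map (Itilde N) D \<in> I0"
proof (induction rule: I1.induct)
  case (ideal p)
  then show ?case by (intro exI[of _ 0]) simp
next
  case (Isym w)
  let ?D = "\<Sum>as\<in>index_lists N (length w). single (zip (map fst w) as)
    ((-1) ^ length w * \<eta> N powi (- dot (diffs as) (map snd w)))"
  have "keys ?D \<subseteq> (\<Union>as\<in>index_lists N (length w). keys (single (zip (map fst w) as)
    ((-1) ^ length w * \<eta> N powi (- dot (diffs as) (map snd w)))))" by (rule keys_sum)
  also have "\<dots> \<subseteq> H1_words N"
    using zip_H1_words[OF H1_words_fst[OF Isym]] by auto
  finally have "keys ?D \<subseteq> H1_words N" .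
  moreover have "lin_map (Itilde N) ?D = Isym N 0 w"
    unfolding lin_map_sum lin_map_single Isym_eq_sum_Itilde[OF Isym] ..
  ultimately show ?case using J_zero by (intro exI[of _ ?D]) simp
next
  case (add p q)
  then obtain D E where "keys D \<subseteq> H1_words N" "p - lin_map (Itilde N) D \<in> I0"
    "keys E \<subseteq> H1_words N" "q - lin_map (Itilde N) E \<in> I0" by blast
  then show ?case using keys_add[of D E] J_add[of "p - lin_map (Itilde N) D" "q - lin_map (Itilde N) E"]
    by (intro exI[of _ "D + E"]) (auto simp: lin_map_add algebra_simps)
next
  case (scalar p c)
  then obtain D where D: "keys D \<subseteq> H1_words N" "p - lin_map (Itilde N) D \<in> I0" by blast
  have "keys (single 0 c * D) \<subseteq> H1_words N"
    using D(1) keys_mult[of "single 0 c" D] by (auto split: if_splits)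
  moreover have "scalar c * p - lin_map (Itilde N) (single 0 c * D) \<in> I0"
    using J_mult[OF scalar_F1 D(2), of c] by (simp add: lin_map_scale right_diff_distrib)
  ultimately show ?case by blast
qed

end

section \<open>Separation of words by characters, and the coproduct on index words\<close>

section \<open>Separating characters\<close>

text \<open>
  \<open>signature [(s\<^sub>1,t\<^sub>1),\<dots>]\<close> is the noncommutative series \<open>exp (t\<^sub>1 s\<^sub>1) exp (t\<^sub>2 s\<^sub>2) \<cdots>\<close>;
  its coefficients are polynomials in the \<open>t\<^sub>i\<close>, and differentiating at \<open>t\<^sub>1 = 0\<close> strips the
  first letter.
\<close>

definition exp_letter :: "'a \<Rightarrow> complex \<Rightarrow> 'a list \<Rightarrow> complex" where
  "exp_letter s t u = (if set u \<subseteq> {s} then t ^ length u / fact (length u) else 0)"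

primrec signature :: "('a \<times> complex) list \<Rightarrow> 'a list \<Rightarrow> complex" where
  "signature [] = counit"
| "signature (p # ps) = conv (exp_letter (fst p) (snd p)) (signature ps)"

interpretation cplx: ideal_of_subring "UNIV :: complex set" "{0}"
  by unfold_locales auto

lemma cplx_cg [simp]: "cplx.cg x y \<longleftrightarrow> x = y"
  by (simp add: cplx.cg_def)

lemma size_shuffle: "size (shuffle u v) = (length u + length v) choose length u"
  by (induction u v rule: shuffle.induct) auto

text \<open>All shuffles of s^m and s^n are the word s^(m+n), and their number is the binomial
  coefficient that converts 1 / (m+n)! into 1 / (m! n!).\<close>

lemma exp_letter_char: "cplx.is_char S (exp_letter s t)"
proof -
  have "exp_letter s t u * exp_letter s t v = (\<Sum>w\<in>#shuffle u v. exp_letter s t w)" for u v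
  proof -
    let ?n = "length u + length v"
    have "(\<Sum>w\<in>#shuffle u v. exp_letter s t w) =
        (\<Sum>w\<in>#shuffle u v. if set u \<union> set v \<subseteq> {s} then t ^ ?n / fact ?n else 0)"
      by (intro arg_cong[where f = sum_mset] image_mset_cong) (simp add: exp_letter_def set_shuffle length_shuffle)
    also have "\<dots> = of_nat (?n choose length u) * (if set u \<union> set v \<subseteq> {s} then t ^ ?n / fact ?n else 0)"
      by (simp add: size_shuffle)
    also have "\<dots> = exp_letter s t u * exp_letter s t v"
      by (auto simp: exp_letter_def binomial_fact power_add)
    finally show ?thesis by simp
  qed
  then show ?thesis by (simp add: cplx.is_char_def exp_letter_def)
qed

lemma signature_char: "cplx.is_char S (signature ps)"
  by (induction ps) (simp_all add: cplx.is_char_counit cplx.is_char_conv exp_letter_char)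

text \<open>Putting (s, t) in front of \<open>ps\<close> makes the pairing a polynomial in t that
  vanishes identically; its linear coefficient is the pairing with \<open>ps\<close> of those words
  that begin with s, deprived of that letter. Since y may repeat words, the conclusion concerns the
  total coefficient of w.\<close>

lemma signature_separates:
  fixes y :: "'i \<Rightarrow> 'a list" and c :: "'i \<Rightarrow> complex"
  assumes "finite I" "\<And>ps. (\<Sum>i\<in>I. c i * signature ps (y i)) = 0"
  shows "(\<Sum>i\<in>{i\<in>I. y i = w}. c i) = 0"
  using assms
proof (induction w arbitrary: I y)
  case Nil
  have "(\<Sum>i\<in>I. c i * signature [] (y i)) = (\<Sum>i\<in>I. if y i = [] then c i else 0)"
    by (intro sum.cong) (auto simp: counit_def)
  also have "\<dots> = (\<Sum>i\<in>{i\<in>I. y i = []}. c i)"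
    using Nil.prems(1) by (rule sum.inter_filter[symmetric])
  finally show ?case using Nil.prems(2)[of "[]"] by (simp del: signature.simps)
next
  case (Cons s w)
  define I' where "I' = {i \<in> I. y i \<noteq> [] \<and> hd (y i) = s}"
  have "(\<Sum>i\<in>I'. c i * signature ps (tl (y i))) = 0" for ps
  proof -
    define a where "a k = (\<Sum>i\<in>I. if k \<le> length (y i) \<and> set (take k (y i)) \<subseteq> {s}
      then c i * signature ps (drop k (y i)) / fact k else 0)" for k
    \<comment> \<open>Bounds every degree in t; the successor guarantees that the linear coefficient
      is in range even if all words are empty.\<close>
    define M where "M = Suc (\<Sum>i\<in>I. length (y i))"
    have "(\<Sum>k\<le>M. a k * t ^ k) = 0" for t :: complex
    proof -
      have "c i * signature ((s, t) # ps) (y i) = (\<Sum>k\<le>M. (if k \<le> length (y i) \<and> set (take k (y i)) \<subseteq> {s}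
          then c i * signature ps (drop k (y i)) / fact k else 0) * t ^ k)" if i: "i \<in> I" for i
      proof -
        have le: "length (y i) \<le> M"
          using member_le_sum[OF i, of "\<lambda>i. length (y i)"] Cons.prems(1) by (simp add: M_def)
        have "c i * signature ((s, t) # ps) (y i) =
            (\<Sum>k\<le>length (y i). c i * (exp_letter s t (take k (y i)) * signature ps (drop k (y i))))"
          by (simp add: conv_def sum_distrib_left)
        also have "\<dots> = (\<Sum>k\<le>length (y i). (if k \<le> length (y i) \<and> set (take k (y i)) \<subseteq> {s}
          then c i * signature ps (drop k (y i)) / fact k else 0) * t ^ k)"
          by (intro sum.cong refl) (simp add: exp_letter_def min_def)
        also have "\<dots> = (\<Sum>k\<le>M. (if k \<le> length (y i) \<and> set (take k (y i)) \<subseteq> {s}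
          then c i * signature ps (drop k (y i)) / fact k else 0) * t ^ k)"
          using le by (intro sum.mono_neutral_left) auto
        finally show ?thesis .
      qed
      then have "(\<Sum>i\<in>I. c i * signature ((s, t) # ps) (y i)) = (\<Sum>k\<le>M. a k * t ^ k)"
        unfolding a_def sum_distrib_right by (subst sum.swap) (simp del: signature.simps)
      then show ?thesis using Cons.prems(2)[of "(s, t) # ps"] by simp
    qed
    then have "a 1 = 0"
      using polyfun_eq_0[of a M] by (auto simp: M_def)
    moreover have "a 1 = (\<Sum>i\<in>I. if y i \<noteq> [] \<and> hd (y i) = s then c i * signature ps (tl (y i)) else 0)"
      unfolding a_def by (intro sum.cong refl) (auto simp: neq_Nil_conv Suc_le_eq)
    moreover have "\<dots> = (\<Sum>i\<in>I'. c i * signature ps (tl (y i)))"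
      unfolding I'_def using Cons.prems(1) by (rule sum.inter_filter[symmetric])
    ultimately show ?thesis by simp
  qed
  from Cons.IH[of I' "\<lambda>i. tl (y i)", OF _ this] Cons.prems(1)
  have "(\<Sum>i\<in>{i\<in>I'. tl (y i) = w}. c i) = 0" by (simp add: I'_def)
  moreover have "{i\<in>I'. tl (y i) = w} = {i\<in>I. y i = s # w}"
    by (auto simp: I'_def)
  ultimately show ?case by simp
qed

text \<open>The leading factor \<open>exp (- T \<cdot> 0)\<close> makes the character vanish on the word \<open>[0]\<close>.\<close>

definition transport :: "(complex \<times> complex) list \<Rightarrow> complex \<Rightarrow> complex list \<Rightarrow> complex" where
  "transport ps c = (if c = 0 then counit else signature ((0, - signature ps [0]) # ps))"

definition eval1 :: "(gen \<Rightarrow> complex) \<Rightarrow> poly1 \<Rightarrow> complex" where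
  "eval1 e = linear_ext (\<lambda>m. prod_mset (image_mset e m))"

definition eval2 :: "(gen \<Rightarrow> complex) \<Rightarrow> (gen \<Rightarrow> complex) \<Rightarrow> poly2 \<Rightarrow> complex" where
  "eval2 e e' = linear_ext (\<lambda>(m, m'). prod_mset (image_mset e m) * prod_mset (image_mset e' m'))"

lemma eval1_add: "eval1 e (p + q) = eval1 e p + eval1 e q"
  and eval1_mult: "eval1 e (p * q) = eval1 e p * eval1 e q"
  and eval1_scalar: "eval1 e (scalar c) = c"
  and eval1_var: "eval1 e (var g) = e g"
  unfolding eval1_def
  by (simp_all add: linear_ext_add linear_ext_mult var_def)

lemma eval1_sum: "eval1 e (\<Sum>i\<in>I. p i) = (\<Sum>i\<in>I. eval1 e (p i))"
  by (rule additive_sum) (rule eval1_add)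

lemma eval2_add: "eval2 e e' (p + q) = eval2 e e' p + eval2 e e' q"
  and eval2_mult: "eval2 e e' (p * q) = eval2 e e' p * eval2 e e' q"
  and eval2_scalar: "eval2 e e' (scalar c) = c"
  unfolding eval2_def
  by (simp_all add: linear_ext_add linear_ext_mult case_prod_unfold zero_prod_def)

lemma eval2_tensor: "eval2 e e' (tensor p q) = eval1 e p * eval1 e' q"
proof (induction p rule: pm_induct)
  case zero
  show ?case by (simp add: eval1_def eval2_def)
next
  case (single k c)
  show ?case
  proof (induction q rule: pm_induct)
    case zero
    show ?case by (simp add: eval1_def eval2_def)
  next
    case (single l d)
    show ?case by (simp add: tensor_single eval1_def eval2_def)
  qed (simp add: tensor_add_right eval1_add eval2_add distrib_left)
qed (simp add: tensor_add_left eval1_add eval2_add distrib_right)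

lemma signature_Nil [simp]: "signature ps [] = 1"
  by (induction ps) (simp_all add: counit_def exp_letter_def)

lemma eval1_ideal:
  assumes S: "0 \<in> S" and p: "p \<in> ideal_I0 S"
  shows "eval1 (path_char (transport ps)) p = 0"
proof -
  have "eval1 (path_char (transport ps)) p \<in> {0}"
  proof (rule cplx.path_char_ideal[where g = "transport ps" and h = "eval1 (path_char (transport ps))" and p = p, OF S _ _ _ eval1_add eval1_mult _ _ _ p])
    show "cplx.is_char S (transport ps c)" for c
    proof (cases "c = 0")
      case True
      then show ?thesis by (simp add: transport_def cplx.is_char_counit)
    next
      case False
      then show ?thesis by (simp only: transport_def if_False signature_char)
    qed
    show "transport ps c [0] \<in> {0}" for c
      by (simp add: transport_def counit_def conv_def exp_letter_def)
    show "eval1 (path_char (transport ps)) 1 = 1" using eval1_scalar[of _ 1] by simp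
  qed (simp_all add: transport_def eval1_var)
  then show ?thesis by simp
qed

text \<open>A pair of characters, one for each tensor factor, is multiplicative on the tensor square
  and vanishes on the generators of its ideal.\<close>

lemma eval2_ideal:
  assumes S: "0 \<in> S" and p: "p \<in> ideal_I0_2 S"
  shows "eval2 (path_char (transport ps)) (path_char (transport ps')) p = 0"
proof -
  let ?e = "eval2 (path_char (transport ps)) (path_char (transport ps'))"
  interpret F: subring_of "F2 S" by (rule subring_F2)
  have zero: "?e 0 = 0" by (simp add: eval2_def)
  have "ideal_of_subring (F2 S) {p \<in> F2 S. ?e p = 0}"
    by unfold_locales (auto simp: F.C_zero F.C_add F.C_mult eval2_add eval2_mult zero)
  then have "ideal_I0_2 S \<subseteq> {p \<in> F2 S. ?e p = 0}"
  proof (rule ideal_I0_2_minimal[OF S])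
    fix p assume p: "p \<in> ideal_I0 S"
    interpret I: ideal_of_subring "F1 S" "ideal_I0 S" by (rule ideal_I0) fact
    show "tensor p 1 \<in> {p \<in> F2 S. ?e p = 0}" "tensor 1 p \<in> {p \<in> F2 S. ?e p = 0}"
      using p I.J_sub I.C_one by (auto simp: eval2_tensor eval1_ideal[OF S p] intro!: tensor_F2)
  qed
  with p show ?thesis by blast
qed

text \<open>The correcting factor in \<open>transport\<close> only charges prefixes consisting of
  zeros, and the words of index words do not begin with 0, so only the empty prefix
  contributes.\<close>

lemma eval1_Isym:
  assumes "N \<ge> 1"
  shows "eval1 (path_char (transport ps)) (Isym N 0 w) = signature ps (cletters N w)"
proof -
  interpret level N by standard fact
  have "antipode (transport ps 0) = counit"
    by (auto simp: transport_def antipode_def counit_def fun_eq_iff)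
  then have "eval1 (path_char (transport ps)) (Isym N 0 w) = conv (exp_letter 0 (- signature ps [0])) (signature ps) (cletters N w)"
    by (simp add: Isym_eq eval1_var path_char_def) (simp add: transport_def)
  also have "\<dots> = signature ps (cletters N w)"
  proof (cases "cletters N w")
    case (Cons x u)
    then have "x \<noteq> 0" using hd_cletters[of w] by simp
    then have "conv (\<lambda>u. exp_letter 0 (- signature ps [0]) (x # u)) (signature ps) u = 0"
      by (simp add: exp_letter_def conv_def)
    then show ?thesis unfolding Cons conv_Cons by (simp add: exp_letter_def)
  qed (simp add: exp_letter_def)
  finally show ?thesis .
qed

section \<open>The coproduct on \<open>\<HH>\<^sup>1\<close>\<close>

text \<open>Expanding each \<open>Itilde\<close> into symbols gives a combination of distinct words,
  whose coefficients vanish by \<open>signature_separates\<close>. These coefficients are Fourier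
  transforms of c along index words with equal upper entries, so Fourier inversion gives the
  vanishing of c.\<close>

lemma Itilde_separates:
  assumes N: "N \<ge> 1" and A: "finite A" "A \<subseteq> H1_words N"
    and zero: "\<And>ps. (\<Sum>u\<in>A. c u * eval1 (path_char (transport ps)) (Itilde N u)) = 0"
    and w: "w \<in> A"
  shows "c w = 0"
proof -
  interpret level N by standard fact
  define I where "I = Sigma A (\<lambda>u. index_lists N (length u))"
  define k where "k = (\<lambda>(u, bs). c u * ((-1) ^ length u / of_nat N ^ length u) * \<eta> N powi dot (diffs (map snd u)) bs)"
  define y :: "index_word \<times> int list \<Rightarrow> complex list" where "y = (\<lambda>(u, bs). cletters N (zip (map fst u) bs))"
  have finI: "finite I" unfolding I_def using A by auto
  have "(\<Sum>i\<in>I. k i * signature ps (y i)) = 0" for ps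
  proof -
    have "(\<Sum>u\<in>A. c u * eval1 (path_char (transport ps)) (Itilde N u)) =
        (\<Sum>u\<in>A. \<Sum>bs\<in>index_lists N (length u). k (u, bs) * signature ps (y (u, bs)))"
      unfolding Itilde_eq eval1_mult eval1_sum eval1_scalar eval1_Isym[OF N] k_def y_def
      by (simp add: sum_distrib_left mult.assoc)
    also have "\<dots> = (\<Sum>i\<in>I. k i * signature ps (y i))"
      unfolding I_def using A by (simp add: sum.Sigma)
    finally show ?thesis using zero by simp
  qed
  note sep = signature_separates[OF finI this]
  let ?r = "length w" and ?ns = "map fst w"
  \<comment> \<open>The words of A that contribute to symbols with the upper entries of w: the upper
    entries can be read off the symbol, the lower ones are mixed by the Fourier sum.\<close>
  define B where "B = {u \<in> A. map fst u = ?ns}"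
  have finB: "finite B" using A by (simp add: B_def)
  have "(\<Sum>u\<in>B. c u * \<eta> N powi dot (diffs (map snd u)) bs) = 0" if bs: "bs \<in> index_lists N ?r" for bs
  proof -
    have set_eq: "{i \<in> I. y i = cletters N (zip ?ns bs)} = (\<lambda>u. (u, bs)) ` B"
    proof (intro equalityI subsetI)
      fix i assume "i \<in> {i \<in> I. y i = cletters N (zip ?ns bs)}"
      then obtain u cs where i: "i = (u, cs)" "u \<in> A" "cs \<in> index_lists N (length u)"
        "cletters N (zip (map fst u) cs) = cletters N (zip ?ns bs)" by (auto simp: I_def y_def)
      then have "zip (map fst u) cs = zip ?ns bs"
        using A bs w by (intro cletters_inj zip_H1_words H1_words_fst) auto
      then have "map fst (zip (map fst u) cs) = map fst (zip ?ns bs)" "map snd (zip (map fst u) cs) = map snd (zip ?ns bs)"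
        by simp_all
      moreover have "length (map fst u) = length cs" "length ?ns = length bs"
        using i bs by (simp_all add: index_lists_def)
      ultimately have "map fst u = ?ns" "cs = bs" by (simp_all only: map_fst_zip map_snd_zip)
      then show "i \<in> (\<lambda>u. (u, bs)) ` B" using i by (auto simp: B_def)
    next
      fix i assume "i \<in> (\<lambda>u. (u, bs)) ` B"
      then obtain u where u: "i = (u, bs)" "u \<in> A" "map fst u = ?ns" by (auto simp: B_def)
      then have "length u = ?r" by (metis length_map)
      then show "i \<in> {i \<in> I. y i = cletters N (zip ?ns bs)}" using u bs by (simp add: I_def y_def)
    qed
    have "0 = (\<Sum>i\<in>(\<lambda>u. (u, bs)) ` B. k i)" using sep[of "cletters N (zip ?ns bs)"] unfolding set_eq by simp
    also have "\<dots> = (\<Sum>u\<in>B. k (u, bs))" by (subst sum.reindex) (auto simp: inj_on_def)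
    also have "\<dots> = (\<Sum>u\<in>B. ((-1) ^ ?r / of_nat N ^ ?r) * (c u * \<eta> N powi dot (diffs (map snd u)) bs))"
    proof (intro sum.cong refl)
      fix u assume "u \<in> B"
      then have "length u = ?r" unfolding B_def by (metis (mono_tags, lifting) length_map mem_Collect_eq)
      then show "k (u, bs) = ((-1) ^ ?r / of_nat N ^ ?r) * (c u * \<eta> N powi dot (diffs (map snd u)) bs)"
        by (simp add: k_def)
    qed
    finally have "((-1) ^ ?r / of_nat N ^ ?r) * (\<Sum>u\<in>B. c u * \<eta> N powi dot (diffs (map snd u)) bs) = 0"
      unfolding sum_distrib_left by (rule sym)
    moreover have "((-1) ^ ?r / of_nat N ^ ?r :: complex) \<noteq> 0" using N by simp
    moreover have "y = 0" if "k * y = 0" "k \<noteq> 0" for k y :: complex using that by simp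
    ultimately show ?thesis by blast
  qed
  note zeroB = this
  \<comment> \<open>Pairing with the conjugate character of w and summing over \<open>bs\<close>
    isolates the coefficient of w by orthogonality.\<close>
  have "0 = (\<Sum>bs\<in>index_lists N ?r. \<eta> N powi (- dot (diffs (map snd w)) bs) *
      (\<Sum>u\<in>B. c u * \<eta> N powi dot (diffs (map snd u)) bs))"
  proof (rule sum.neutral[symmetric], rule ballI)
    fix bs assume "bs \<in> index_lists N ?r"
    from zeroB[OF this] show "\<eta> N powi (- dot (diffs (map snd w)) bs) *
      (\<Sum>u\<in>B. c u * \<eta> N powi dot (diffs (map snd u)) bs) = 0" by simp
  qed
  also have "\<dots> = (\<Sum>u\<in>B. \<Sum>bs\<in>index_lists N ?r. \<eta> N powi (- dot (diffs (map snd w)) bs) * (c u * \<eta> N powi dot (diffs (map snd u)) bs))"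
    unfolding sum_distrib_left by (rule sum.swap)
  also have "\<dots> = (\<Sum>u\<in>B. c u * (\<Sum>bs\<in>index_lists N ?r.
      \<eta> N powi (dot (diffs (map snd u)) bs - dot (diffs (map snd w)) bs)))"
    by (intro sum.cong refl) (simp add: sum_distrib_left power_int_diff power_int_minus field_simps)
  also have "\<dots> = (\<Sum>u\<in>B. if u = w then c w * of_nat N ^ ?r else 0)"
  proof (intro sum.cong refl)
    fix u assume u: "u \<in> B"
    then have fst: "map fst u = ?ns" and uA: "u \<in> A" by (auto simp: B_def)
    then have len: "length u = ?r" by (metis length_map)
    have "map snd u \<in> index_lists N ?r" "map snd w \<in> index_lists N ?r"
      using H1_words_snd[of u N] H1_words_snd[of w N] uA w A len by auto
    note orth = sum_eta_diffs_orthogonal[OF this]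
    have "u = w" if "map snd u = map snd w" using that fst by (metis zip_map_fst_snd)
    then show "c u * (\<Sum>bs\<in>index_lists N ?r. \<eta> N powi (dot (diffs (map snd u)) bs - dot (diffs (map snd w)) bs)) =
        (if u = w then c w * of_nat N ^ ?r else 0)"
      unfolding orth by auto
  qed
  also have "\<dots> = c w * of_nat N ^ ?r"
    using finB w by (simp add: sum.delta B_def)
  finally show ?thesis using N by simp
qed

lemma tensor_map_lin_map:
  "tensor_map F (\<Sum>u\<in>keys D. \<Sum>v\<in>keys E. single (u, v) (c * lookup D u * lookup E v)) =
     scalar c * tensor (lin_map F D) (lin_map F E)"
proof -
  have "tensor_map F (\<Sum>u\<in>keys D. \<Sum>v\<in>keys E. single (u, v) (c * lookup D u * lookup E v)) =
      (\<Sum>u\<in>keys D. \<Sum>v\<in>keys E. scalar (c * lookup D u * lookup E v) * tensor (F u) (F v))"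
    by (simp add: tensor_map_eq_lin_map lin_map_sum)
  also have "\<dots> = (\<Sum>u\<in>keys D. \<Sum>v\<in>keys E. scalar c * (scalar (lookup D u) * (scalar (lookup E v) * tensor (F u) (F v))))"
    by (simp only: scalar_mult mult.assoc)
  also have "\<dots> = scalar c * tensor (lin_map F D) (lin_map F E)"
    unfolding lin_map_def tensor_sum_left tensor_sum_right tensor_scalar_left tensor_scalar_right sum_distrib_left
    by (subst sum.swap) (simp only: mult.left_commute)
  finally show ?thesis .
qed

lemma tensor_map_add: "tensor_map F (p + q) = tensor_map F p + tensor_map F q"
  and tensor_map_sum: "tensor_map F (\<Sum>i\<in>I. f i) = (\<Sum>i\<in>I. tensor_map F (f i))"
  and tensor_map_diff: "tensor_map F (p - q) = tensor_map F p - tensor_map F q"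
  and tensor_map_single: "tensor_map F (single (u, v) c) = scalar c * tensor (F u) (F v)"
  by (simp_all add: tensor_map_eq_lin_map lin_map_add lin_map_sum lin_map_diff)

context level
begin

abbreviation "I02 \<equiv> ideal_I0_2 (letter_set N)"

text \<open>Pairs of characters separate the two tensor factors one after the other: for a fixed
  second character the sums over v are the coefficients of the words u and vanish, and then varying
  the second character separates the v.\<close>

lemma Delta_unique:
  assumes D: "keys D \<subseteq> H1_words N \<times> H1_words N" and I: "tensor_map (Itilde N) D \<in> I02"
  shows "D = 0"
proof -
  let ?A = "fst ` keys D" and ?B = "snd ` keys D"
  let ?e = "\<lambda>ps. eval1 (path_char (transport ps))"
  have AB: "finite ?A" "finite ?B" "?A \<subseteq> H1_words N" "?B \<subseteq> H1_words N" using D by auto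
  have zero: "(\<Sum>u\<in>?A. (\<Sum>v\<in>?B. lookup D (u, v) * ?e ps' (Itilde N v)) * ?e ps (Itilde N u)) = 0" for ps ps'
  proof -
    have "0 = eval2 (path_char (transport ps)) (path_char (transport ps')) (tensor_map (Itilde N) D)"
      using eval2_ideal[OF zero_letter I] by simp
    also have "\<dots> = (\<Sum>x\<in>keys D. lookup D x * (?e ps (Itilde N (fst x)) * ?e ps' (Itilde N (snd x))))"
      unfolding tensor_map_def
      by (subst additive_sum[OF eval2_add])
        (simp add: case_prod_unfold eval2_mult eval2_scalar eval2_tensor)
    also have "\<dots> = (\<Sum>x\<in>?A \<times> ?B. lookup D x * (?e ps (Itilde N (fst x)) * ?e ps' (Itilde N (snd x))))"
      using AB by (intro sum.mono_neutral_left) (force simp: in_keys_iff)+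
    also have "\<dots> = (\<Sum>u\<in>?A. \<Sum>v\<in>?B. lookup D (u, v) * (?e ps (Itilde N u) * ?e ps' (Itilde N v)))"
      by (simp add: sum.cartesian_product case_prod_unfold)
    finally show ?thesis unfolding sum_distrib_right by (simp only: mult_ac)
  qed
  have lookup: "lookup D (u, v) = 0" if "u \<in> ?A" "v \<in> ?B" for u v
  proof (rule Itilde_separates[OF N AB(2,4) _ that(2)])
    fix ps'
    show "(\<Sum>v\<in>?B. lookup D (u, v) * ?e ps' (Itilde N v)) = 0"
      by (rule Itilde_separates[OF N AB(1,3) zero that(1)])
  qed
  have "x \<notin> keys D" for x
  proof
    assume x: "x \<in> keys D"
    then have "lookup D (fst x, snd x) = 0" by (intro lookup imageI)
    with x show False by (simp add: in_keys_iff)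
  qed
  then have "keys D = {}" by blast
  then show ?thesis by simp
qed

text \<open>Works monomial by monomial for any tensor P: \<mu> maps both factors into the span of
  the symbols, which modulo the ideal is the span of the \<open>Itilde\<close>. Replacing each
  factor by such a combination changes the tensor by an element of the ideal.\<close>

lemma Delta_exists:
  assumes P: "P \<in> F2 S"
  shows "\<exists>D. keys D \<subseteq> H1_words N \<times> H1_words N \<and> tensor_map (Itilde N) D - mu_tensor_mu N P \<in> I02"
proof -
  have "\<exists>D. keys D \<subseteq> H1_words N \<times> H1_words N \<and>
      tensor_map (Itilde N) D - mu_tensor_mu N (\<Sum>k\<in>A. single k (lookup P k)) \<in> I02"
    if "finite A" "A \<subseteq> keys P" for A
    using that
  proof (induction A)
    case empty
    show ?case using J2.J_zero by (intro exI[of _ 0]) (simp add: mu_tensor_mu_def tensor_map_eq_lin_map)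
  next
    case (insert x A)
    obtain m m' where x: "x = (m, m')" by (cases x)
    define c where "c = lookup P x"
    define p where "p = mu N (single m 1)"
    define p' where "p' = mu N (single m' 1)"
    have "single m 1 \<in> F1 S" "single m' 1 \<in> F1 S" using P insert.prems x by (auto simp: F1_def F2_def)
    then have p: "p \<in> I1" "p' \<in> I1" unfolding p_def p'_def by (auto intro: mu_I1)
    obtain D E where D: "keys D \<subseteq> H1_words N" "p - lin_map (Itilde N) D \<in> I0"
      and E: "keys E \<subseteq> H1_words N" "p' - lin_map (Itilde N) E \<in> I0"
      using I1_span[OF p(1)] I1_span[OF p(2)] by blast
    define G where "G = (\<Sum>u\<in>keys D. \<Sum>v\<in>keys E. single (u, v) (c * lookup D u * lookup E v))"
    have "keys G \<subseteq> (\<Union>u\<in>keys D. \<Union>v\<in>keys E. keys (single (u, v) (c * lookup D u * lookup E v)))"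
      unfolding G_def using keys_sum by (intro order.trans[OF keys_sum] UN_mono order.refl)
    also have "\<dots> \<subseteq> H1_words N \<times> H1_words N" using D(1) E(1) by (auto split: if_splits)
    finally have G: "keys G \<subseteq> H1_words N \<times> H1_words N" .
    let ?d = "lin_map (Itilde N) D" and ?e = "lin_map (Itilde N) E"
    have dF: "?d \<in> F1 S" by (intro lin_map_F1 Itilde_F1)
    have "tensor p p' - tensor ?d ?e = tensor (p - ?d) p' + tensor ?d (p' - ?e)"
      by (simp add: tensor_diff_left tensor_diff_right)
    also have "\<dots> \<in> I02"
      by (intro J2.J_add tensor_ideal_left tensor_ideal_right zero_letter D E dF I1_F1 p)
    finally have "scalar (- c) * (tensor p p' - tensor ?d ?e) \<in> I02"
      by (rule J2.J_mult[OF scalar_F2])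
    moreover have "mu_tensor_mu N (single x c) = scalar c * tensor p p'"
      by (simp add: x mu_tensor_mu_def tensor_map_single p_def p'_def)
    moreover have "tensor_map (Itilde N) G = scalar c * tensor ?d ?e"
      unfolding G_def by (rule tensor_map_lin_map)
    ultimately have new: "tensor_map (Itilde N) G - mu_tensor_mu N (single x c) \<in> I02"
      by (simp add: algebra_simps single_uminus)
    obtain H where H: "keys H \<subseteq> H1_words N \<times> H1_words N"
      "tensor_map (Itilde N) H - mu_tensor_mu N (\<Sum>k\<in>A. single k (lookup P k)) \<in> I02"
      using insert by auto
    have "keys (G + H) \<subseteq> H1_words N \<times> H1_words N" using keys_add[of G H] G H(1) by blast
    moreover have "tensor_map (Itilde N) (G + H) - mu_tensor_mu N (\<Sum>k\<in>insert x A. single k (lookup P k)) \<in> I02"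
      using J2.J_add[OF new H(2)] insert.hyps
      by (simp add: tensor_map_add mu_tensor_mu_def c_def algebra_simps)
    ultimately show ?case by blast
  qed
  from this[of "keys P"] show ?thesis by (simp flip: pm_expand)
qed

end

lemma coproduct_F2:
  assumes "p \<in> F1 S"
  shows "coproduct p \<in> F2 S"
proof -
  interpret F1: subring_of "F1 S" by (rule subring_F1)
  interpret F2: subring_of "F2 S" by (rule subring_F2)
  have gen: "coproduct_gen g \<in> F2 S" if g: "g \<in> gens S" for g
  proof -
    obtain b bs c where g': "g = (b, bs, c)" by (cases g)
    define B where "B = b # bs @ [c]"
    define m where "m = length bs"
    have BS: "B ! i \<in> S" if "i \<le> m + 1" for i
    proof -
      have "B ! i \<in> set B" using that by (intro nth_mem) (simp add: B_def m_def)
      then show ?thesis using g by (auto simp: B_def g' gens_def)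
    qed
    have bc: "b \<in> S" "c \<in> S" using g by (auto simp: g' gens_def)
    have "tensor
         (\<Prod>p<length is - 1. var (B ! (is ! p), map ((!) B) [is ! p + 1..<is ! (p + 1)], B ! (is ! (p + 1))))
         (var (b, map ((!) B) (sorted_list_of_set A), c)) \<in> F2 S"
      if A: "A \<in> Pow {1..m}" and is_def: "is = 0 # sorted_list_of_set A @ [m + 1]" for A "is"
    proof -
      have fin: "finite A" using A finite_subset by auto
      have le: "i \<le> m + 1" if "i \<in> set is" for i using that A fin by (auto simp: is_def)
      have nth_le: "is ! p \<le> m + 1" if "p < length is" for p using le that by auto
      have "var (B ! (is ! p), map ((!) B) [is ! p + 1..<is ! (p + 1)], B ! (is ! (p + 1))) \<in> F1 S"
        if "p < length is - 1" for p
      proof -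
        have "p < length is" "p + 1 < length is" using that by linarith+
        note nth_le[OF this(1)] nth_le[OF this(2)]
        then show ?thesis by (auto simp: gens_def intro!: BS)
      qed
      moreover have "var (b, map ((!) B) (sorted_list_of_set A), c) \<in> F1 S"
        using bc A fin by (auto simp: gens_def intro!: BS)
      ultimately show ?thesis by (intro tensor_F2 F1.C_prod) auto
    qed
    then show ?thesis
      unfolding coproduct_gen_def g' by (auto simp: Let_def B_def m_def intro!: F2.C_sum)
  qed
  show ?thesis
    unfolding coproduct_def poly_hom_eq_lin_map
    by (intro lin_map_F2 F2.C_prod_mset gen) (use assms in \<open>unfold F1_def, blast\<close>)
qed

context level
begin

lemma Delta_mu:
  "keys (Delta_mu N w) \<subseteq> H1_words N \<times> H1_words N"
  "tensor_map (Itilde N) (Delta_mu N w) - mu_tensor_mu N (coproduct (Itilde N w)) \<in> I02"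
proof -
  let ?P = "\<lambda>D. keys D \<subseteq> H1_words N \<times> H1_words N \<and>
     tensor_map (Itilde N) D - mu_tensor_mu N (coproduct (Itilde N w)) \<in> I02"
  obtain D where D: "?P D" using Delta_exists[OF coproduct_F2[OF Itilde_F1]] by blast
  have "E = D" if E: "?P E" for E
  proof -
    have "keys (E - D) \<subseteq> H1_words N \<times> H1_words N" using keys_diff[of E D] D E by blast
    moreover have "tensor_map (Itilde N) (E - D) \<in> I02"
      using J2.J_diff[of "tensor_map (Itilde N) E - mu_tensor_mu N (coproduct (Itilde N w))"
          "tensor_map (Itilde N) D - mu_tensor_mu N (coproduct (Itilde N w))"] D E
      by (simp add: tensor_map_diff)
    ultimately have "E - D = 0" by (rule Delta_unique)
    then show ?thesis by simp
  qed
  then have "Delta_mu N w = D"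
    unfolding Delta_mu_def by (intro the_equality D)
  with D show "keys (Delta_mu N w) \<subseteq> H1_words N \<times> H1_words N"
    "tensor_map (Itilde N) (Delta_mu N w) - mu_tensor_mu N (coproduct (Itilde N w)) \<in> I02"
    by simp_all
qed

lemma letter_set_1: "letter_set 1 = {0, 1}"
proof -
  have "\<eta> 1 = 1" using level.eta_powi_eq_1[of 1 1] by (simp add: level_def)
  then show ?thesis by (auto simp: letter_set_def)
qed

lemma letter_set_1_subset: "letter_set 1 \<subseteq> S"
  unfolding letter_set_1 by simp

text \<open>The only nonzero end point is now \<open>1\<close>, and there \<open>\<mu>\<close> does not rotate the letters.\<close>

lemma mu_level1:
  assumes "p \<in> F1 (letter_set 1)"
  shows "mu N p - p \<in> I0"
proof -
  interpret L1: level 1 by standard simp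
  have "p \<in> {p \<in> F1 (letter_set 1). mu N p - p \<in> I0}"
  proof (rule L1.generation[OF _ _ _ _ _ _ assms])
    show "ideal_I0 (letter_set 1) \<subseteq> {p \<in> F1 (letter_set 1). mu N p - p \<in> I0}"
      using ideal_I0_mono[OF letter_set_1_subset L1.zero_letter] L1.J_sub mu_I0 J_diff by blast
    fix p q assume p: "p \<in> {p \<in> F1 (letter_set 1). mu N p - p \<in> I0}"
      and q: "q \<in> {p \<in> F1 (letter_set 1). mu N p - p \<in> I0}"
    have F: "p \<in> F1 S" "q \<in> F1 S" using p q F1_mono[OF letter_set_1_subset] by auto
    have "mu N p * mu N q - p * q = mu N p * (mu N q - q) + (mu N p - p) * q" by (simp add: algebra_simps)
    also have "\<dots> \<in> I0" using p q F by (intro J_add J_mult J_mult_right mu_F1) auto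
    finally show "p * q \<in> {p \<in> F1 (letter_set 1). mu N p - p \<in> I0}"
      using p q L1.C_mult by (simp add: mu_mult)
    have "mu N p + mu N q - (p + q) = (mu N p - p) + (mu N q - q)" by simp
    also have "\<dots> \<in> I0" using p q by (intro J_add) auto
    finally show "p + q \<in> {p \<in> F1 (letter_set 1). mu N p - p \<in> I0}"
      using p q L1.C_add by (simp add: mu_add)
  next
    fix c u assume c: "c \<in> letter_set 1" "c \<noteq> 0" and u: "u \<in> lists (letter_set 1)" "u = [] \<or> hd u \<noteq> 0"
    obtain w where w: "w \<in> H1_words 1" "cletters 1 w = u" using u L1.cletters_surj by blast
    have "\<forall>x\<in>set w. snd x = 0"
      using w(1) by (auto simp: H1_words_def residues_mod_def)
    then have "cletters N w = cletters 1 w" by (induction w) auto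
    moreover have "w \<in> H1_words N" using w(1) N by (auto simp: H1_words_def residues_mod_def)
    moreover have "c = 1" using c letter_set_1 by auto
    moreover have "map (\<lambda>(n, a). (n, a - 0)) w = w" by (simp add: case_prod_unfold)
    moreover have "0 \<in> residues_mod N" using N by (simp add: residues_mod_def)
    ultimately have "mu N (var (0, u, c)) - var (0, u, c) \<in> I0"
      using mu_Isym[of 0 w] w by (simp add: Isym_eq)
    then show "var (0, u, c) \<in> {p \<in> F1 (letter_set 1). mu N p - p \<in> I0}"
      using c u L1.zero_letter by (auto simp: gens_def)
  qed (simp_all add: mu_scalar J_zero)
  then show ?thesis by simp
qed

lemma mu_tensor_mu_level1:
  assumes P: "P \<in> F2 (letter_set 1)"
  shows "mu_tensor_mu N P - P \<in> I02"
proof -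
  have "mu_tensor_mu N (single k (lookup P k)) - single k (lookup P k) \<in> I02" if k: "k \<in> keys P" for k
  proof -
    obtain m m' where x: "k = (m, m')" by (cases k)
    let ?a = "single m 1 :: poly1" and ?b = "single m' 1 :: poly1"
    have F: "?a \<in> F1 (letter_set 1)" "?b \<in> F1 (letter_set 1)" using P k x by (auto simp: F1_def F2_def)
    have FN: "?a \<in> F1 S" "?b \<in> F1 S" using F F1_mono[OF letter_set_1_subset] by auto
    have "tensor (mu N ?a) (mu N ?b) - tensor ?a ?b =
        tensor (mu N ?a - ?a) (mu N ?b) + tensor ?a (mu N ?b - ?b)"
      by (simp add: tensor_diff_left tensor_diff_right)
    also have "\<dots> \<in> I02"
      by (intro J2.J_add tensor_ideal_left tensor_ideal_right zero_letter mu_level1 F FN mu_F1)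
    finally have "scalar (lookup P k) * (tensor (mu N ?a) (mu N ?b) - tensor ?a ?b) \<in> I02"
      by (rule J2.J_mult[OF scalar_F2])
    moreover have "scalar (lookup P k) * tensor ?a ?b = single k (lookup P k)"
      by (simp add: tensor_single mult_single x zero_prod_def[symmetric])
    ultimately show ?thesis
      unfolding right_diff_distrib by (simp add: x mu_tensor_mu_def tensor_map_single)
  qed
  then have "(\<Sum>k\<in>keys P. mu_tensor_mu N (single k (lookup P k)) - single k (lookup P k)) \<in> I02"
    by (rule J2.J_sum)
  then show ?thesis
    unfolding sum_subtractf pm_expand[symmetric] mu_tensor_mu_def tensor_map_sum[symmetric] .
qed

text \<open>
  The pushforward of a level \<open>1\<close> tensor along \<open>z\<^sub>n \<mapsto> \<Sum>\<^sub>a z\<^bsub>n,a\<^esub>\<close>.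
\<close>

definition spread :: "(index_word \<times> index_word \<Rightarrow>\<^sub>0 complex) \<Rightarrow> (index_word \<times> index_word \<Rightarrow>\<^sub>0 complex)" where
  "spread D = (\<Sum>(u, v)\<in>keys D. \<Sum>as\<in>index_lists N (length u). \<Sum>bs\<in>index_lists N (length v).
     single (zip (map fst u) as, zip (map fst v) bs) (lookup D (u, v)))"

lemma H1_words_1: "w \<in> H1_words 1 \<Longrightarrow> w = map (\<lambda>n. (n, 0)) (map fst w)"
  by (induction w) (auto simp: residues_mod_def)

text \<open>Both sides consist of index words of level N, so by \<open>Delta_unique\<close> only
  their images have to be compared. Linearity and \<open>sum_Itilde\<close> turn the left image into
  the coproduct of a level 1 element and the right image into the level 1 tensor
  \<open>tensor_map (Itilde 1) D\<close>.\<close>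

lemma sum_Delta_mu:
  assumes ns: "\<forall>n\<in>set ns. n \<ge> 1"
  shows "(\<Sum>as\<in>index_lists N (length ns). Delta_mu N (zip ns as)) = spread (Delta_mu 1 (map (\<lambda>n. (n, 0)) ns))"
proof -
  interpret L1: level 1 by standard simp
  let ?w = "map (\<lambda>n. (n, 0)) ns" and ?r = "length ns"
  define D where "D = Delta_mu 1 ?w"
  define E where "E = (\<Sum>as\<in>index_lists N ?r. Delta_mu N (zip ns as))"
  let ?P = "coproduct (Itilde 1 ?w)"
  note D = L1.Delta_mu[of ?w, folded D_def]
  have P: "?P \<in> F2 (letter_set 1)" by (intro coproduct_F2 L1.Itilde_F1)
  have keysE: "keys E \<subseteq> H1_words N \<times> H1_words N"
    unfolding E_def using Delta_mu(1) by (intro order.trans[OF keys_sum]) blast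
  have E: "tensor_map (Itilde N) E - mu_tensor_mu N ?P \<in> I02"
  proof -
    have "(\<Sum>as\<in>index_lists N ?r. tensor_map (Itilde N) (Delta_mu N (zip ns as))
        - mu_tensor_mu N (coproduct (Itilde N (zip ns as)))) \<in> I02"
      by (intro J2.J_sum Delta_mu)
    also have "(\<Sum>as\<in>index_lists N ?r. tensor_map (Itilde N) (Delta_mu N (zip ns as))
        - mu_tensor_mu N (coproduct (Itilde N (zip ns as)))) =
        tensor_map (Itilde N) E - mu_tensor_mu N (coproduct (\<Sum>as\<in>index_lists N ?r. Itilde N (zip ns as)))"
      by (simp add: sum_subtractf E_def tensor_map_sum mu_tensor_mu_def coproduct_def poly_hom_sum)
    finally show ?thesis unfolding sum_Itilde[OF N] .
  qed
  have mem1: "u \<in> H1_words 1 \<and> v \<in> H1_words 1" if "(u, v) \<in> keys D" for u v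
    using that D(1) by auto
  have keysS: "keys (spread D) \<subseteq> H1_words N \<times> H1_words N"
  proof -
    have "keys (\<Sum>as\<in>index_lists N (length u). \<Sum>bs\<in>index_lists N (length v).
       single (zip (map fst u) as, zip (map fst v) bs) (lookup D (u, v))) \<subseteq> H1_words N \<times> H1_words N"
      if "(u, v) \<in> keys D" for u v
    proof (intro order.trans[OF keys_sum] UN_least)
      fix as bs assume "as \<in> index_lists N (length u)" "bs \<in> index_lists N (length v)"
      then have "zip (map fst u) as \<in> H1_words N" "zip (map fst v) bs \<in> H1_words N"
        using mem1[OF that] by (auto intro!: zip_H1_words H1_words_fst)
      then show "keys (single (zip (map fst u) as, zip (map fst v) bs) (lookup D (u, v))) \<subseteq> H1_words N \<times> H1_words N"
        by simp
    qed
    then show ?thesis unfolding spread_def by (intro order.trans[OF keys_sum] UN_least) auto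
  qed
  have "tensor_map (Itilde N) (spread D) = tensor_map (Itilde 1) D"
  proof -
    have "tensor_map (Itilde N) (\<Sum>as\<in>index_lists N (length u). \<Sum>bs\<in>index_lists N (length v).
       single (zip (map fst u) as, zip (map fst v) bs) (lookup D (u, v))) =
       scalar (lookup D (u, v)) * tensor (Itilde 1 u) (Itilde 1 v)" if uv: "(u, v) \<in> keys D" for u v
    proof -
      have "(\<Sum>as\<in>index_lists N (length u). Itilde N (zip (map fst u) as)) = Itilde 1 u"
        using sum_Itilde[OF N, of "map fst u"] H1_words_1[of u] mem1[OF uv] by simp
      moreover have "(\<Sum>as\<in>index_lists N (length v). Itilde N (zip (map fst v) as)) = Itilde 1 v"
        using sum_Itilde[OF N, of "map fst v"] H1_words_1[of v] mem1[OF uv] by simp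
      ultimately show ?thesis
        by (simp only: tensor_map_sum tensor_map_single flip: tensor_sum_left tensor_sum_right sum_distrib_left)
    qed
    then show ?thesis
      unfolding spread_def tensor_map_sum[of _ "\<lambda>x. case x of (u, v) \<Rightarrow> _ u v"] tensor_map_def[of "Itilde 1"]
      by (intro sum.cong refl) auto
  qed
  \<comment> \<open>The operators \<mu> of level 1 and of level N have no direct relation; on
    tensors in the letters 0 and 1 each is congruent to the identity, and the level 1 ideal of the
    tensor square lies in that of level N.\<close>
  moreover have "tensor_map (Itilde 1) D - mu_tensor_mu N ?P \<in> I02"
  proof -
    have "ideal_I0_2 (letter_set 1) \<subseteq> F2 (letter_set 1) \<inter> I02"
    proof (rule ideal_I0_2_minimal[OF L1.zero_letter])
      show "ideal_of_subring (F2 (letter_set 1)) (F2 (letter_set 1) \<inter> I02)"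
      proof unfold_locales
        fix x y assume "x \<in> F2 (letter_set 1)" "y \<in> F2 (letter_set 1) \<inter> I02"
        then show "x * y \<in> F2 (letter_set 1) \<inter> I02"
          using F2_mono[OF letter_set_1_subset] J2.J_mult[of x y] L1.J2.C_mult[of x y] by blast
      qed (use J2.J_zero J2.J_add L1.J2.C_zero L1.J2.C_add in auto)
      fix p assume p: "p \<in> ideal_I0 (letter_set 1)"
      then have "p \<in> I0" using ideal_I0_mono[OF letter_set_1_subset L1.zero_letter] by blast
      then show "tensor p 1 \<in> F2 (letter_set 1) \<inter> I02" "tensor 1 p \<in> F2 (letter_set 1) \<inter> I02"
        using p L1.J_sub tensor_F2[OF _ L1.C_one] tensor_F2[OF L1.C_one] tensor_ideal_left[OF zero_letter _ C_one]
          tensor_ideal_right[OF zero_letter C_one] by auto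
    qed
    then have 1: "tensor_map (Itilde 1) D - mu_tensor_mu 1 ?P \<in> I02"
      and 2: "mu_tensor_mu 1 ?P - ?P \<in> I02"
      using D(2) L1.mu_tensor_mu_level1[OF P] by blast+
    have "tensor_map (Itilde 1) D - mu_tensor_mu N ?P =
        (tensor_map (Itilde 1) D - mu_tensor_mu 1 ?P) + (mu_tensor_mu 1 ?P - ?P) - (mu_tensor_mu N ?P - ?P)"
      by simp
    also have "\<dots> \<in> I02" by (intro J2.J_diff J2.J_add 1 2 mu_tensor_mu_level1 P)
    finally show ?thesis .
  qed
  ultimately have "tensor_map (Itilde N) (E - spread D) \<in> I02"
    using J2.J_diff[OF E] by (fastforce simp: tensor_map_diff)
  moreover have "keys (E - spread D) \<subseteq> H1_words N \<times> H1_words N"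
    using keys_diff[of E "spread D"] keysE keysS by blast
  ultimately have "E - spread D = 0" by (intro Delta_unique)
  then show ?thesis by (simp add: E_def D_def)
qed

text \<open>\<open>spread\<close> sums over the lower indices of the two tensor factors
  independently, so the convolution factors into the two separate relations.\<close>

lemma sum_convolution:
  assumes ns: "\<forall>n\<in>set ns. n \<ge> 1"
    and \<phi>: "\<And>ms. \<forall>n\<in>set ms. n \<ge> 1 \<Longrightarrow> (\<Sum>as\<in>index_lists N (length ms). \<phi> (zip ms as)) = \<phi>' (map (\<lambda>n. (n, 0)) ms)"
    and \<psi>: "\<And>ms. \<forall>n\<in>set ms. n \<ge> 1 \<Longrightarrow> (\<Sum>as\<in>index_lists N (length ms). \<psi> (zip ms as)) = \<psi>' (map (\<lambda>n. (n, 0)) ms)"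
  shows "(\<Sum>as\<in>index_lists N (length ns). convolution N \<phi> \<psi> (zip ns as)) = convolution 1 \<phi>' \<psi>' (map (\<lambda>n. (n, 0)) ns)"
proof -
  interpret L1: level 1 by standard simp
  let ?f = "\<lambda>(u, v). \<phi> u * \<psi> v"
  define D where "D = Delta_mu 1 (map (\<lambda>n. (n, 0)) ns)"
  have "(\<Sum>as\<in>index_lists N (length ns). convolution N \<phi> \<psi> (zip ns as)) = linear_ext ?f (spread D)"
    unfolding convolution_def linear_ext_sum[symmetric] sum_Delta_mu[OF ns] D_def ..
  also have "\<dots> = (\<Sum>(u, v)\<in>keys D. lookup D (u, v) * (\<phi>' u * \<psi>' v))"
    unfolding spread_def linear_ext_sum
  proof (intro sum.cong refl, clarify)
    fix u v assume uv: "(u, v) \<in> keys D"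
    then have H: "u \<in> H1_words 1" "v \<in> H1_words 1" using L1.Delta_mu(1) unfolding D_def by blast+
    have "linear_ext ?f (\<Sum>as\<in>index_lists N (length u). \<Sum>bs\<in>index_lists N (length v).
       single (zip (map fst u) as, zip (map fst v) bs) (lookup D (u, v))) =
       lookup D (u, v) * ((\<Sum>as\<in>index_lists N (length u). \<phi> (zip (map fst u) as))
         * (\<Sum>bs\<in>index_lists N (length v). \<psi> (zip (map fst v) bs)))"
      unfolding sum_product by (simp add: linear_ext_sum sum_distrib_left)
    also have "\<dots> = lookup D (u, v) * (\<phi>' u * \<psi>' v)"
      using \<phi>[OF H1_words_fst[OF H(1)]] \<psi>[OF H1_words_fst[OF H(2)]] H1_words_1[OF H(1)] H1_words_1[OF H(2)]
      by simp
    finally show "linear_ext ?f (\<Sum>as\<in>index_lists N (length u). \<Sum>bs\<in>index_lists N (length v).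
       single (zip (map fst u) as, zip (map fst v) bs) (lookup D (u, v))) = lookup D (u, v) * (\<phi>' u * \<psi>' v)" .
  qed
  also have "\<dots> = convolution 1 \<phi>' \<psi>' (map (\<lambda>n. (n, 0)) ns)"
    by (simp add: convolution_def linear_ext_def D_def case_prod_unfold)
  finally show ?thesis .
qed

end

section \<open>Analytic input and the regularised zeta values\<close>

section \<open>Abel's limit theorem and Dirichlet's test\<close>

text \<open>Abel's theorem along a sequence of radii; the summand 2 keeps the radius strictly
  between 0 and 1 for m = 0 as well.\<close>

lemma abel_limit:
  fixes a :: "nat \<Rightarrow> complex"
  assumes "a sums A"
  shows "(\<lambda>m. suminf (\<lambda>n. a n * of_real (1 - 1 / (real m + 2)) ^ n)) \<longlonglongrightarrow> A"
proof (rule LIMSEQ_I)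
  fix r :: real assume r: "r > 0"
  define D where "D n = (\<Sum>k<n. a k) - A" for n
  have D0: "D \<longlonglongrightarrow> 0"
    using assms unfolding sums_def D_def by (simp add: LIM_zero)
  then obtain K where K: "K > 0" "\<And>n. norm (D n) \<le> K"
    using Bseq_def convergent_imp_Bseq convergent_def by metis
  obtain M where M: "\<And>n. n \<ge> M \<Longrightarrow> norm (D n) < r / 2"
    using LIMSEQ_D[OF D0, of "r / 2"] r by auto
  \<comment> \<open>Summation by parts gives (sum of a_n t^n) - A = (1 - t) * (sum of D (n + 1)
    t^n). The terms with n < M contribute at most M K to the last sum, the others at most (r / 2) /
    (1 - t).\<close>
  have bound: "norm ((suminf (\<lambda>n. a n * of_real t ^ n)) - A) \<le> (1 - t) * (real M * K) + r / 2"
    if t: "0 < t" "t < 1" for t :: real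
  proof -
    let ?g = "\<lambda>n. D (Suc n) * of_real t ^ n"
    let ?h = "\<lambda>n. (if n < M then K else 0) + r / 2 * t ^ n"
    have le: "norm (?g n) \<le> ?h n" for n
    proof (cases "n < M")
      case True
      have "norm (?g n) \<le> K * 1"
        unfolding norm_mult norm_power using K t by (intro mult_mono power_le_one) auto
      then show ?thesis using True r t by (simp add: add_increasing2)
    next
      case False
      then have "norm (D (Suc n)) \<le> r / 2" using M[of "Suc n"] by simp
      then have "norm (?g n) \<le> r / 2 * t ^ n"
        unfolding norm_mult norm_power using t r by (intro mult_mono) auto
      then show ?thesis using False by simp
    qed
    have h: "?h sums (real M * K + r / 2 * (1 / (1 - t)))"
      using sums_add[OF sums_If_finite[of "\<lambda>n. n < M" "\<lambda>_. K"] sums_mult[OF geometric_sums[of t], of "r / 2"]] t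
      by (simp add: lessThan_def[symmetric])
    have sum_norm: "summable (\<lambda>n. norm (?g n))"
      using le by (intro summable_comparison_test'[OF sums_summable[OF h]]) simp
    define s where "s = (suminf (\<lambda>n. ?g n))"
    have s: "?g sums s" unfolding s_def using summable_norm_cancel[OF sum_norm] by (rule summable_sums)
    have "(\<lambda>n. D (Suc n) * of_real t ^ Suc n) sums (of_real t * s)"
      using sums_mult[OF s, of "of_real t"] by (simp add: mult_ac)
    then have "(\<lambda>n. D n * of_real t ^ n) sums (of_real t * s + D 0 * of_real t ^ 0)"
      by (subst (asm) sums_Suc_iff[of "\<lambda>n. D n * of_real t ^ n"]) (simp add: algebra_simps)
    from sums_diff[OF s this] have "(\<lambda>n. a n * of_real t ^ n) sums (s - (of_real t * s - A))"
      by (simp add: D_def algebra_simps)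
    then have "(suminf (\<lambda>n. a n * of_real t ^ n)) - A = of_real (1 - t) * s"
      by (simp add: sums_iff algebra_simps)
    moreover have "norm s \<le> real M * K + r / 2 * (1 / (1 - t))"
    proof -
      have "norm s \<le> (suminf (\<lambda>n. norm (?g n)))" unfolding s_def by (rule summable_norm[OF sum_norm])
      also have "\<dots> \<le> (suminf (\<lambda>n. ?h n))" by (intro suminf_le le sum_norm sums_summable[OF h])
      finally show ?thesis using h by (simp add: sums_iff)
    qed
    ultimately have "norm ((suminf (\<lambda>n. a n * of_real t ^ n)) - A) \<le> (1 - t) * (real M * K + r / 2 * (1 / (1 - t)))"
      using t by (simp add: norm_mult del: of_real_diff)
    also have "\<dots> = (1 - t) * (real M * K) + r / 2" using t by (simp add: field_simps)
    finally show ?thesis .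
  qed
  obtain m0 :: nat where m0: "2 * (real M * K) / r < real m0" using reals_Archimedean2 by blast
  show "\<exists>no. \<forall>m\<ge>no. norm ((suminf (\<lambda>n. a n * of_real (1 - 1 / (real m + 2)) ^ n)) - A) < r"
  proof (intro exI[of _ m0] allI impI)
    fix m assume m: "m0 \<le> m"
    define t where "t = 1 - 1 / (real m + 2)"
    have "2 * (real M * K) / r < real m + 2" using m0 m by simp
    then have "(1 - t) * (real M * K) < r / 2" using r by (simp add: t_def field_simps)
    moreover have "0 < t" "t < 1" by (simp_all add: t_def field_simps)
    ultimately show "norm ((suminf (\<lambda>n. a n * of_real (1 - 1 / (real m + 2)) ^ n)) - A) < r"
      using bound[of t] unfolding t_def by linarith
  qed
qed

text \<open>Inside the unit disc all series converge absolutely and the Cauchy product applies;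
  Abel's theorem transfers the identity to the boundary. This covers the conditionally convergent
  values with last upper index 1.\<close>

lemma cauchy_product_limit:
  fixes a b :: "nat \<Rightarrow> complex"
  assumes a: "a sums A" and b: "b sums B" and c: "(\<lambda>n. \<Sum>i\<le>n. a i * b (n - i)) sums C"
  shows "A * B = C"
proof -
  let ?t = "\<lambda>m. of_real (1 - 1 / (real m + 2)) :: complex"
  have eq: "(suminf (\<lambda>n. a n * ?t m ^ n)) * (suminf (\<lambda>n. b n * ?t m ^ n)) = (suminf (\<lambda>n. (\<Sum>i\<le>n. a i * b (n - i)) * ?t m ^ n))" for m
  proof -
    have "norm (?t m) < norm (1 :: complex)"
      unfolding norm_of_real norm_one by (simp add: abs_if field_simps)
    then have abs: "summable (\<lambda>n. norm (f n * ?t m ^ n))" if "f sums F" for f F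
      using that sums_summable[OF that] by (intro powser_insidea[of f 1]) auto
    have "(suminf (\<lambda>n. a n * ?t m ^ n)) * (suminf (\<lambda>n. b n * ?t m ^ n)) =
        (suminf (\<lambda>n. \<Sum>i\<le>n. (a i * ?t m ^ i) * (b (n - i) * ?t m ^ (n - i))))"
      by (rule Cauchy_product[OF abs[OF a] abs[OF b]])
    also have "\<dots> = (suminf (\<lambda>n. (\<Sum>i\<le>n. a i * b (n - i)) * ?t m ^ n))"
    proof (intro suminf_cong)
      fix n
      have "(a i * ?t m ^ i) * (b (n - i) * ?t m ^ (n - i)) = a i * b (n - i) * ?t m ^ n" if "i \<le> n" for i
      proof -
        have "?t m ^ n = ?t m ^ i * ?t m ^ (n - i)" using that by (simp flip: power_add)
        then show ?thesis by (simp only: mult_ac)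
      qed
      then show "(\<Sum>i\<le>n. (a i * ?t m ^ i) * (b (n - i) * ?t m ^ (n - i))) = (\<Sum>i\<le>n. a i * b (n - i)) * ?t m ^ n"
        unfolding sum_distrib_right by (intro sum.cong) auto
    qed
    finally show ?thesis .
  qed
  have "(\<lambda>m. suminf (\<lambda>n. (\<Sum>i\<le>n. a i * b (n - i)) * ?t m ^ n)) \<longlonglongrightarrow> A * B"
    unfolding eq[symmetric] by (intro tendsto_mult abel_limit a b)
  then show ?thesis by (rule LIMSEQ_unique[OF _ abel_limit[OF c]])
qed

text \<open>(z - 1) z^n b_n is the increment of z^n b_n minus z^(n+1) (b_(n+1) - b_n): the
  increments telescope and the rest converges absolutely.\<close>

lemma dirichlet_summable:
  fixes z :: complex and b :: "nat \<Rightarrow> complex"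
  assumes z: "norm z = 1" "z \<noteq> 1" and b: "b \<longlonglongrightarrow> 0" and v: "summable (\<lambda>n. norm (b (Suc n) - b n))"
  shows "summable (\<lambda>n. z ^ n * b n)"
proof -
  have "(\<lambda>n. z ^ n * b n) \<longlonglongrightarrow> 0"
    by (rule tendsto_norm_zero_cancel) (use tendsto_norm_zero[OF b] in \<open>simp add: norm_mult norm_power z\<close>)
  then have "summable (\<lambda>n. z ^ Suc n * b (Suc n) - z ^ n * b n)" by (rule telescope_summable)
  moreover have "summable (\<lambda>n. z ^ Suc n * (b (Suc n) - b n))"
    by (rule summable_norm_cancel) (use v in \<open>simp add: norm_mult norm_power z\<close>)
  ultimately have "summable (\<lambda>n. ((z ^ Suc n * b (Suc n) - z ^ n * b n) - z ^ Suc n * (b (Suc n) - b n)) / (z - 1))"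
    by (rule summable_divide[OF summable_diff])
  moreover have "((z ^ Suc n * b (Suc n) - z ^ n * b n) - z ^ Suc n * (b (Suc n) - b n)) / (z - 1) = z ^ n * b n" for n
    using z by (simp add: field_simps)
  ultimately show ?thesis by (simp only:)
qed

lemma powr_over: "k \<ge> 1 \<Longrightarrow> real k powr a / real k = real k powr (a - 1)"
  by (simp add: powr_diff)

lemma harm_power_bound: "\<exists>C\<ge>0. \<forall>k\<ge>1. harm k ^ n \<le> C * real k powr (1 / 4)"
proof (cases "n = 0")
  case True
  have "1 \<le> 1 * real k powr (1 / 4)" if "k \<ge> 1" for k using that by (simp add: ge_one_powr_ge_zero)
  then show ?thesis using True by (intro exI[of _ 1]) auto
next
  case False
  \<comment> \<open>The n-th power of k^e is then k^(1/4). This exponent leaves k^(-7/4) after the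
    two divisions by k made later, which is summable.\<close>
  define e where "e = 1 / (4 * real n)"
  have e: "e > 0" using False by (simp add: e_def)
  show ?thesis
  proof (intro exI[of _ "(1 + 1 / e) ^ n"] conjI allI impI)
    fix k :: nat assume k: "k \<ge> 1"
    have "harm k - ln k \<le> harm 1 - ln (real 1)"
      using decseqD[OF decseq_harm_diff_ln, of 0 "k - 1"] k by simp
    also have "\<dots> = 1" by (simp add: harm_expand)
    finally have "harm k \<le> 1 + ln k" by simp
    also have "\<dots> \<le> real k powr e + real k powr e / e"
      using k e ln_powr_bound[of k e] by (intro add_mono ge_one_powr_ge_zero) auto
    also have "\<dots> = (1 + 1 / e) * real k powr e" using e by (simp add: field_simps)
    finally have "harm k ^ n \<le> ((1 + 1 / e) * real k powr e) ^ n"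
      by (intro power_mono) (auto simp: harm_nonneg)
    also have "\<dots> = (1 + 1 / e) ^ n * real k powr (e * real n)"
      using k by (simp add: power_mult_distrib powr_powr flip: powr_realpow)
    also have "e * real n = 1 / 4" using False by (simp add: e_def)
    finally show "harm k ^ n \<le> (1 + 1 / e) ^ n * real k powr (1 / 4)" .
  qed (use e in auto)
qed

section \<open>Multiple polylogarithms at roots of unity\<close>

text \<open>
  The coefficient of \<open>z\<^sup>k\<close> in the iterated integral attached to a word, where \<open>X\<close> stands for
  \<open>dz / z\<close> and \<open>Y a\<close> for \<open>\<eta>\<^sup>a dz / (1 - \<eta>\<^sup>a z)\<close>.  The word is read from right to left.
\<close>

primrec li_coeff :: "nat \<Rightarrow> letter list \<Rightarrow> nat \<Rightarrow> complex" where
  "li_coeff N [] = (\<lambda>k. if k = 0 then 1 else 0)"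
| "li_coeff N (l # w) = (\<lambda>k. (case l of X \<Rightarrow> li_coeff N w k
     | Y a \<Rightarrow> \<Sum>j<k. \<eta> N powi (a * int (k - j)) * li_coeff N w j) / of_nat k)"

lemma li_coeff_0 [simp]: "w \<noteq> [] \<Longrightarrow> li_coeff N w 0 = 0"
  by (cases w) auto

definition li_fps :: "nat \<Rightarrow> letter list \<Rightarrow> complex fps" where
  "li_fps N w = Abs_fps (li_coeff N w)"

text \<open>The differential form of a letter divided by dz / z: it is 1 for x, and \<eta>^a z / (1
  - \<eta>^a z), a geometric series without constant term, for y_a.\<close>

definition form_fps :: "nat \<Rightarrow> letter \<Rightarrow> complex fps" where
  "form_fps N l = (case l of X \<Rightarrow> 1 | Y a \<Rightarrow> Abs_fps (\<lambda>m. if m = 0 then 0 else \<eta> N powi (a * int m)))"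

definition euler_deriv :: "complex fps \<Rightarrow> complex fps" where
  "euler_deriv f = Abs_fps (\<lambda>k. of_nat k * fps_nth f k)"

lemma euler_deriv_eq: "euler_deriv f = fps_X * fps_deriv f"
proof (rule fps_ext)
  fix n show "fps_nth (euler_deriv f) n = fps_nth (fps_X * fps_deriv f) n"
    by (cases n) (simp_all add: euler_deriv_def)
qed

lemma euler_deriv_add: "euler_deriv (f + g) = euler_deriv f + euler_deriv g"
  by (simp add: euler_deriv_eq algebra_simps)

lemma euler_deriv_mult: "euler_deriv (f * g) = euler_deriv f * g + f * euler_deriv g"
  by (simp add: euler_deriv_eq algebra_simps)

lemma euler_deriv_inject:
  assumes "euler_deriv f = euler_deriv g" "fps_nth f 0 = fps_nth g 0"
  shows "f = g"
proof (rule fps_ext)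
  fix n
  have "of_nat n * fps_nth f n = of_nat n * fps_nth g n"
    using arg_cong[OF assms(1), of "\<lambda>h. fps_nth h n"] by (simp add: euler_deriv_def)
  then show "fps_nth f n = fps_nth g n" using assms(2) by (cases "n = 0") auto
qed

text \<open>The differential equation of iterated integrals. A lone dz / z would integrate to a
  logarithm, which has no power series; for that word division by zero makes \<open>li_fps\<close>
  vanish, and the premise excludes it.\<close>

lemma euler_deriv_li:
  assumes "l = X \<longrightarrow> w \<noteq> []"
  shows "euler_deriv (li_fps N (l # w)) = form_fps N l * li_fps N w"
proof (rule fps_ext)
  fix k
  show "fps_nth (euler_deriv (li_fps N (l # w))) k = fps_nth (form_fps N l * li_fps N w) k"
  proof (cases l)
    case X
    then show ?thesis using assms by (cases "k = 0") (simp_all add: euler_deriv_def li_fps_def form_fps_def)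
  next
    case (Y a)
    have "fps_nth (form_fps N l * li_fps N w) k =
        (\<Sum>j=0..k. (if k - j = 0 then 0 else \<eta> N powi (a * int (k - j))) * li_coeff N w j)"
      unfolding mult.commute[of "form_fps N l"] fps_mult_nth
      by (intro sum.cong) (simp_all add: form_fps_def li_fps_def Y)
    also have "\<dots> = (\<Sum>j<k. \<eta> N powi (a * int (k - j)) * li_coeff N w j)"
      by (rule sum.mono_neutral_cong_right) auto
    finally show ?thesis by (cases "k = 0") (simp_all add: euler_deriv_def li_fps_def Y)
  qed
qed

text \<open>The product rule for z d/dz reproduces the recursion of the shuffle product by first
  letters, and all constant terms vanish once both words are nonempty. The condition on the last
  letter keeps the logarithm away.\<close>

lemma li_fps_shuffle:
  assumes "u = [] \<or> last u \<noteq> X" "v = [] \<or> last v \<noteq> X"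
  shows "li_fps N u * li_fps N v = (\<Sum>w\<in>#shuffle u v. li_fps N w)"
  using assms
proof (induction u v rule: shuffle.induct)
  case (1 v)
  have "li_fps N [] = 1" by (rule fps_ext) (simp add: li_fps_def)
  then show ?case by simp
next
  case (2 a u)
  have "li_fps N [] = 1" by (rule fps_ext) (simp add: li_fps_def)
  then show ?case by simp
next
  case (3 a u b v)
  have uv: "u = [] \<or> last u \<noteq> X" "v = [] \<or> last v \<noteq> X" "a = X \<longrightarrow> u \<noteq> []" "b = X \<longrightarrow> v \<noteq> []"
    using 3(3,4) by (auto split: if_splits)
  have sum_a: "(\<Sum>w\<in>#shuffle u (b # v). euler_deriv (li_fps N (a # w))) =
      form_fps N a * (\<Sum>w\<in>#shuffle u (b # v). li_fps N w)"
    unfolding sum_mset_distrib_left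
    by (intro arg_cong[where f = sum_mset] image_mset_cong euler_deriv_li) (auto dest: length_shuffle)
  have sum_b: "(\<Sum>w\<in>#shuffle (a # u) v. euler_deriv (li_fps N (b # w))) =
      form_fps N b * (\<Sum>w\<in>#shuffle (a # u) v. li_fps N w)"
    unfolding sum_mset_distrib_left
    by (intro arg_cong[where f = sum_mset] image_mset_cong euler_deriv_li) (auto dest: length_shuffle)
  show ?case
  proof (rule euler_deriv_inject)
    have "euler_deriv (li_fps N (a # u) * li_fps N (b # v)) =
        form_fps N a * (li_fps N u * li_fps N (b # v)) + form_fps N b * (li_fps N (a # u) * li_fps N v)"
      unfolding euler_deriv_mult euler_deriv_li[OF uv(3)] euler_deriv_li[OF uv(4)] by (simp only: mult_ac)
    also have "\<dots> = form_fps N a * (\<Sum>w\<in>#shuffle u (b # v). li_fps N w)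
        + form_fps N b * (\<Sum>w\<in>#shuffle (a # u) v. li_fps N w)"
      using 3 uv by simp
    also have "\<dots> = euler_deriv (\<Sum>w\<in>#shuffle (a # u) (b # v). li_fps N w)"
      unfolding additive_sum_mset[of euler_deriv, OF euler_deriv_add]
      by (simp add: sum_a sum_b multiset.map_comp comp_def)
    finally show "euler_deriv (li_fps N (a # u) * li_fps N (b # v)) =
        euler_deriv (\<Sum>w\<in>#shuffle (a # u) (b # v). li_fps N w)" .
    have "fps_nth (\<Sum>w\<in>#M. li_fps N w) 0 = 0" if "[] \<notin># M" for M
      using that by (induction M) (auto simp: li_fps_def)
    moreover have "[] \<notin># shuffle (a # u) (b # v)" by auto
    ultimately have "fps_nth (\<Sum>w\<in>#shuffle (a # u) (b # v). li_fps N w) 0 = 0" by blast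
    moreover have "fps_nth (li_fps N (a # u) * li_fps N (b # v)) 0 = 0"
      by (simp add: li_fps_def)
    ultimately show "fps_nth (li_fps N (a # u) * li_fps N (b # v)) 0 =
        fps_nth (\<Sum>w\<in>#shuffle (a # u) (b # v). li_fps N w) 0" by simp
  qed
qed

context level
begin

lemma norm_eta_powi [simp]: "norm (\<eta> N powi k) = 1"
proof -
  have "norm (\<eta> N) = 1"
  proof -
    have "\<eta> N = exp (\<i> * of_real (2 * pi / real N))" by (simp add: \<eta>_def mult_ac)
    then show ?thesis by (simp only: norm_exp_i_times)
  qed
  then show ?thesis by (simp add: norm_power_int)
qed

lemma norm_li_sum:
  assumes IH: "\<And>k. k \<ge> 1 \<Longrightarrow> w \<noteq> [] \<Longrightarrow> norm (li_coeff N w k) \<le> harm k ^ (length w - 1) / real k" and k: "k \<ge> 1"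
  shows "norm (\<Sum>j<k. \<eta> N powi (a * int (k - j)) * li_coeff N w j) \<le> harm k ^ length w"
proof (cases "w = []")
  case True
  have "(\<Sum>j<k. \<eta> N powi (a * int (k - j)) * li_coeff N w j) = (\<Sum>j\<in>{0}. \<eta> N powi (a * int (k - j)))"
    using True k by (intro sum.mono_neutral_cong_right) auto
  then show ?thesis using True by simp
next
  case False
  have "norm (\<Sum>j<k. \<eta> N powi (a * int (k - j)) * li_coeff N w j) \<le> (\<Sum>j<k. norm (li_coeff N w j))"
    by (rule order.trans[OF norm_sum]) (simp add: norm_mult)
  also have "\<dots> = (\<Sum>j\<in>{1..<k}. norm (li_coeff N w j))"
    using False by (intro sum.mono_neutral_right) (auto simp: not_less_eq_eq)
  also have "\<dots> \<le> (\<Sum>j\<in>{1..<k}. harm k ^ (length w - 1) * (1 / real j))"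
  proof (intro sum_mono)
    fix j assume j: "j \<in> {1..<k}"
    have "norm (li_coeff N w j) \<le> harm j ^ (length w - 1) / real j" using j by (intro IH False) auto
    also have "\<dots> \<le> harm k ^ (length w - 1) / real j"
      using j by (intro divide_right_mono power_mono harm_mono) (auto simp: harm_nonneg)
    finally show "norm (li_coeff N w j) \<le> harm k ^ (length w - 1) * (1 / real j)" by simp
  qed
  also have "\<dots> = harm k ^ (length w - 1) * (\<Sum>j\<in>{1..<k}. 1 / real j)" by (simp add: sum_distrib_left)
  also have "\<dots> \<le> harm k ^ (length w - 1) * harm k"
  proof (intro mult_left_mono)
    show "(\<Sum>j\<in>{1..<k}. 1 / real j) \<le> harm k"
      unfolding harm_def inverse_eq_divide by (rule sum_mono2) auto
  qed (simp add: harm_nonneg)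
  also have "\<dots> = harm k ^ length w" using False by (cases w) (simp_all add: mult.commute)
  finally show ?thesis .
qed

text \<open>A letter y_a sums bounds of the form H^n / j over j < k and so gains one harmonic
  number, while x only divides by k. The growth is thus a power of the logarithm divided by
  k.\<close>

lemma norm_li_coeff:
  assumes "w = [] \<or> last w \<noteq> X" "w \<noteq> []" "k \<ge> 1"
  shows "norm (li_coeff N w k) \<le> harm k ^ (length w - 1) / real k"
  using assms
proof (induction w arbitrary: k)
  case (Cons l w)
  have w: "w = [] \<or> last w \<noteq> X" and l: "l = X \<longrightarrow> w \<noteq> []" using Cons.prems by (auto split: if_splits)
  have h1: "harm k \<ge> (1 :: real)" using harm_mono[of 1 k] Cons.prems by (simp add: harm_expand)
  show ?case
  proof (cases l)
    case X
    have "norm (li_coeff N (l # w) k) = norm (li_coeff N w k) / real k" by (simp add: X norm_divide)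
    also have "\<dots> \<le> (harm k ^ (length w - 1) / real k) / real k"
      using X l w Cons.prems by (intro divide_right_mono Cons.IH) auto
    also have "\<dots> \<le> (harm k ^ length w / 1) / real k"
      using Cons.prems h1 by (intro divide_right_mono frac_le power_increasing) (auto simp: harm_nonneg)
    finally show ?thesis by simp
  next
    case (Y a)
    have "norm (li_coeff N (l # w) k) = norm (\<Sum>j<k. \<eta> N powi (a * int (k - j)) * li_coeff N w j) / real k"
      by (simp add: Y norm_divide)
    also have "\<dots> \<le> harm k ^ length w / real k"
      using w Cons.prems by (intro divide_right_mono norm_li_sum Cons.IH) auto
    finally show ?thesis by simp
  qed
qed simp

text \<open>Besides the words of \<open>H0_words\<close> it admits the single letters y_b with b
  \<noteq> 0, whose series converge too. The excluded words are those beginning with x or ending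
  with y_0, which the two regularisations treat.\<close>

definition convergent_word :: "letter list \<Rightarrow> bool" where
  "convergent_word w \<longleftrightarrow> w = [] \<or> (hd w \<noteq> X \<and> last w \<noteq> Y 0)"

lemma summable_powr_74: "summable (\<lambda>k. C * real k powr (- 7 / 4))"
  by (intro summable_mult) (simp add: summable_real_powr_iff)

text \<open>A last letter x brings a further division by k and absolute convergence. A last letter
  y_a with a \<noteq> 0 makes the k-th coefficient \<eta>^(a k) b_k with b of bounded variation and
  limit 0, so Dirichlet's test applies.\<close>

lemma summable_li:
  assumes w: "convergent_word w" and letters: "w \<in> lists (letters N)"
  shows "summable (li_coeff N (rev w))"
proof (cases "rev w")
  case Nil
  then show ?thesis by (simp add: summable_finite[of "{0}"])
next
  case (Cons l v)
  have wne: "w \<noteq> []" using Cons by auto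
  then have hl: "hd w = last (l # v)" "last w = l" using Cons by (metis last_rev, metis hd_rev list.sel(1))
  then have last: "last (l # v) \<noteq> X" and l0: "l \<noteq> Y 0" using w wne by (auto simp: convergent_word_def)
  have v: "v = [] \<or> last v \<noteq> X" and lX: "l = X \<longrightarrow> v \<noteq> []" using last by (auto split: if_splits)
  show ?thesis
  proof (cases l)
    case X
    then have vne: "v \<noteq> []" using lX by simp
    obtain C where C: "C \<ge> 0" "\<And>k. k \<ge> 1 \<Longrightarrow> harm k ^ (length v - 1) \<le> C * real k powr (1 / 4)"
      using harm_power_bound by blast
    have "norm (li_coeff N (rev w) k) \<le> C * real k powr (- 7 / 4)" if k: "k \<ge> 1" for k
    proof -
      have "norm (li_coeff N (rev w) k) = norm (li_coeff N v k) / real k" by (simp add: Cons X norm_divide)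
      also have "\<dots> \<le> (harm k ^ (length v - 1) / real k) / real k"
        using v vne k by (intro divide_right_mono norm_li_coeff) auto
      also have "\<dots> \<le> (C * real k powr (1 / 4) / real k) / real k"
        using k C by (intro divide_right_mono) auto
      also have "\<dots> = C * (real k powr (1 / 4) / real k / real k)" by simp
      also have "\<dots> = C * real k powr (1 / 4 - 1 - 1)" using k by (simp only: powr_over)
      finally show ?thesis by simp
    qed
    then show ?thesis by (intro summable_comparison_test'[OF summable_powr_74[of C], of 1]) auto
  next
    case (Y a)
    have aN: "a \<in> residues_mod N" "a \<noteq> 0"
    proof -
      have "l \<in> set w" using Cons by (metis list.set_intros(1) set_rev)
      then show "a \<in> residues_mod N" using letters Y by (auto simp: letters_def)
      show "a \<noteq> 0" using l0 Y by auto
    qed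
    define s where "s k = (\<Sum>j<k. \<eta> N powi (- (a * int j)) * li_coeff N v j)" for k
    define b where "b k = s k / of_nat k" for k
    have coeff: "li_coeff N (rev w) k = (\<eta> N powi a) ^ k * b k" for k
    proof -
      have "(\<Sum>j<k. \<eta> N powi (a * int (k - j)) * li_coeff N v j) = (\<eta> N powi a) ^ k * s k"
        unfolding s_def sum_distrib_left
      proof (intro sum.cong refl)
        fix j assume "j \<in> {..<k}"
        then have "\<eta> N powi (a * int (k - j)) = \<eta> N powi (a * int k + - (a * int j))"
          by (simp add: of_nat_diff algebra_simps)
        also have "\<dots> = (\<eta> N powi a) ^ k * \<eta> N powi (- (a * int j))"
          by (subst power_int_add) (simp_all add: power_int_mult)
        finally show "\<eta> N powi (a * int (k - j)) * li_coeff N v j = (\<eta> N powi a) ^ k * (\<eta> N powi (- (a * int j)) * li_coeff N v j)"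
          by simp
      qed
      then show ?thesis by (simp add: Cons Y b_def)
    qed
    obtain C where C: "C \<ge> 0" "\<And>k. k \<ge> 1 \<Longrightarrow> harm k ^ length v \<le> C * real k powr (1 / 4)"
      using harm_power_bound by blast
    have s_bound: "norm (s k) \<le> C * real k powr (1 / 4)" if k: "k \<ge> 1" for k
    proof -
      have "norm (s k) = norm ((\<eta> N powi a) ^ k * s k)" by (simp add: norm_mult norm_power)
      also have "\<dots> = norm (\<Sum>j<k. \<eta> N powi (a * int (k - j)) * li_coeff N v j)"
        using coeff[of k] k by (simp add: Cons Y b_def)
      also have "\<dots> \<le> harm k ^ length v" using v k by (intro norm_li_sum norm_li_coeff)
      finally show ?thesis using C(2)[OF k] by simp
    qed
    have li_bound: "norm (li_coeff N v k) \<le> C * real k powr (- 3 / 4)" if k: "k \<ge> 1" for k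
    proof (cases "v = []")
      case True
      then show ?thesis using k C by simp
    next
      case False
      have h1: "harm k \<ge> (1 :: real)" using harm_mono[of 1 k] k by (simp add: harm_expand)
      have "norm (li_coeff N v k) \<le> harm k ^ (length v - 1) / real k" using v False k by (intro norm_li_coeff)
      also have "\<dots> \<le> harm k ^ length v / real k" using h1 by (intro divide_right_mono power_increasing) auto
      also have "\<dots> \<le> C * real k powr (1 / 4) / real k" using C(2)[OF k] k by (intro divide_right_mono) auto
      also have "\<dots> = C * real k powr (1 / 4 - 1)" using k by (simp only: powr_over flip: times_divide_eq_right)
      finally show ?thesis by simp
    qed
    have b_bound: "norm (b k) \<le> C * real k powr (- 3 / 4)" if k: "k \<ge> 1" for k
    proof -
      have "norm (b k) \<le> C * real k powr (1 / 4) / real k"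
        unfolding b_def norm_divide using s_bound[OF k] by (simp add: divide_right_mono)
      also have "\<dots> = C * real k powr (1 / 4 - 1)" using k by (simp only: powr_over flip: times_divide_eq_right)
      finally show ?thesis by simp
    qed
    have "b \<longlonglongrightarrow> 0"
    proof (rule Lim_null_comparison)
      show "\<forall>\<^sub>F k in sequentially. norm (b k) \<le> C * real k powr (- 3 / 4)"
        using b_bound by (intro eventually_sequentiallyI[of 1])
      show "(\<lambda>k. C * real k powr (- 3 / 4)) \<longlonglongrightarrow> 0"
        by (intro tendsto_mult_right_zero tendsto_neg_powr filterlim_real_sequentially) simp
    qed
    moreover have "summable (\<lambda>k. norm (b (Suc k) - b k))"
    proof -
      have "norm (b (Suc k) - b k) \<le> 2 * C * real k powr (- 7 / 4)" if k: "k \<ge> 1" for k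
      proof -
        \<comment> \<open>The increment is the newly added summand minus b k, divided by k + 1. Both
          are O(k^(-3/4)), so the quotient is O(k^(-7/4)).\<close>
        have "b (Suc k) - b k = \<eta> N powi (- (a * int k)) * li_coeff N v k / of_nat (Suc k) - b k / of_nat (Suc k)"
        proof -
          have *: "(y + c) / (x + 1) - y / x = c / (x + 1) - y / x / (x + 1)"
            if "x \<noteq> 0" "x + 1 \<noteq> 0" for x y c :: complex
            using that by (simp add: divide_simps) (simp add: algebra_simps)
          have s1: "s (Suc k) = s k + \<eta> N powi (- (a * int k)) * li_coeff N v k" by (simp add: s_def)
          have n1: "of_nat (Suc k) = (of_nat k + 1 :: complex)" by simp
          have nz: "(of_nat k :: complex) \<noteq> 0" "(of_nat k + 1 :: complex) \<noteq> 0"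
            using k of_nat_neq_0[of k, where 'a = complex] by (auto simp: add.commute)
          show ?thesis unfolding b_def s1 n1 by (rule *[OF nz])
        qed
        also have "norm \<dots> \<le> norm (li_coeff N v k) / real (Suc k) + norm (b k) / real (Suc k)"
          by (rule order.trans[OF norm_triangle_ineq4]) (simp add: norm_mult norm_divide del: of_nat_Suc)
        also have "\<dots> \<le> C * real k powr (- 3 / 4) / real k + C * real k powr (- 3 / 4) / real k"
          using k li_bound[OF k] b_bound[OF k] C(1) by (intro add_mono frac_le) auto
        also have "\<dots> = 2 * C * (real k powr (- 3 / 4) / real k)" by simp
        also have "\<dots> = 2 * C * real k powr (- 3 / 4 - 1)" using k by (simp only: powr_over)
        finally show ?thesis by simp
      qed
      then show ?thesis by (intro summable_comparison_test'[OF summable_powr_74[of "2 * C"], of 1]) auto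
    qed
    moreover have "\<eta> N powi a \<noteq> 1" using aN eta_powi_inj[of a 0] N by (auto simp: eta_powi_eq_1 residues_mod_def)
    ultimately have "summable (\<lambda>k. (\<eta> N powi a) ^ k * b k)"
      by (intro dirichlet_summable) auto
    moreover have "li_coeff N (rev w) = (\<lambda>k. (\<eta> N powi a) ^ k * b k)" by (rule ext) (rule coeff)
    ultimately show ?thesis by simp
  qed
qed

definition li_value :: "letter list \<Rightarrow> complex" where
  "li_value w = (suminf (\<lambda>k. li_coeff N (rev w) k))"

lemma convergent_word_shuffle:
  "w \<in># shuffle u v \<Longrightarrow> convergent_word u \<Longrightarrow> convergent_word v \<Longrightarrow> convergent_word w"
  using hd_shuffle[of w u v] last_shuffle[of w u v] unfolding convergent_word_def by metis

text \<open>The power series identity for the reversed words says that the Cauchy product of the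
  coefficients is the sum over the shuffles; convergence is preserved because ends of shuffles are
  ends of the factors.\<close>

lemma li_value_mult:
  assumes u: "convergent_word u" "u \<in> lists (letters N)" and v: "convergent_word v" "v \<in> lists (letters N)"
  shows "li_value u * li_value v = (\<Sum>w\<in>#shuffle u v. li_value w)"
proof (rule cauchy_product_limit)
  show "li_coeff N (rev u) sums li_value u" "li_coeff N (rev v) sums li_value v"
    unfolding li_value_def by (intro summable_sums summable_li u v)+
  have sums: "(\<lambda>k. \<Sum>w\<in>#M. li_coeff N (rev w) k) sums (\<Sum>w\<in>#M. li_value w)"
    if "\<And>w. w \<in># M \<Longrightarrow> summable (li_coeff N (rev w))" for M
    using that by (induction M) (auto intro!: sums_add summable_sums simp: li_value_def)
  have "(\<lambda>k. \<Sum>w\<in>#shuffle u v. li_coeff N (rev w) k) sums (\<Sum>w\<in>#shuffle u v. li_value w)"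
  proof (rule sums)
    fix w assume w: "w \<in># shuffle u v"
    show "summable (li_coeff N (rev w))"
      by (rule summable_li[OF convergent_word_shuffle[OF w u(1) v(1)] lists_shuffle[OF w u(2) v(2)]])
  qed
  moreover have "(\<Sum>i\<le>k. li_coeff N (rev u) i * li_coeff N (rev v) (k - i)) =
      (\<Sum>w\<in>#shuffle u v. li_coeff N (rev w) k)" for k
  proof -
    have last: "rev y = [] \<or> last (rev y) \<noteq> X" if "convergent_word y" for y
      using that by (cases y) (auto simp: convergent_word_def)
    have nth: "fps_nth (\<Sum>w\<in>#M. li_fps N w) k = (\<Sum>w\<in>#M. li_coeff N w k)" for M
      by (induction M) (auto simp: li_fps_def)
    have "fps_nth (li_fps N (rev u) * li_fps N (rev v)) k = (\<Sum>w\<in>#shuffle (rev u) (rev v). li_coeff N w k)"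
      unfolding li_fps_shuffle[OF last[OF u(1)] last[OF v(1)]] nth ..
    then show ?thesis
      unfolding shuffle_rev fps_mult_nth by (simp add: li_fps_def multiset.map_comp comp_def atLeast0AtMost)
  qed
  ultimately show "(\<lambda>k. \<Sum>i\<le>k. li_coeff N (rev u) i * li_coeff N (rev v) (k - i)) sums (\<Sum>w\<in>#shuffle u v. li_value w)"
    by simp
qed

lemma li_coeff_block:
  assumes "n \<ge> 1"
  shows "li_coeff N (replicate (n - 1) X @ Y a # v) k =
    (\<Sum>j<k. \<eta> N powi (a * int (k - j)) * li_coeff N v j) / of_nat k ^ n"
proof -
  have "li_coeff N (replicate m X @ Y a # v) k =
      (\<Sum>j<k. \<eta> N powi (a * int (k - j)) * li_coeff N v j) / of_nat k ^ Suc m" for m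
    by (induction m) (simp_all add: field_simps)
  from this[of "n - 1"] assms show ?thesis by simp
qed

lemma word_of_simps [simp]:
  "word_of [] = []" "word_of ((n, a) # w) = Y a # replicate (n - 1) X @ word_of w"
  "word_of (w @ w') = word_of w @ word_of w'"
  by (simp_all add: word_of_def)

definition increasing :: "nat \<Rightarrow> nat \<Rightarrow> nat list set" where
  "increasing r K = {k. length k = r \<and> sorted_wrt (<) k \<and> set k \<subseteq> {1..K}}"

lemma finite_increasing [simp]: "finite (increasing r K)"
  by (rule finite_subset[OF _ finite_lists_length_eq[of "{1..K}" r]]) (auto simp: increasing_def)

lemma increasing_0 [simp]: "increasing 0 K = {[]}"
  by (auto simp: increasing_def)

lemma increasing_Suc:
  "increasing (Suc r) K = (\<lambda>(k, ks). ks @ [k]) ` (SIGMA k:{1..K}. increasing r (k - 1))"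
proof (intro equalityI subsetI)
  fix x assume x: "x \<in> increasing (Suc r) K"
  then obtain ks k where "x = ks @ [k]" by (cases x rule: rev_cases) (auto simp: increasing_def)
  with x show "x \<in> (\<lambda>(k, ks). ks @ [k]) ` (SIGMA k:{1..K}. increasing r (k - 1))"
    by (intro image_eqI[of _ _ "(k, ks)"]) (fastforce simp: increasing_def sorted_wrt_append)+
next
  fix x assume "x \<in> (\<lambda>(k, ks). ks @ [k]) ` (SIGMA k:{1..K}. increasing r (k - 1))"
  then obtain k ks where "x = ks @ [k]" "k \<in> {1..K}" "ks \<in> increasing r (k - 1)" by auto
  then show "x \<in> increasing (Suc r) K" by (fastforce simp: increasing_def sorted_wrt_append)
qed

lemma sum_increasing_Suc:
  "(\<Sum>x\<in>increasing (Suc r) K. f x) = (\<Sum>k\<in>{1..K}. \<Sum>ks\<in>increasing r (k - 1). f (ks @ [k]))"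
proof -
  have "inj_on (\<lambda>(k, ks). ks @ [k]) (SIGMA k:{1..K}. increasing r (k - 1))"
    by (auto simp: inj_on_def)
  then show ?thesis unfolding increasing_Suc
    by (simp add: sum.reindex sum.Sigma case_prod_unfold)
qed

text \<open>\<open>b\<close> plays the role of the entry following the last one.\<close>

definition partial_L :: "index_word \<Rightarrow> int \<Rightarrow> nat \<Rightarrow> complex" where
  "partial_L w b K = (\<Sum>k\<in>increasing (length w) K. \<Prod>j<length w.
     \<eta> N powi ((snd (w ! j) - (if j + 1 < length w then snd (w ! (j + 1)) else b)) * int (k ! j))
       / of_nat (k ! j) ^ fst (w ! j))"

text \<open>Induction from the right end, with the largest summation index summed last. The
  exponents a_j - a_(j+1) couple neighbouring blocks, so the entry b behind the last block must
  vary; it accounts for the twist \<eta>^(-b k).\<close>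

lemma partial_L_eq:
  assumes "w \<in> H1_words N"
  shows "partial_L w b K = (\<Sum>k\<le>K. \<eta> N powi (- (b * int k)) * li_coeff N (rev (word_of w)) k)"
  using assms
proof (induction w arbitrary: b K rule: rev_induct)
  case Nil
  have "(\<Sum>k\<le>K. \<eta> N powi (- (b * int k)) * li_coeff N [] k) = (\<Sum>k\<in>{0}. \<eta> N powi (- (b * int k)))"
    by (intro sum.mono_neutral_cong_right) auto
  then show ?case by (simp add: partial_L_def)
next
  case (snoc p w)
  obtain n a where p: "p = (n, a)" by (cases p)
  have w: "w \<in> H1_words N" and n: "n \<ge> 1" using snoc.prems p by (auto simp: H1_words_def)
  let ?r = "length w"
  have "partial_L (w @ [p]) b K = (\<Sum>k\<in>{1..K}. \<eta> N powi ((a - b) * int k) / of_nat k ^ n * partial_L w a (k - 1))"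
  proof -
    have "(\<Prod>j<Suc ?r. \<eta> N powi ((snd ((w @ [p]) ! j) - (if j + 1 < Suc ?r then snd ((w @ [p]) ! (j + 1)) else b)) * int ((ks @ [k]) ! j))
          / of_nat ((ks @ [k]) ! j) ^ fst ((w @ [p]) ! j)) =
        \<eta> N powi ((a - b) * int k) / of_nat k ^ n * (\<Prod>j<?r.
          \<eta> N powi ((snd (w ! j) - (if j + 1 < ?r then snd (w ! (j + 1)) else a)) * int (ks ! j)) / of_nat (ks ! j) ^ fst (w ! j))"
      if ks: "ks \<in> increasing ?r (k - 1)" for k ks
    proof -
      have len: "length ks = ?r" using ks by (simp add: increasing_def)
      have "(\<Prod>j<?r. \<eta> N powi ((snd ((w @ [p]) ! j) - (if j + 1 < Suc ?r then snd ((w @ [p]) ! (j + 1)) else b)) * int ((ks @ [k]) ! j))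
          / of_nat ((ks @ [k]) ! j) ^ fst ((w @ [p]) ! j)) = (\<Prod>j<?r.
          \<eta> N powi ((snd (w ! j) - (if j + 1 < ?r then snd (w ! (j + 1)) else a)) * int (ks ! j)) / of_nat (ks ! j) ^ fst (w ! j))"
        using len by (intro prod.cong refl) (auto simp: nth_append p less_Suc_eq)
      then show ?thesis using len by (simp add: nth_append p)
    qed
    then show ?thesis
      unfolding partial_L_def by (simp add: sum_increasing_Suc sum_distrib_left del: prod.lessThan_Suc)
  qed
  also have "\<dots> = (\<Sum>k\<in>{1..K}. \<eta> N powi (- (b * int k)) * li_coeff N (rev (word_of (w @ [p]))) k)"
  proof (intro sum.cong refl)
    fix k assume k: "k \<in> {1..K}"
    then have "{..k - 1} = {..<k}" by auto
    then have "partial_L w a (k - 1) = (\<Sum>j<k. \<eta> N powi (- (a * int j)) * li_coeff N (rev (word_of w)) j)"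
      using snoc.IH[OF w, of a "k - 1"] by simp
    then have "\<eta> N powi ((a - b) * int k) / of_nat k ^ n * partial_L w a (k - 1) =
        (\<Sum>j<k. \<eta> N powi ((a - b) * int k) * \<eta> N powi (- (a * int j)) * li_coeff N (rev (word_of w)) j) / of_nat k ^ n"
      by (simp add: sum_distrib_left mult.assoc sum_divide_distrib)
    also have "\<dots> = (\<Sum>j<k. \<eta> N powi (- (b * int k)) * (\<eta> N powi (a * int (k - j)) * li_coeff N (rev (word_of w)) j)) / of_nat k ^ n"
    proof (intro arg_cong[where f = "\<lambda>x. x / of_nat k ^ n"] sum.cong refl)
      fix j assume "j \<in> {..<k}"
      then have "(a - b) * int k + - (a * int j) = - (b * int k) + a * int (k - j)"
        by (simp add: of_nat_diff algebra_simps)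
      then have "\<eta> N powi ((a - b) * int k) * \<eta> N powi (- (a * int j)) = \<eta> N powi (- (b * int k)) * \<eta> N powi (a * int (k - j))"
        by (metis eta_nonzero power_int_add)
      then show "\<eta> N powi ((a - b) * int k) * \<eta> N powi (- (a * int j)) * li_coeff N (rev (word_of w)) j =
          \<eta> N powi (- (b * int k)) * (\<eta> N powi (a * int (k - j)) * li_coeff N (rev (word_of w)) j)" by simp
    qed
    also have "\<dots> = \<eta> N powi (- (b * int k)) * li_coeff N (replicate (n - 1) X @ Y a # rev (word_of w)) k"
      unfolding li_coeff_block[OF n] by (simp add: sum_distrib_left)
    finally show "\<eta> N powi ((a - b) * int k) / of_nat k ^ n * partial_L w a (k - 1) =
        \<eta> N powi (- (b * int k)) * li_coeff N (rev (word_of (w @ [p]))) k"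
      by (simp add: p)
  qed
  also have "\<dots> = (\<Sum>k\<le>K. \<eta> N powi (- (b * int k)) * li_coeff N (rev (word_of (w @ [p]))) k)"
  proof (rule sum.mono_neutral_left)
    have "rev (word_of (w @ [p])) \<noteq> []" by (simp add: p)
    then show "\<forall>k\<in>{..K} - {1..K}. \<eta> N powi (- (b * int k)) * li_coeff N (rev (word_of (w @ [p]))) k = 0"
      by (auto simp: not_less_eq_eq)
  qed auto
  finally show ?case .
qed

lemma word_of_lists: "w \<in> H1_words N \<Longrightarrow> word_of w \<in> lists (letters N)"
  by (induction w) (auto simp: letters_def)

lemma H0_words_convergent: "w \<in> H0_words N \<Longrightarrow> convergent_word w"
  by (auto simp: H0_words_def convergent_word_def)

lemma L_series_eq:
  assumes w: "w \<in> H1_words N" "word_of w \<in> H0_words N"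
  shows "L_series N w = li_value (word_of w)"
proof -
  have "(\<lambda>K. \<Sum>k\<le>K. li_coeff N (rev (word_of w)) k) \<longlonglongrightarrow> li_value (word_of w)"
    unfolding li_value_def
    by (intro summable_LIMSEQ' summable_li H0_words_convergent word_of_lists w)
  moreover have "partial_L w 0 = (\<lambda>K. \<Sum>k\<le>K. li_coeff N (rev (word_of w)) k)"
    using partial_L_eq[OF w(1), of 0] by (simp add: fun_eq_iff)
  ultimately have "partial_L w 0 \<longlonglongrightarrow> li_value (word_of w)" by simp
  moreover have "L_series N w = lim (partial_L w 0)"
    unfolding L_series_def partial_L_def increasing_def Let_def
    by (intro arg_cong[where f = lim] ext sum.cong prod.cong refl) auto
  ultimately show ?thesis by (simp add: limI)
qed

end

section \<open>The regularised values\<close>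

context level
begin

lemma lists_letters_shuffle:
  "u \<in> lists A \<Longrightarrow> v \<in> lists A \<Longrightarrow> set_mset (shuffle u v) \<subseteq> lists A"
  using lists_shuffle by blast

lemma X_letters [simp]: "X \<in> letters N"
  by (simp add: letters_def)

lemma Y0_letters [simp]: "Y 0 \<in> letters N"
  using N by (simp add: letters_def residues_mod_def)

text \<open>The leading letters x are regularised on words not ending with y_0, where the convergent
  values supply the multiplicative base; the result is then the base for the regularisation of the
  trailing letters y_0 on all words.\<close>

lemma Lhat_exists:
  "\<exists>L. (\<forall>w\<in>H1_words N. word_of w \<in> H0_words N \<longrightarrow> L (word_of w) = L_series N w) \<and>
     (\<forall>u\<in>lists (letters N). \<forall>v\<in>lists (letters N). L u * L v = (\<Sum>w\<in>#shuffle u v. L w)) \<and>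
     L [X] = 0 \<and> L [Y 0] = 0"
proof -
  define W where "W = {w \<in> lists (letters N). w = [] \<or> last w \<noteq> Y 0}"
  define L1 where "L1 = regularise X li_value"
  \<comment> \<open>Words are reversed so that trailing letters y_0 become leading ones;
    \<open>shuffle_rev\<close> makes this harmless.\<close>
  define L2 where "L2 = regularise (Y 0) (\<lambda>w. L1 (rev w))"
  have L1_mult: "L1 u * L1 v = (\<Sum>w\<in>#shuffle u v. L1 w)" if "u \<in> W" "v \<in> W" for u v
    unfolding L1_def
  proof (rule regularise_mult[where W = W])
    show "set_mset (shuffle u v) \<subseteq> W" if uv: "u \<in> W" "v \<in> W" for u v
    proof
      fix w assume w: "w \<in> set_mset (shuffle u v)"
      then have "w \<in> lists (letters N)" using uv lists_shuffle[of w u v] unfolding W_def by blast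
      moreover have "w = [] \<or> last w \<noteq> Y 0" using last_shuffle[OF w] uv unfolding W_def by auto
      ultimately show "w \<in> W" by (simp add: W_def)
    qed
    show "A \<in> W" if "X # A \<in> W" for A using that by (auto simp: W_def split: if_splits)
    show "[X] \<in> W" by (simp add: W_def)
    show "li_value u * li_value v = (\<Sum>w\<in>#shuffle u v. li_value w)"
      if "u \<in> W" "v \<in> W" "u = [] \<or> hd u \<noteq> X" "v = [] \<or> hd v \<noteq> X" for u v
      by (rule li_value_mult) (use that in \<open>auto simp: W_def convergent_word_def\<close>)
  qed (use that in auto)
  have L2_mult: "L2 u * L2 v = (\<Sum>w\<in>#shuffle u v. L2 w)"
    if "u \<in> lists (letters N)" "v \<in> lists (letters N)" for u v
    unfolding L2_def
  proof (rule regularise_mult[where W = "lists (letters N)"])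
    show "L1 (rev u) * L1 (rev v) = (\<Sum>w\<in>#shuffle u v. L1 (rev w))"
      if "u \<in> lists (letters N)" "v \<in> lists (letters N)" "u = [] \<or> hd u \<noteq> Y 0" "v = [] \<or> hd v \<noteq> Y 0" for u v
    proof -
      have "rev u \<in> W" "rev v \<in> W"
        using that lists_rev[of u] lists_rev[of v] unfolding W_def by (auto simp: last_rev)
      from L1_mult[OF this] show ?thesis
        unfolding shuffle_rev by (simp add: multiset.map_comp comp_def)
    qed
    show "set_mset (shuffle u v) \<subseteq> lists (letters N)"
      if "u \<in> lists (letters N)" "v \<in> lists (letters N)" for u v
      using that by (rule lists_letters_shuffle)
  qed (use that in auto)
  define L where "L w = L2 (rev w)" for w
  have mult: "L u * L v = (\<Sum>w\<in>#shuffle u v. L w)" if "u \<in> lists (letters N)" "v \<in> lists (letters N)" for u v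
    using L2_mult[of "rev u" "rev v"] that lists_rev[of u] lists_rev[of v]
    unfolding L_def shuffle_rev by (simp add: multiset.map_comp comp_def)
  have "L w = li_value w" if "convergent_word w" for w
  proof -
    have "L w = L1 (rev (rev w))" unfolding L_def L2_def
      by (rule regularise_base) (use that in \<open>auto simp: convergent_word_def hd_rev\<close>)
    also have "\<dots> = li_value w" unfolding L1_def rev_rev_ident
      by (rule regularise_base) (use that in \<open>auto simp: convergent_word_def\<close>)
    finally show ?thesis .
  qed
  then have "\<forall>w\<in>H1_words N. word_of w \<in> H0_words N \<longrightarrow> L (word_of w) = L_series N w"
    using L_series_eq H0_words_convergent by simp
  moreover have "L [X] = 0"
  proof -
    have "L [X] = L1 (rev [X])" unfolding L_def L2_def by (subst regularise_base) auto
    then show ?thesis using regularise_power[of X li_value 0] by (simp add: L1_def)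
  qed
  moreover have "L [Y 0] = 0"
    using regularise_power[of "Y 0" "\<lambda>w. L1 (rev w)" 0] by (simp add: L_def L2_def)
  ultimately show ?thesis using mult by (intro exI[of _ L]) blast
qed

lemma
  shows Lhat_series: "w \<in> H1_words N \<Longrightarrow> word_of w \<in> H0_words N \<Longrightarrow> Lhat N (word_of w) = L_series N w"
    and Lhat_mult: "u \<in> lists (letters N) \<Longrightarrow> v \<in> lists (letters N) \<Longrightarrow>
      Lhat N u * Lhat N v = (\<Sum>w\<in>#shuffle u v. Lhat N w)"
    and Lhat_X: "Lhat N [X] = 0" and Lhat_Y: "Lhat N [Y 0] = 0"
  using someI_ex[OF Lhat_exists, folded Lhat_def] by blast+

lemma word_of_surj:
  "u \<in> lists {X, Y 0} \<Longrightarrow> u = [] \<or> hd u \<noteq> X \<Longrightarrow> \<exists>ns. (\<forall>n\<in>set ns. n \<ge> 1) \<and> word_of (map (\<lambda>n. (n, 0)) ns) = u"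
proof (induction "length u" arbitrary: u rule: less_induct)
  case less
  show ?case
  proof (cases u)
    case (Cons x u')
    then have x: "x = Y 0" using less.prems by auto
    obtain k v where u': "u' = replicate k X @ v" "v = [] \<or> hd v \<noteq> X"
      by (rule split_leading[of u' X]) (metis append_Nil2, metis list.sel(1))
    then obtain ns where "\<forall>n\<in>set ns. n \<ge> 1" "word_of (map (\<lambda>n. (n, 0)) ns) = v"
      using less.hyps[of v] less.prems Cons by auto
    then show ?thesis using x u' Cons by (intro exI[of _ "Suc k # ns"]) auto
  qed (auto intro!: exI[of _ "[]"])
qed

text \<open>Both functions solve the same two triangular systems on words in x and y_0, and they
  agree on the convergent words, where the series with zero lower indices contains no root of
  unity.\<close>

lemma Lhat_level1:
  assumes u: "u \<in> lists {X, Y 0}"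
  shows "Lhat N u = Lhat 1 u"
proof -
  interpret L1: level 1 by standard simp
  let ?A = "{X, Y 0}"
  have sub: "v \<in> lists (letters N)" "v \<in> lists (letters 1)" if "v \<in> lists ?A" for v
    using that X_letters Y0_letters L1.X_letters L1.Y0_letters by (auto simp: in_lists_conv_set)
  define W where "W = {w \<in> lists ?A. w = [] \<or> last w \<noteq> Y 0}"
  have step1: "Lhat N v = Lhat 1 v" if "v \<in> W" for v
  proof (rule regularisation_unique[where W = W and x = X])
    show "set_mset (shuffle u v) \<subseteq> W" if uv: "u \<in> W" "v \<in> W" for u v
    proof
      fix w assume w: "w \<in> set_mset (shuffle u v)"
      then have "w \<in> lists ?A" using uv lists_shuffle[of w u v] unfolding W_def by blast
      moreover have "w = [] \<or> last w \<noteq> Y 0" using last_shuffle[OF w] uv unfolding W_def by auto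
      ultimately show "w \<in> W" by (simp add: W_def)
    qed
    show "B \<in> W" if "X # B \<in> W" for B using that by (auto simp: W_def split: if_splits)
    show "[X] \<in> W" by (simp add: W_def)
    show "(\<Sum>w\<in>#shuffle [X] B. Lhat N w) = 0" if "B \<in> W" for B
      using Lhat_mult[of "[X]" B] Lhat_X sub[of B] that by (simp add: W_def)
    show "(\<Sum>w\<in>#shuffle [X] B. Lhat 1 w) = 0" if "B \<in> W" for B
      using L1.Lhat_mult[of "[X]" B] L1.Lhat_X L1.X_letters sub[of B] that by (simp add: W_def)
    show "Lhat N u = Lhat 1 u" if u: "u \<in> W" "u = [] \<or> hd u \<noteq> X" for u
    proof -
      have uA: "u \<in> lists ?A" using u(1) by (simp only: W_def mem_Collect_eq)
      obtain ns where ns: "\<forall>n\<in>set ns. n \<ge> 1" "word_of (map (\<lambda>n. (n, 0)) ns) = u"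
        using word_of_surj[OF uA u(2)] by (elim exE conjE)
      let ?w = "map (\<lambda>n. (n, 0 :: int)) ns"
      have H1: "?w \<in> H1_words M" if "M \<ge> 1" for M
        using ns(1) that by (auto simp: H1_words_def residues_mod_def)
      have H0: "u \<in> H0_words M" if M: "M \<ge> 1" for M
      proof (cases "u = []")
        case False
        then have hd: "hd u = Y 0" using u by (cases u) (auto simp: W_def)
        have "last u \<noteq> Y 0" "last u \<in> ?A" using False u by (auto simp: W_def in_lists_conv_set)
        then have last: "last u = X" by auto
        obtain v where u': "u = Y 0 # v" using False hd by (cases u) auto
        then have "v \<noteq> []" using last by auto
        then obtain v' where v': "v = v' @ [X]" using last u' by (cases v rule: rev_cases) auto
        have "set v' \<subseteq> ?A" using u u' v' by (auto simp: W_def in_lists_conv_set)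
        then have "v' \<in> lists (letters M)" using M by (auto simp: letters_def residues_mod_def)
        moreover have "0 \<in> residues_mod M" using M by (simp add: residues_mod_def)
        ultimately show ?thesis unfolding H0_words_def u' v' by auto
      qed (simp add: H0_words_def)
      have "Lhat N u = L_series N ?w" using Lhat_series[OF H1[OF N]] H0[OF N] ns(2) by simp
      moreover have "Lhat 1 u = L_series 1 ?w" using L1.Lhat_series[OF H1] H0 ns(2) by simp
      moreover have "L_series N ?w = L_series 1 ?w"
        unfolding L_series_def Let_def by (intro arg_cong[where f = lim] ext sum.cong prod.cong refl) simp
      ultimately show ?thesis by simp
    qed
  qed (use that in auto)
  have "Lhat N (rev (rev u)) = Lhat 1 (rev (rev u))"
  proof (rule regularisation_unique[where W = "lists ?A" and x = "Y 0" and u = "rev u"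
        and L = "\<lambda>v. Lhat N (rev v)" and L' = "\<lambda>v. Lhat 1 (rev v)"])
    show "(\<Sum>w\<in>#shuffle [Y 0] B. Lhat N (rev w)) = 0" if "B \<in> lists ?A" for B
    proof -
      have "(\<Sum>w\<in>#shuffle [Y 0] B. Lhat N (rev w)) = (\<Sum>w\<in>#shuffle (rev [Y 0]) (rev B). Lhat N w)"
        unfolding shuffle_rev by (simp add: multiset.map_comp comp_def)
      then show ?thesis using Lhat_mult[of "rev [Y 0]" "rev B"] Lhat_Y lists_rev[OF sub(1)[OF that]] by simp
    qed
    show "(\<Sum>w\<in>#shuffle [Y 0] B. Lhat 1 (rev w)) = 0" if "B \<in> lists ?A" for B
    proof -
      have "(\<Sum>w\<in>#shuffle [Y 0] B. Lhat 1 (rev w)) = (\<Sum>w\<in>#shuffle (rev [Y 0]) (rev B). Lhat 1 w)"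
        unfolding shuffle_rev by (simp add: multiset.map_comp comp_def)
      then show ?thesis
        using L1.Lhat_mult[of "rev [Y 0]" "rev B"] L1.Lhat_Y L1.Y0_letters lists_rev[OF sub(2)[OF that]] by simp
    qed
    show "Lhat N (rev v) = Lhat 1 (rev v)" if "v \<in> lists ?A" "v = [] \<or> hd v \<noteq> Y 0" for v
      by (rule step1) (use that lists_rev[OF that(1)] in \<open>auto simp: W_def last_rev\<close>)
    show "set_mset (shuffle u v) \<subseteq> lists ?A" if "u \<in> lists ?A" "v \<in> lists ?A" for u v
      using that by (rule lists_letters_shuffle)
  qed (use lists_rev[OF u] in auto)
  then show ?thesis by simp
qed

lemma sum_pi_map:
  "(\<Sum>as\<in>index_lists N (length ns). pi_map N (zip ns as)) = single (map (\<lambda>n. (n, 0)) ns) 1"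
proof (induction ns)
  case Nil
  have "single [] 1 = (1 :: index_word \<Rightarrow>\<^sub>0 complex)" by (simp only: zero_list_def[symmetric] single_one)
  then show ?case by (simp add: pi_map_def)
next
  case (Cons n ns)
  let ?z = "\<lambda>a. \<Sum>b\<in>residues_mod N. single [(n, b)] (\<eta> N powi (- (a * b)) / of_nat N)"
  have "(\<Sum>as\<in>index_lists N (length (n # ns)). pi_map N (zip (n # ns) as)) =
      (\<Sum>a\<in>residues_mod N. \<Sum>as\<in>index_lists N (length ns). ?z a * pi_map N (zip ns as))"
    by (simp add: sum_index_lists_Suc pi_map_def)
  also have "\<dots> = (\<Sum>a\<in>residues_mod N. ?z a) * single (map (\<lambda>n. (n, 0)) ns) 1"
    by (simp only: sum_distrib_left[symmetric] sum_distrib_right[symmetric] Cons.IH)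
  also have "(\<Sum>a\<in>residues_mod N. ?z a) = single [(n, 0)] 1"
  proof -
    have "(\<Sum>a\<in>residues_mod N. ?z a) =
        (\<Sum>b\<in>residues_mod N. single [(n, b)] ((\<Sum>a\<in>residues_mod N. \<eta> N powi (a * - b)) / of_nat N))"
      by (subst sum.swap) (simp add: single_sum sum_divide_distrib)
    also have "\<dots> = (\<Sum>b\<in>residues_mod N. if b = 0 then single [(n, 0)] 1 else 0)"
    proof (intro sum.cong refl)
      fix b assume b: "b \<in> residues_mod N"
      then have "int N dvd - b \<longleftrightarrow> b = 0" using eta_powi_inj[of b 0] N by (auto simp: residues_mod_def)
      then show "single [(n, b)] ((\<Sum>a\<in>residues_mod N. \<eta> N powi (a * - b)) / of_nat N) =
          (if b = 0 then single [(n, 0)] 1 else 0)"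
        unfolding sum_eta using N by simp
    qed
    also have "\<dots> = single [(n, 0)] 1" using N by (simp add: sum.delta residues_mod_def)
    finally show ?thesis .
  qed
  also have "single [(n, 0)] 1 * single (map (\<lambda>n. (n, 0)) ns) 1 = (single (map (\<lambda>n. (n, 0)) (n # ns)) 1 :: index_word \<Rightarrow>\<^sub>0 complex)"
    by (simp add: mult_single plus_list_def)
  finally show ?case .
qed

lemma sum_zeta_Lhat:
  "(\<Sum>as\<in>index_lists N (length ns). zeta_sh N (zip ns as)) = Lhat N (word_of (map (\<lambda>n. (n, 0)) ns))"
proof -
  let ?f = "\<lambda>v. Lhat N (word_of v)"
  have "(\<Sum>as\<in>index_lists N (length ns). zeta_sh N (zip ns as)) =
      (\<Sum>as\<in>index_lists N (length ns). linear_ext ?f (pi_map N (zip ns (map (\<lambda>a. a mod int N) (diffs_from 0 as)))))"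
    unfolding zeta_sh_def rho_def by (intro sum.cong refl) (simp add: index_lists_def diffs_eq)
  also have "\<dots> = (\<Sum>as\<in>index_lists N (length ns). linear_ext ?f (pi_map N (zip ns as)))"
    by (rule sum_diffs_from)
  also have "\<dots> = linear_ext ?f (single (map (\<lambda>n. (n, 0)) ns) 1)"
    unfolding sum_pi_map[symmetric] linear_ext_sum ..
  finally show ?thesis by simp
qed

end

lemma index_lists_1: "index_lists 1 r = {replicate r 0}"
proof -
  have "as = replicate r 0" if "as \<in> index_lists 1 r" for as
    by (rule replicate_eqI) (use that in \<open>fastforce simp: index_lists_def residues_mod_def\<close>)+
  moreover have "replicate r 0 \<in> index_lists 1 r" by (auto simp: index_lists_def residues_mod_def)
  ultimately show ?thesis by blast
qed

lemma zip_replicate_0: "zip ns (replicate (length ns) 0) = map (\<lambda>n. (n, 0)) ns"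
  by (induction ns) auto

lemma (in level) sum_zeta:
  "(\<Sum>as\<in>index_lists N (length ns). zeta_sh N (zip ns as)) = zeta_sh 1 (map (\<lambda>n. (n, 0)) ns)"
proof -
  interpret L1: level 1 by standard simp
  have "word_of (map (\<lambda>n. (n, 0)) ns) \<in> lists {X, Y 0}" by (induction ns) auto
  then have "Lhat N (word_of (map (\<lambda>n. (n, 0)) ns)) = Lhat 1 (word_of (map (\<lambda>n. (n, 0)) ns))"
    by (rule Lhat_level1)
  then show ?thesis
    using L1.sum_zeta_Lhat[of ns] sum_zeta_Lhat[of ns] by (simp add: index_lists_1[simplified] zip_replicate_0)
qed

section \<open>Generating series: expansion, uniqueness of coefficients and the q-series\<close>

section \<open>Power series in several variables\<close>

abbreviation abs_summable :: "('a \<Rightarrow> 'b::real_normed_vector) \<Rightarrow> 'a set \<Rightarrow> bool" where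
  "abs_summable f A \<equiv> (\<lambda>x. norm (f x)) summable_on A"

definition pos_lists :: "nat \<Rightarrow> nat list set" where
  "pos_lists r = {ks. length ks = r \<and> (\<forall>k\<in>set ks. 1 \<le> k)}"

lemma pos_lists_0 [simp]: "pos_lists 0 = {[]}"
  by (auto simp: pos_lists_def)

lemma pos_lists_Suc: "pos_lists (Suc r) = (\<lambda>(k, ks). k # ks) ` ({1..} \<times> pos_lists r)"
  by (force simp: pos_lists_def length_Suc_conv image_iff)

lemma has_sum_pos_lists_Suc:
  "(f has_sum s) (pos_lists (Suc r)) \<longleftrightarrow> ((\<lambda>(k, ks). f (k # ks)) has_sum s) ({1..} \<times> pos_lists r)"
proof -
  have "inj_on (\<lambda>(k, ks). k # ks) ({1..} \<times> pos_lists r)" by (auto simp: inj_on_def)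
  then show ?thesis
    unfolding pos_lists_Suc by (subst has_sum_reindex) (simp_all add: comp_def case_prod_unfold)
qed

lemma has_sum_Times:
  fixes f :: "'a \<Rightarrow> 'c::{real_normed_field,banach}" and g :: "'b \<Rightarrow> 'c"
  assumes f: "abs_summable f A" "(f has_sum F) A" and g: "abs_summable g B" "(g has_sum G) B"
  shows "abs_summable (\<lambda>(x, y). f x * g y) (A \<times> B) \<and> ((\<lambda>(x, y). f x * g y) has_sum F * G) (A \<times> B)"
proof -
  have inf: "infsum (\<lambda>y. norm (f x * g y)) B = norm (f x) * infsum (\<lambda>y. norm (g y)) B" for x
    by (simp add: norm_mult infsum_cmult_right')
  have sA: "abs_summable (\<lambda>x. norm (f x) * infsum (\<lambda>y. norm (g y)) B) A"
    using f(1) by (simp add: abs_mult summable_on_cmult_left)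
  have sB: "abs_summable (\<lambda>y. f x * g y) B" for x
    using g(1) by (simp add: norm_mult summable_on_cmult_right)
  have abs: "abs_summable (\<lambda>(x, y). f x * g y) (A \<times> B)"
    by (subst Infinite_Sum.abs_summable_on_Sigma_iff) (simp only: prod.case inf sA sB, simp)
  then have "(\<lambda>(x, y). f x * g y) summable_on A \<times> B" by (rule abs_summable_summable)
  then obtain S where S: "((\<lambda>(x, y). f x * g y) has_sum S) (A \<times> B)" by (auto simp: summable_on_def)
  have "((\<lambda>x. f x * G) has_sum S) A"
    by (rule has_sum_SigmaD[OF S]) (simp add: has_sum_cmult_right[OF g(2)])
  moreover have "((\<lambda>x. f x * G) has_sum (F * G)) A" by (rule has_sum_cmult_left[OF f(2)])
  ultimately have "S = F * G" by (rule has_sum_unique)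
  with abs S show ?thesis by simp
qed

lemma has_sum_prod_pos_lists:
  fixes f :: "nat \<Rightarrow> nat \<Rightarrow> 'c::{real_normed_field,banach}"
  assumes "\<And>j. j < r \<Longrightarrow> abs_summable (f j) {1..}" "\<And>j. j < r \<Longrightarrow> (f j has_sum s j) {1..}"
  shows "abs_summable (\<lambda>ks. \<Prod>j<r. f j (ks ! j)) (pos_lists r) \<and>
    ((\<lambda>ks. \<Prod>j<r. f j (ks ! j)) has_sum (\<Prod>j<r. s j)) (pos_lists r)"
  using assms
proof (induction r arbitrary: f s)
  case 0
  have "((\<lambda>ks. \<Prod>j<0. f j (ks ! j)) has_sum (\<Prod>j<0. s j)) {[]}"
    by (rule has_sum_finiteI) auto
  then show ?case by simp
next
  case (Suc r)
  have IH: "abs_summable (\<lambda>ks. \<Prod>j<r. f (Suc j) (ks ! j)) (pos_lists r)"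
    "((\<lambda>ks. \<Prod>j<r. f (Suc j) (ks ! j)) has_sum (\<Prod>j<r. s (Suc j))) (pos_lists r)"
    using Suc.IH[of "\<lambda>j. f (Suc j)" "\<lambda>j. s (Suc j)"] Suc.prems by auto
  have eq: "(\<Prod>j<Suc r. f j ((k # ks) ! j)) = f 0 k * (\<Prod>j<r. f (Suc j) (ks ! j))" for k ks
    by (simp add: prod.lessThan_Suc_shift del: prod.lessThan_Suc)
  have T: "abs_summable (\<lambda>(k, ks). f 0 k * (\<Prod>j<r. f (Suc j) (ks ! j))) ({1..} \<times> pos_lists r)"
    "((\<lambda>(k, ks). f 0 k * (\<Prod>j<r. f (Suc j) (ks ! j))) has_sum s 0 * (\<Prod>j<r. s (Suc j))) ({1..} \<times> pos_lists r)"
    using has_sum_Times[OF Suc.prems(1)[of 0] Suc.prems(2)[of 0] IH] by auto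
  have inj: "inj_on (\<lambda>(k, ks). k # ks) ({1..} \<times> pos_lists r)" by (auto simp: inj_on_def)
  have "abs_summable (\<lambda>ks. \<Prod>j<Suc r. f j (ks ! j)) (pos_lists (Suc r))"
    unfolding pos_lists_Suc
    by (subst summable_on_reindex[OF inj]) (use T(1) in \<open>simp only: comp_def case_prod_unfold eq\<close>)
  moreover have "((\<lambda>ks. \<Prod>j<Suc r. f j (ks ! j)) has_sum (\<Prod>j<Suc r. s j)) (pos_lists (Suc r))"
    unfolding has_sum_pos_lists_Suc eq using T(2)
    by (simp only: prod.lessThan_Suc_shift comp_def)
  ultimately show ?case by blast
qed

lemma has_sum_from_1: "(f has_sum s) {1..} \<longleftrightarrow> ((\<lambda>n. f (Suc n)) has_sum s) UNIV"
proof -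
  have "{1..} = range Suc" by (metis One_nat_def atLeast_Suc_greaterThan greaterThan_0)
  then show ?thesis by (simp add: has_sum_reindex comp_def)
qed

lemma has_sum_exp_from_1:
  fixes z :: "'c::{real_normed_field,banach}"
  shows "abs_summable (\<lambda>k. z ^ (k - 1) / fact (k - 1)) {1..}"
    "((\<lambda>k. z ^ (k - 1) / fact (k - 1)) has_sum exp z) {1..}"
proof -
  have sums: "(\<lambda>n. z ^ n / fact n) sums exp z"
    using exp_converges[of z] by (simp add: scaleR_conv_of_real field_simps)
  have "summable (\<lambda>n. norm (z ^ n / fact n))"
    using summable_norm_exp[of z] by (simp add: scaleR_conv_of_real field_simps norm_divide norm_mult)
  then have hs: "((\<lambda>n. z ^ n / fact n) has_sum exp z) UNIV" and abs: "abs_summable (\<lambda>n. z ^ n / fact n) UNIV"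
    using norm_summable_imp_has_sum[OF _ sums] norm_summable_imp_summable_on[of "\<lambda>n. norm (z ^ n / fact n)"]
    by auto
  from hs show "((\<lambda>k. z ^ (k - 1) / fact (k - 1)) has_sum exp z) {1..}"
    unfolding has_sum_from_1 by simp
  from abs obtain t where "((\<lambda>n. norm (z ^ n / fact n)) has_sum t) UNIV" by (auto simp: summable_on_def)
  then have "((\<lambda>k. norm (z ^ (k - 1) / fact (k - 1))) has_sum t) {1..}"
    unfolding has_sum_from_1 by simp
  then show "abs_summable (\<lambda>k. z ^ (k - 1) / fact (k - 1)) {1..}" by (auto simp: summable_on_def)
qed

text \<open>Fubini for the double family indexed by d and by the exponents of the x_j; the premise
  majorises it on the polydisc of radius R. Upper indices start at 1, hence the exponents
  \<open>ks ! j - 1\<close>.\<close>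

lemma exp_family_expansion:
  fixes c :: "'d \<Rightarrow> complex" and m :: "'d \<Rightarrow> nat \<Rightarrow> int"
  assumes R: "R > 0" and summ: "(\<lambda>d. norm (c d) * exp (R * (\<Sum>j<r. \<bar>real_of_int (m d j)\<bar>))) summable_on A"
  shows "\<And>x. (\<And>j. j < r \<Longrightarrow> norm (x j) \<le> R) \<Longrightarrow>
      ((\<lambda>ks. infsum (\<lambda>d. c d * (\<Prod>j<r. of_int (m d j) ^ (ks ! j - 1) / fact (ks ! j - 1))) A
        * (\<Prod>j<r. x j ^ (ks ! j - 1))) has_sum
        infsum (\<lambda>d. c d * exp (\<Sum>j<r. of_int (m d j) * x j)) A) (pos_lists r)"
    and "\<And>ks. ks \<in> pos_lists r \<Longrightarrow>
      (\<lambda>d. c d * (\<Prod>j<r. of_int (m d j) ^ (ks ! j - 1) / fact (ks ! j - 1))) summable_on A"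
proof -
  define T where "T d ks = c d * (\<Prod>j<r. of_int (m d j) ^ (ks ! j - 1) / fact (ks ! j - 1))" for d and ks :: "nat list"
  have main: "(\<forall>ks\<in>pos_lists r. (\<lambda>d. T d ks * (\<Prod>j<r. x j ^ (ks ! j - 1))) summable_on A) \<and>
      ((\<lambda>ks. infsum (\<lambda>d. T d ks) A * (\<Prod>j<r. x j ^ (ks ! j - 1))) has_sum
        infsum (\<lambda>d. c d * exp (\<Sum>j<r. of_int (m d j) * x j)) A) (pos_lists r)"
    if x: "\<And>j. j < r \<Longrightarrow> norm (x j) \<le> R" for x :: "nat \<Rightarrow> complex"
  proof -
    define F where "F d ks = c d * (\<Prod>j<r. (of_int (m d j) * x j) ^ (ks ! j - 1) / fact (ks ! j - 1))" for d and ks :: "nat list"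
    have FT: "F d ks = T d ks * (\<Prod>j<r. x j ^ (ks ! j - 1))" for d ks
      unfolding F_def T_def mult.assoc prod.distrib[symmetric]
      by (intro arg_cong[where f = "\<lambda>y. c d * y"] prod.cong refl) (simp add: power_mult_distrib)
    have Fd: "(F d has_sum c d * exp (\<Sum>j<r. of_int (m d j) * x j)) (pos_lists r)" for d
      unfolding F_def exp_sum[OF finite_lessThan]
      by (intro has_sum_cmult_right has_sum_prod_pos_lists[THEN conjunct2] has_sum_exp_from_1)
    have normF: "((\<lambda>ks. norm (F d ks)) has_sum norm (c d) * exp (\<Sum>j<r. norm (of_int (m d j) * x j))) (pos_lists r)" for d
    proof -
      have "((\<lambda>ks. norm (c d) * (\<Prod>j<r. norm (of_int (m d j) * x j) ^ (ks ! j - 1) / fact (ks ! j - 1)))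
          has_sum norm (c d) * exp (\<Sum>j<r. norm (of_int (m d j) * x j))) (pos_lists r)"
        unfolding exp_sum[OF finite_lessThan]
        by (intro has_sum_cmult_right has_sum_prod_pos_lists[THEN conjunct2] has_sum_exp_from_1)
      then show ?thesis by (simp add: F_def norm_mult norm_divide norm_power flip: prod_norm)
    qed
    have "abs_summable (\<lambda>(d, ks). F d ks) (A \<times> pos_lists r)"
    proof (subst Infinite_Sum.abs_summable_on_Sigma_iff, intro conjI ballI)
      fix d
      show "abs_summable (\<lambda>ks. (case (d, ks) of (d, ks) \<Rightarrow> F d ks)) (pos_lists r)"
        using normF[of d] by (auto simp: summable_on_def)
    next
      have inf: "infsum (\<lambda>ks. norm (case (d, ks) of (d, ks) \<Rightarrow> F d ks)) (pos_lists r) =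
          norm (c d) * exp (\<Sum>j<r. norm (of_int (m d j) * x j))" for d
        using infsumI[OF normF[of d]] by simp
      have "norm (norm (c d) * exp (\<Sum>j<r. norm (of_int (m d j) * x j))) \<le>
          norm (c d) * exp (R * (\<Sum>j<r. \<bar>real_of_int (m d j)\<bar>))" for d
      proof -
        have "(\<Sum>j<r. norm (of_int (m d j) * x j)) \<le> (\<Sum>j<r. \<bar>real_of_int (m d j)\<bar> * R)"
          using x by (intro sum_mono) (simp add: norm_mult mult_left_mono)
        also have "\<dots> = R * (\<Sum>j<r. \<bar>real_of_int (m d j)\<bar>)" by (simp add: sum_distrib_left mult.commute)
        finally show ?thesis by (simp add: abs_mult mult_left_mono)
      qed
      then show "abs_summable (\<lambda>d. infsum (\<lambda>ks. norm (case (d, ks) of (d, ks) \<Rightarrow> F d ks)) (pos_lists r)) A"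
        unfolding inf by (rule Infinite_Sum.abs_summable_on_comparison_test'[OF summ])
    qed
    then have "(\<lambda>(d, ks). F d ks) summable_on A \<times> pos_lists r" by (rule abs_summable_summable)
    then obtain S where S: "((\<lambda>(d, ks). F d ks) has_sum S) (A \<times> pos_lists r)" by (auto simp: summable_on_def)
    have "((\<lambda>d. c d * exp (\<Sum>j<r. of_int (m d j) * x j)) has_sum S) A"
      by (rule has_sum_SigmaD[OF S]) (use Fd in simp)
    then have S_eq: "S = infsum (\<lambda>d. c d * exp (\<Sum>j<r. of_int (m d j) * x j)) A" by (simp add: infsumI)
    have S': "((\<lambda>(ks, d). F d ks) has_sum S) (pos_lists r \<times> A)"
      using has_sum_swap[THEN iffD1, OF S] by simp
    then have summ_ks: "(\<lambda>d. F d ks) summable_on A" if "ks \<in> pos_lists r" for ks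
      using that by (intro summable_on_SigmaD1[where f = "\<lambda>ks d. F d ks" and A = "pos_lists r"]) (auto simp: summable_on_def)
    have "((\<lambda>ks. infsum (\<lambda>d. F d ks) A) has_sum S) (pos_lists r)"
      by (rule has_sum_SigmaD[OF S']) (use summ_ks in simp)
    then show ?thesis
      using summ_ks unfolding FT S_eq by (simp add: infsum_cmult_left')
  qed
  show "((\<lambda>ks. infsum (\<lambda>d. c d * (\<Prod>j<r. of_int (m d j) ^ (ks ! j - 1) / fact (ks ! j - 1))) A
        * (\<Prod>j<r. x j ^ (ks ! j - 1))) has_sum
        infsum (\<lambda>d. c d * exp (\<Sum>j<r. of_int (m d j) * x j)) A) (pos_lists r)"
    if "\<And>j. j < r \<Longrightarrow> norm (x j) \<le> R" for x
    using main[of x] that unfolding T_def by blast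
  show "(\<lambda>d. c d * (\<Prod>j<r. of_int (m d j) ^ (ks ! j - 1) / fact (ks ! j - 1))) summable_on A"
    if ks: "ks \<in> pos_lists r" for ks
  proof -
    \<comment> \<open>At the point with all coordinates R, which is not 0, the monomial can be
      divided out.\<close>
    have "(\<lambda>d. T d ks * (\<Prod>j<r. of_real R ^ (ks ! j - 1))) summable_on A"
      using main[of "\<lambda>_. of_real R"] ks R by simp
    moreover have "(\<Prod>j<r. complex_of_real R ^ (ks ! j - 1)) \<noteq> 0" using R by simp
    ultimately show ?thesis unfolding T_def by (simp add: summable_on_cmult_left' del: prod_eq_1_iff)
  qed
qed

lemma power_series_zero:
  fixes a :: "nat \<Rightarrow> complex"
  assumes s: "s > 0" and "\<And>x. x \<noteq> 0 \<Longrightarrow> norm x < s \<Longrightarrow> (\<lambda>n. a n * x ^ n) sums 0"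
  shows "a n = 0"
  using assms(2)
proof (induction n arbitrary: a)
  case 0
  have "((\<lambda>_ :: complex. 0 :: complex) \<longlongrightarrow> a 0) (at 0)" by (rule powser_limit_0_strong[where a = a, OF s]) (rule 0)
  then show ?case by (simp add: tendsto_const_iff)
next
  case (Suc n)
  have "((\<lambda>_ :: complex. 0 :: complex) \<longlongrightarrow> a 0) (at 0)" by (rule powser_limit_0_strong[where a = a, OF s]) (rule Suc.prems)
  then have a0: "a 0 = 0" by (simp add: tendsto_const_iff)
  show ?case
  proof (rule Suc.IH)
    fix x :: complex assume x: "x \<noteq> 0" "norm x < s"
    have "(\<lambda>n. a (Suc n) * x ^ Suc n) sums 0"
      using Suc.prems[OF x] a0 by (subst sums_Suc_iff) simp
    from sums_mult[OF this, of "1 / x"] show "(\<lambda>n. a (Suc n) * x ^ n) sums 0" using x by simp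
  qed
qed

text \<open>Induction on the number of variables: with the other variables fixed, the identity
  theorem in the first one kills each inner series, to which the hypothesis applies.\<close>

lemma multi_power_series_zero:
  fixes c :: "nat list \<Rightarrow> complex"
  assumes e: "e > 0" and "\<And>xs. length xs = r \<Longrightarrow> (\<forall>x\<in>set xs. norm x < e) \<Longrightarrow>
      ((\<lambda>ks. c ks * (\<Prod>j<r. xs ! j ^ (ks ! j - 1))) has_sum 0) (pos_lists r)"
    and "ks \<in> pos_lists r"
  shows "c ks = 0"
  using assms(2,3)
proof (induction r arbitrary: c ks)
  case 0
  from 0(1)[of "[]"] have "((\<lambda>ks. c ks) has_sum 0) {[]}" by simp
  moreover have "((\<lambda>ks. c ks) has_sum c []) {[]}" by (rule has_sum_finiteI) auto
  ultimately have "0 = c []" by (rule has_sum_unique)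
  then show ?case using 0 by simp
next
  case (Suc r)
  obtain k ks' where ks: "ks = k # ks'" "k \<ge> 1" "ks' \<in> pos_lists r" using Suc.prems(2) by (auto simp: pos_lists_Suc)
  have "((\<lambda>ks. c (k # ks) * (\<Prod>j<r. xs ! j ^ (ks ! j - 1))) has_sum 0) (pos_lists r)"
    if xs: "length xs = r" "\<forall>x\<in>set xs. norm x < e" for xs
  proof -
    define T where "T k ks = c (k # ks) * (\<Prod>j<r. xs ! j ^ (ks ! j - 1))" for k ks
    have hs: "((\<lambda>(k, ks). x ^ (k - 1) * T k ks) has_sum 0) ({1..} \<times> pos_lists r)" if "norm x < e" for x
    proof -
      have "((\<lambda>(k, ks). c (k # ks) * (\<Prod>j<Suc r. (x # xs) ! j ^ ((k # ks) ! j - 1))) has_sum 0) ({1..} \<times> pos_lists r)"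
        using Suc.prems(1)[of "x # xs"] xs that unfolding has_sum_pos_lists_Suc by simp
      moreover have "c (k # ks) * (\<Prod>j<Suc r. (x # xs) ! j ^ ((k # ks) ! j - 1)) = x ^ (k - 1) * T k ks" for k ks
        by (simp add: prod.lessThan_Suc_shift T_def mult.left_commute del: prod.lessThan_Suc)
      ultimately show ?thesis by simp
    qed
    have summ: "T k summable_on pos_lists r" if "k \<ge> 1" for k
    proof -
      \<comment> \<open>Any nonzero point of the disc would serve: it is used to divide out the
        power of the first variable and obtain summability of the inner series.\<close>
      have "norm (complex_of_real (e / 2)) < e" using e by simp
      from hs[OF this] have "(\<lambda>(k, ks). complex_of_real (e / 2) ^ (k - 1) * T k ks) summable_on ({1..} \<times> pos_lists r)"
        unfolding summable_on_def by blast
      then have "(\<lambda>ks. complex_of_real (e / 2) ^ (k - 1) * T k ks) summable_on pos_lists r"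
        by (rule summable_on_SigmaD1) (use that in simp)
      then show ?thesis using e by (simp add: summable_on_cmult_right')
    qed
    define a where "a n = infsum (T (Suc n)) (pos_lists r)" for n
    have "a (k - 1) = 0"
    proof (rule power_series_zero[OF e])
      fix x :: complex assume x: "x \<noteq> 0" "norm x < e"
      have "((\<lambda>k. x ^ (k - 1) * infsum (T k) (pos_lists r)) has_sum 0) {1..}"
        by (rule has_sum_SigmaD[OF hs[OF x(2)]]) (use summ in \<open>auto intro!: has_sum_cmult_right has_sum_infsum\<close>)
      then show "(\<lambda>n. a n * x ^ n) sums 0"
        unfolding has_sum_from_1 by (intro has_sum_imp_sums) (simp add: a_def mult.commute)
    qed
    then have "infsum (T k) (pos_lists r) = 0" using ks by (simp add: a_def)
    then show ?thesis using has_sum_infsum[OF summ[OF ks(2)]] by (simp add: T_def[abs_def])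
  qed
  from Suc.IH[of "\<lambda>ks. c (k # ks)", OF this ks(3)] show ?case by (simp add: ks)
qed

section \<open>Block sums and differences\<close>

definition lprod :: "'a::comm_ring_1 list \<Rightarrow> 'a list \<Rightarrow> 'a" where
  "lprod xs ys = sum_list (map2 (*) xs ys)"

lemma lprod_nth: "length xs = length ys \<Longrightarrow> lprod xs ys = (\<Sum>j<length xs. xs ! j * ys ! j)"
  by (simp add: lprod_def sum_list_sum_nth atLeast0LessThan)

lemma lprod_append: "length xs = length us \<Longrightarrow> lprod (xs @ ys) (us @ vs) = lprod xs us + lprod ys vs"
  by (simp add: lprod_def)

lemma lprod_rev: "length xs = length ys \<Longrightarrow> lprod (rev xs) (rev ys) = lprod xs ys"
  unfolding lprod_def by (simp add: zip_rev rev_map[symmetric])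

lemma lprod_replicate: "lprod (replicate (length xs) d) xs = d * sum_list xs"
  by (induction xs) (simp_all add: lprod_def algebra_simps)

definition expand :: "nat list \<Rightarrow> 'a list \<Rightarrow> 'a list" where
  "expand is ds = concat (map2 replicate is ds)"

lemma expand_simps [simp]: "expand [] ds = []" "expand (i # is) (d # ds) = replicate i d @ expand is ds"
  by (simp_all add: expand_def)

lemma length_expand: "length is = length ds \<Longrightarrow> length (expand is ds) = sum_list is"
  by (induction "is" ds rule: list_induct2) auto

lemma map_expand: "length is = length ds \<Longrightarrow> map f (expand is ds) = expand is (map f ds)"
  by (induction "is" ds rule: list_induct2) auto

text \<open>\<open>expand\<close> is the transpose of \<open>block_sums\<close>: pairing d_k with
  the sum of a block is pairing d_k with each entry of that block.\<close>

lemma lprod_block_sums: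
  assumes "length is = length ds" "length xs = sum_list is"
  shows "lprod ds (block_sums is xs) = lprod (expand is ds) xs"
  using assms
proof (induction "is" ds arbitrary: xs rule: list_induct2)
  case (Cons i "is" d ds)
  have l: "length (take i xs) = i" using Cons.prems by simp
  have "lprod (d # ds) (block_sums (i # is) xs) = d * sum_list (take i xs) + lprod ds (block_sums is (drop i xs))"
    by (simp add: lprod_def)
  also have "\<dots> = lprod (replicate i d) (take i xs) + lprod (expand is ds) (drop i xs)"
    using Cons.IH[of "drop i xs"] Cons.prems lprod_replicate[of "take i xs" d] l by simp
  also have "\<dots> = lprod (replicate i d @ expand is ds) (take i xs @ drop i xs)"
    using l by (intro lprod_append[symmetric]) simp
  finally show ?case by simp
qed (simp add: lprod_def)

text \<open>The transpose of \<open>diffs\<close> for the pairing \<open>lprod\<close>, as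
  \<open>lprod_diffs_from\<close> shows for c = 0.\<close>

fun tail_diffs :: "'a::ab_group_add list \<Rightarrow> 'a list" where
  "tail_diffs [] = []"
| "tail_diffs [e] = [e]"
| "tail_diffs (e # e' # es) = (e - e') # tail_diffs (e' # es)"

lemma length_tail_diffs [simp]: "length (tail_diffs es) = length es"
  by (induction es rule: tail_diffs.induct) auto

lemma lprod_diffs_from:
  assumes "length es = length xs"
  shows "lprod es (diffs_from c xs) = lprod (tail_diffs es) xs - c * (if es = [] then 0 else hd es)"
  using assms
proof (induction es arbitrary: c xs rule: tail_diffs.induct)
  case (2 e)
  then show ?case by (cases xs) (auto simp: lprod_def algebra_simps)
next
  case (3 e e' es)
  then obtain x xs' where xs: "xs = x # xs'" by (cases xs) auto
  have "lprod (e # e' # es) (diffs_from c xs) = e * (x - c) + lprod (e' # es) (diffs_from x xs')"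
    by (simp add: lprod_def xs)
  also have "\<dots> = e * (x - c) + (lprod (tail_diffs (e' # es)) xs' - x * e')"
    using 3 xs by simp
  also have "\<dots> = lprod (tail_diffs (e # e' # es)) xs - c * e"
    by (simp add: lprod_def xs algebra_simps)
  finally show ?case by simp
qed (simp add: lprod_def)

lemma tail_diffs_of_int: "tail_diffs (map of_int es) = (map of_int (tail_diffs es) :: 'a::ring_1 list)"
  by (induction es rule: tail_diffs.induct) auto

lemma tail_diffs_scale: "tail_diffs (map (\<lambda>e. n * e) es) = map (\<lambda>e. n * e) (tail_diffs (es :: int list))"
  by (induction es rule: tail_diffs.induct) (auto simp: algebra_simps)

text \<open>The last entry is kept and the others are recovered from it by successive addition, so
  both lists generate the same subgroup of the integers.\<close>

lemma dvd_tail_diffs: "(\<forall>m\<in>set (tail_diffs es). n dvd m) \<longleftrightarrow> (\<forall>m\<in>set es. (n :: int) dvd m)"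
proof (induction es rule: tail_diffs.induct)
  case (3 e e' es)
  have "n dvd e - e' \<longleftrightarrow> n dvd e" if "n dvd e'" using that by (metis dvd_diff_commute dvd_diff_right_iff)
  then show ?case using 3 by auto
qed auto

text \<open>Each entry occurs in at most two differences, and the first one only once; subtracting
  it is what carries the induction.\<close>

lemma sum_abs_tail_diffs:
  assumes "\<forall>e\<in>set es. 0 \<le> (e :: int)"
  shows "(\<Sum>m\<leftarrow>tail_diffs es. \<bar>m\<bar>) \<le> 2 * sum_list es - (if es = [] then 0 else hd es)"
  using assms by (induction es rule: tail_diffs.induct) auto

text \<open>The integers m_j with sum of d_k X_k = sum of m_j x_j, where X_k are the block sums of
  the reversed differences of the x_j. The same integers pair with the lower indices in the exponent
  of \<eta>, see \<open>lprod_exponents\<close>.\<close>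

definition exponents :: "nat list \<Rightarrow> nat list \<Rightarrow> int list" where
  "exponents is d = tail_diffs (rev (expand is (map int d)))"

lemma length_exponents: "length is = length d \<Longrightarrow> length (exponents is d) = sum_list is"
  by (simp add: exponents_def length_expand)

lemma lprod_exponents:
  fixes xs :: "'a::comm_ring_1 list"
  assumes "length is = length d" "length xs = sum_list is"
  shows "lprod (map of_nat d) (block_sums is (rev (diffs xs))) = lprod (map of_int (exponents is d)) xs"
proof -
  let ?E = "expand is (map of_nat d) :: 'a list"
  have "lprod (map of_nat d) (block_sums is (rev (diffs xs))) = lprod ?E (rev (diffs xs))"
    using assms by (intro lprod_block_sums) simp_all
  also have "\<dots> = lprod (rev (rev ?E)) (rev (diffs xs))" by simp
  also have "\<dots> = lprod (rev ?E) (diffs xs)"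
    using assms by (intro lprod_rev) (simp add: length_expand)
  also have "\<dots> = lprod (tail_diffs (rev ?E)) xs"
    unfolding diffs_eq using assms by (subst lprod_diffs_from) (simp_all add: length_expand)
  also have "rev ?E = map of_int (rev (expand is (map int d)))"
    using assms by (simp add: map_expand comp_def flip: rev_map)
  finally show ?thesis by (simp add: tail_diffs_of_int exponents_def)
qed

lemma set_expand: "length is = length d \<Longrightarrow> \<forall>i\<in>set is. 1 \<le> i \<Longrightarrow> set (expand is d) = set d"
  by (induction "is" d rule: list_induct2) auto

lemma sum_list_expand: "length is = length d \<Longrightarrow> sum_list (expand is (map int d)) = (\<Sum>j<length is. int (is ! j) * int (d ! j))"
proof (induction "is" d rule: list_induct2)
  case (Cons i "is" d ds)
  then show ?case by (simp add: sum.lessThan_Suc_shift sum_list_replicate del: sum.lessThan_Suc)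
qed simp

lemma sum_abs_exponents:
  assumes "length is = length d"
  shows "(\<Sum>m\<leftarrow>exponents is d. \<bar>m\<bar>) \<le> 2 * (\<Sum>j<length is. int (is ! j) * int (d ! j))"
proof -
  let ?E = "rev (expand is (map int d))"
  have nonneg: "\<forall>e\<in>set ?E. 0 \<le> e" by (auto simp: expand_def dest!: set_zip_rightD)
  then have "0 \<le> (if ?E = [] then 0 else hd ?E)" by (metis hd_in_set order_refl)
  with sum_abs_tail_diffs[OF nonneg] show ?thesis
    unfolding exponents_def using assms by (simp add: sum_list_expand sum_list_rev)
qed

section \<open>The generating series\<close>

definition inc_lists :: "nat \<Rightarrow> nat list set" where
  "inc_lists l = {d. length d = l \<and> sorted_wrt (<) d \<and> (\<forall>i\<in>set d. 0 < i)}"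

definition weight :: "complex \<Rightarrow> nat list \<Rightarrow> nat list \<Rightarrow> complex" where
  "weight q is d = (\<Prod>j<length is. (q ^ (d ! j) / (1 - q ^ (d ! j))) ^ (is ! j))"

definition monomial_coeff :: "nat list \<Rightarrow> int list \<Rightarrow> complex" where
  "monomial_coeff ks m = (\<Prod>j<length ks. of_int (m ! j) ^ (ks ! j - 1) / fact (ks ! j - 1))"

definition h_coeff :: "nat \<Rightarrow> complex \<Rightarrow> int list \<Rightarrow> nat list \<Rightarrow> complex" where
  "h_coeff N q as ks = (\<Sum>is\<in>compositions (length as). 1 / (\<Prod>i\<leftarrow>is. fact i) *
     infsum (\<lambda>d. weight q is d * \<eta> N powi dot (exponents is d) as * monomial_coeff ks (exponents is d))
       (inc_lists (length is)))"

text \<open>Chosen so that exp (2 \<open>radius q\<close>) = 2 / (1 + |q|), which times |q| is still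
  below 1. The factor 2 matches the bound in \<open>sum_abs_exponents\<close>.\<close>

definition radius :: "complex \<Rightarrow> real" where
  "radius q = ln (2 / (1 + norm q)) / 2"

lemma radius_pos: "norm q < 1 \<Longrightarrow> radius q > 0"
  by (simp add: radius_def add_pos_nonneg)

lemma inc_lists_subset: "inc_lists l \<subseteq> pos_lists l"
  by (auto simp: inc_lists_def pos_lists_def)

lemma length_block_sums [simp]: "length (block_sums is xs) = length is"
  by (induction "is" xs rule: block_sums.induct) auto

lemma finite_compositions: "finite (compositions r)"
proof (rule finite_subset)
  show "compositions r \<subseteq> {is. set is \<subseteq> {..r} \<and> length is \<le> r}"
  proof
    fix "is" assume "is \<in> compositions r"
    then have c: "\<forall>i\<in>set is. 1 \<le> i" "sum_list is = r" by (auto simp: compositions_def)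
    have "length is \<le> sum_list is" using c(1) by (induction "is") auto
    moreover have "i \<le> sum_list is" if "i \<in> set is" for i using that by (intro member_le_sum_list) auto
    ultimately show "is \<in> {is. set is \<subseteq> {..r} \<and> length is \<le> r}" using c by auto
  qed
  show "finite {is. set is \<subseteq> {..r} \<and> length is \<le> r}" by (rule finite_lists_length_le) simp
qed

lemma has_sum_finite_sum:
  assumes "finite I" "\<And>i. i \<in> I \<Longrightarrow> (f i has_sum g i) A"
  shows "((\<lambda>x. \<Sum>i\<in>I. f i x) has_sum (\<Sum>i\<in>I. g i :: complex)) A"
  using assms by (induction I) (auto intro!: has_sum_add)

text \<open>The denominator is at least 1 - |q|, and the exponential growth turns |q|^d into the
  d-th power of 2 |q| / (1 + |q|) < 1. Since i \<ge> 1, of the i-th power of that factor only the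
  first is kept.\<close>

lemma norm_weight_bound:
  assumes q: "norm q < 1" and d: "d \<ge> 1" and i: "i \<ge> 1"
  shows "norm ((q ^ d / (1 - q ^ d)) ^ i) * exp (2 * radius q * (real i * real d))
    \<le> (1 / (1 - norm q)) ^ i * (2 * norm q / (1 + norm q)) ^ d"
proof -
  define K where "K = 1 / (1 - norm q)"
  define s where "s = 2 * norm q / (1 + norm q)"
  have exp: "exp (2 * radius q) = 2 / (1 + norm q)"
    by (simp add: radius_def add_pos_nonneg)
  have s: "0 \<le> s" "s \<le> 1" using q by (simp_all add: s_def field_simps add_pos_nonneg)
  have K: "K \<ge> 0" using q by (simp add: K_def)
  have "norm q ^ d \<le> norm q ^ 1" using q d by (intro power_decreasing) auto
  then have "1 - norm q \<le> 1 - norm (q ^ d)" by (simp add: norm_power)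
  also have "\<dots> \<le> norm (1 - q ^ d)" using norm_triangle_ineq2[of 1 "q ^ d"] by simp
  finally have "norm (q ^ d / (1 - q ^ d)) \<le> norm q ^ d * K"
    unfolding norm_divide norm_power K_def using q by (simp add: frac_le)
  then have "norm ((q ^ d / (1 - q ^ d)) ^ i) \<le> (norm q ^ d * K) ^ i"
    unfolding norm_power by (intro power_mono) auto
  moreover have "exp (2 * radius q * (real i * real d)) = ((2 / (1 + norm q)) ^ d) ^ i"
    unfolding exp[symmetric] by (simp add: exp_of_nat_mult[symmetric] mult_ac)
  ultimately have "norm ((q ^ d / (1 - q ^ d)) ^ i) * exp (2 * radius q * (real i * real d))
      \<le> (norm q ^ d * K) ^ i * ((2 / (1 + norm q)) ^ d) ^ i"
    by (simp add: mult_right_mono)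
  also have "\<dots> = K ^ i * (s ^ d) ^ i"
  proof -
    have "s = norm q * (2 / (1 + norm q))" by (simp add: s_def)
    then show ?thesis by (simp only: power_mult_distrib mult_ac)
  qed
  also have "\<dots> \<le> K ^ i * (s ^ d) ^ 1"
    using s i K by (intro mult_left_mono power_decreasing) (auto simp: power_le_one)
  finally show ?thesis by (simp add: K_def s_def)
qed

text \<open>Forgetting that d increases enlarges the index set to all positive lists, where the
  majorant is a product of geometric series.\<close>

lemma weight_summable:
  assumes q: "norm q < 1" and comp: "is \<in> compositions r"
  shows "(\<lambda>d. norm (weight q is d) * exp (radius q * (\<Sum>j<r. \<bar>real_of_int (exponents is d ! j)\<bar>)))
    summable_on inc_lists (length is)"
proof -
  let ?K = "1 / (1 - norm q)" and ?s = "2 * norm q / (1 + norm q)"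
  have sum: "sum_list is = r" and pos: "\<And>j. j < length is \<Longrightarrow> is ! j \<ge> 1"
    using comp by (auto simp: compositions_def)
  have s: "0 \<le> ?s" "?s < 1" using q by (simp_all add: field_simps add_pos_nonneg)
  define f where "f j k = ?K ^ (is ! j) * ?s ^ k" for j k :: nat
  have f0: "f j k \<ge> 0" for j k using s q by (simp add: f_def)
  have "summable (\<lambda>n. norm (f j (Suc n)))" for j
  proof -
    have "summable (\<lambda>n. ?K ^ (is ! j) * (?s * ?s ^ n))"
      using s by (intro summable_mult summable_geometric) simp
    then show ?thesis using f0[of j] by (simp add: f_def)
  qed
  then have abs_UNIV: "abs_summable (\<lambda>n. f j (Suc n)) UNIV" for j
    using norm_summable_imp_summable_on[of "\<lambda>n. norm (f j (Suc n))"] by simp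
  have abs: "abs_summable (f j) {1..}" for j
  proof -
    obtain t where "((\<lambda>n. norm (f j (Suc n))) has_sum t) UNIV" using abs_UNIV by (auto simp: summable_on_def)
    then have "((\<lambda>k. norm (f j k)) has_sum t) {1..}" unfolding has_sum_from_1 .
    then show ?thesis unfolding summable_on_def by blast
  qed
  have hs: "(f j has_sum infsum (f j) {1..}) {1..}" for j
    by (rule has_sum_infsum[OF abs_summable_summable[OF abs]])
  have "((\<lambda>d. \<Prod>j<length is. f j (d ! j)) has_sum (\<Prod>j<length is. infsum (f j) {1..})) (pos_lists (length is))"
    by (rule has_sum_prod_pos_lists[THEN conjunct2, OF abs hs])
  then have "(\<lambda>d. \<Prod>j<length is. f j (d ! j)) summable_on pos_lists (length is)"
    unfolding summable_on_def by blast
  then have "(\<lambda>d. \<Prod>j<length is. f j (d ! j)) summable_on inc_lists (length is)"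
    by (rule summable_on_subset_banach[OF _ inc_lists_subset])
  then show ?thesis
  proof (rule summable_on_comparison_test)
    fix d assume d: "d \<in> inc_lists (length is)"
    then have len: "length is = length d" and dpos: "\<And>j. j < length is \<Longrightarrow> d ! j \<ge> 1"
      by (auto simp: inc_lists_def Suc_le_eq)
    have "(\<Sum>j<r. \<bar>real_of_int (exponents is d ! j)\<bar>) = real_of_int (\<Sum>m\<leftarrow>exponents is d. \<bar>m\<bar>)"
      using sum length_exponents[OF len] by (simp add: sum_list_sum_nth atLeast0LessThan)
    also have "\<dots> \<le> real_of_int (2 * (\<Sum>j<length is. int (is ! j) * int (d ! j)))"
      using sum_abs_exponents[OF len] by (simp only: of_int_le_iff)
    also have "\<dots> = 2 * (\<Sum>j<length is. real (is ! j) * real (d ! j))" by simp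
    finally have "radius q * (\<Sum>j<r. \<bar>real_of_int (exponents is d ! j)\<bar>) \<le>
        radius q * (2 * (\<Sum>j<length is. real (is ! j) * real (d ! j)))"
      using radius_pos[OF q] by (intro mult_left_mono) auto
    also have "\<dots> = (\<Sum>j<length is. 2 * radius q * (real (is ! j) * real (d ! j)))"
      by (simp add: sum_distrib_left mult_ac)
    finally have "norm (weight q is d) * exp (radius q * (\<Sum>j<r. \<bar>real_of_int (exponents is d ! j)\<bar>)) \<le>
        norm (weight q is d) * (\<Prod>j<length is. exp (2 * radius q * (real (is ! j) * real (d ! j))))"
      unfolding exp_sum[OF finite_lessThan, symmetric] by (intro mult_left_mono) auto
    also have "\<dots> = (\<Prod>j<length is. norm ((q ^ (d ! j) / (1 - q ^ (d ! j))) ^ (is ! j)) * exp (2 * radius q * (real (is ! j) * real (d ! j))))"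
      by (simp add: weight_def prod_norm[symmetric] prod.distrib)
    also have "\<dots> \<le> (\<Prod>j<length is. f j (d ! j))"
      unfolding f_def using norm_weight_bound[OF q] pos dpos by (intro prod_mono) auto
    finally show "norm (weight q is d) * exp (radius q * (\<Sum>j<r. \<bar>real_of_int (exponents is d ! j)\<bar>)) \<le>
        (\<Prod>j<length is. f j (d ! j))" .
  qed simp
qed

context level
begin

lemma eta_powi_sum:
  fixes n :: nat
  shows "(\<Prod>j<n. \<eta> N powi f j) = \<eta> N powi (\<Sum>j<n. f j)"
  by (induction n) (simp_all add: power_int_add)

lemma H_term:
  assumes len: "length is = length d" and l: "sum_list is = length as" "length xs = length as"
  shows "(\<Prod>j<length is. exp (of_nat (d ! j) * block_sums is (rev (diffs xs)) ! j)
      * \<eta> N powi (block_sums is (rev (diffs as)) ! j * int (d ! j)) * (q ^ (d ! j) / (1 - q ^ (d ! j))) ^ (is ! j)) =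
    weight q is d * \<eta> N powi dot (exponents is d) as * exp (\<Sum>j<length as. of_int (exponents is d ! j) * xs ! j)"
proof -
  have le: "length (exponents is d) = length as" using l len by (simp add: length_exponents)
  have "(\<Sum>j<length is. of_nat (d ! j) * block_sums is (rev (diffs xs)) ! j) =
      lprod (map of_nat d) (block_sums is (rev (diffs xs)))"
    using len by (simp add: lprod_nth)
  also have "\<dots> = lprod (map of_int (exponents is d)) xs"
    using len l by (intro lprod_exponents) simp_all
  also have "\<dots> = (\<Sum>j<length as. of_int (exponents is d ! j) * xs ! j)"
    using le l by (simp add: lprod_nth)
  finally have 1: "(\<Sum>j<length is. of_nat (d ! j) * block_sums is (rev (diffs xs)) ! j) =
      (\<Sum>j<length as. of_int (exponents is d ! j) * xs ! j)" .
  have "(\<Sum>j<length is. block_sums is (rev (diffs as)) ! j * int (d ! j)) =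
      lprod (map of_nat d) (block_sums is (rev (diffs as)))"
    using len by (simp add: lprod_nth mult.commute)
  also have "\<dots> = lprod (map of_int (exponents is d)) as"
    using len l by (intro lprod_exponents) simp_all
  also have "\<dots> = dot (exponents is d) as"
    using le by (simp add: lprod_nth dot_def)
  finally have 2: "(\<Sum>j<length is. block_sums is (rev (diffs as)) ! j * int (d ! j)) = dot (exponents is d) as" .
  show ?thesis
    unfolding prod.distrib exp_sum[OF finite_lessThan, symmetric] 1 eta_powi_sum 2 weight_def
    by (simp only: mult_ac)
qed

lemma
  assumes q: "norm q < 1" and comp: "is \<in> compositions (length as)"
  shows H_series_expansion: "\<And>xs. length xs = length as \<Longrightarrow> \<forall>x\<in>set xs. norm x \<le> radius q \<Longrightarrow>
      ((\<lambda>ks. infsum (\<lambda>d. weight q is d * \<eta> N powi dot (exponents is d) as * monomial_coeff ks (exponents is d)) (inc_lists (length is))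
        * (\<Prod>j<length as. xs ! j ^ (ks ! j - 1))) has_sum
        H_series N q is (block_sums is (rev (diffs as))) (block_sums is (rev (diffs xs)))) (pos_lists (length as))"
    and H_coeff_summable: "\<And>ks. ks \<in> pos_lists (length as) \<Longrightarrow>
      (\<lambda>d. weight q is d * \<eta> N powi dot (exponents is d) as * monomial_coeff ks (exponents is d)) summable_on inc_lists (length is)"
proof -
  let ?A = "inc_lists (length is)" and ?c = "\<lambda>d. weight q is d * \<eta> N powi dot (exponents is d) as"
  have l: "sum_list is = length as" using comp by (simp add: compositions_def)
  have summ: "(\<lambda>d. norm (?c d) * exp (radius q * (\<Sum>j<length as. \<bar>real_of_int (exponents is d ! j)\<bar>))) summable_on ?A"
    using weight_summable[OF q comp] by (simp add: norm_mult)
  note ex = exp_family_expansion[where m = "\<lambda>d j. exponents is d ! j", OF radius_pos[OF q] summ]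
  have mc: "(\<Prod>j<length as. of_int (exponents is d ! j) ^ (ks ! j - 1) / fact (ks ! j - 1)) = monomial_coeff ks (exponents is d)"
    if "ks \<in> pos_lists (length as)" for ks d
    using that by (simp add: monomial_coeff_def pos_lists_def)
  show "((\<lambda>ks. infsum (\<lambda>d. ?c d * monomial_coeff ks (exponents is d)) ?A
        * (\<Prod>j<length as. xs ! j ^ (ks ! j - 1))) has_sum
        H_series N q is (block_sums is (rev (diffs as))) (block_sums is (rev (diffs xs)))) (pos_lists (length as))"
    if xs: "length xs = length as" "\<forall>x\<in>set xs. norm x \<le> radius q" for xs
  proof -
    have H: "H_series N q is (block_sums is (rev (diffs as))) (block_sums is (rev (diffs xs))) =
        infsum (\<lambda>d. ?c d * exp (\<Sum>j<length as. of_int (exponents is d ! j) * xs ! j)) ?A"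
      unfolding H_series_def inc_lists_def[symmetric]
      by (intro infsum_cong H_term) (use l xs in \<open>auto simp: inc_lists_def\<close>)
    have "((\<lambda>ks. infsum (\<lambda>d. ?c d * (\<Prod>j<length as. of_int (exponents is d ! j) ^ (ks ! j - 1) / fact (ks ! j - 1))) ?A
        * (\<Prod>j<length as. xs ! j ^ (ks ! j - 1))) has_sum
        infsum (\<lambda>d. ?c d * exp (\<Sum>j<length as. of_int (exponents is d ! j) * xs ! j)) ?A) (pos_lists (length as))"
      by (rule ex(1)) (use xs in auto)
    then show ?thesis
      unfolding H by (rule has_sum_cong[THEN iffD1, rotated]) (simp only: mc)
  qed
  show "(\<lambda>d. ?c d * monomial_coeff ks (exponents is d)) summable_on ?A" if "ks \<in> pos_lists (length as)" for ks
    using ex(2)[OF that] mc[OF that] by simp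
qed

lemma h_series_expansion:
  assumes q: "norm q < 1" and xs: "length xs = length as" "\<forall>x\<in>set xs. norm x \<le> radius q"
  shows "((\<lambda>ks. h_coeff N q as ks * (\<Prod>j<length as. xs ! j ^ (ks ! j - 1))) has_sum
    h_series N q (rev (diffs as)) (rev (diffs xs))) (pos_lists (length as))"
proof -
  have "((\<lambda>ks. \<Sum>is\<in>compositions (length as). 1 / (\<Prod>i\<leftarrow>is. fact i) *
      (infsum (\<lambda>d. weight q is d * \<eta> N powi dot (exponents is d) as * monomial_coeff ks (exponents is d)) (inc_lists (length is))
        * (\<Prod>j<length as. xs ! j ^ (ks ! j - 1)))) has_sum
    (\<Sum>is\<in>compositions (length as). 1 / (\<Prod>i\<leftarrow>is. fact i) *
      H_series N q is (block_sums is (rev (diffs as))) (block_sums is (rev (diffs xs))))) (pos_lists (length as))"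
    by (intro has_sum_finite_sum finite_compositions has_sum_cmult_right H_series_expansion q xs)
  then show ?thesis
    unfolding h_coeff_def h_series_def by (simp add: sum_distrib_right mult.assoc)
qed

definition kappa :: complex where
  "kappa = of_nat N / (- 2 * of_real pi * \<i>)"

lemma kappa_nonzero: "kappa \<noteq> 0"
  using N by (simp add: kappa_def)

text \<open>The expansion of h shows that an admissible g exists; any admissible g has the same
  coefficients, by comparison on the smaller of the two polydiscs. This holds for positive
  \<open>ks\<close> and lower indices in the residue range.\<close>

lemma g_sh_coeff:
  assumes q: "norm q < 1" and as: "set as \<subseteq> residues_mod N" and ks: "ks \<in> pos_lists (length as)"
  shows "kappa ^ sum_list ks * g_sh N q (zip ks as) = h_coeff N q as ks"
proof -
  let ?P = "\<lambda>g. g [] = 1 \<and>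
     (\<forall>as. set as \<subseteq> residues_mod N \<longrightarrow>
       (\<exists>\<epsilon>>0. \<forall>xs. length xs = length as \<and> (\<forall>x\<in>set xs. norm x < \<epsilon>) \<longrightarrow>
         ((\<lambda>ks. kappa ^ sum_list ks * g (zip ks as) * (\<Prod>j<length as. xs ! j ^ (ks ! j - 1)))
           has_sum h_series N q (rev (diffs as)) (rev (diffs xs))) (pos_lists (length as))))"
  define g0 where "g0 w = h_coeff N q (map snd w) (map fst w) / kappa ^ sum_list (map fst w)" for w
  have "?P g0"
  proof (intro conjI allI impI)
    have "is = []" if "is \<in> compositions 0" for "is"
      using that by (cases "is") (auto simp: compositions_def)
    moreover have "[] \<in> compositions 0" by (simp add: compositions_def)
    ultimately have "compositions 0 = {[]}" by blast
    moreover have "inc_lists 0 = {[]}" by (auto simp: inc_lists_def)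
    ultimately show "g0 [] = 1" by (simp add: g0_def h_coeff_def weight_def monomial_coeff_def exponents_def)
    fix as :: "int list"
    show "\<exists>\<epsilon>>0. \<forall>xs. length xs = length as \<and> (\<forall>x\<in>set xs. norm x < \<epsilon>) \<longrightarrow>
         ((\<lambda>ks. kappa ^ sum_list ks * g0 (zip ks as) * (\<Prod>j<length as. xs ! j ^ (ks ! j - 1)))
           has_sum h_series N q (rev (diffs as)) (rev (diffs xs))) (pos_lists (length as))"
    proof (intro exI[of _ "radius q"] conjI allI impI radius_pos q)
      fix xs :: "complex list" assume xs: "length xs = length as \<and> (\<forall>x\<in>set xs. norm x < radius q)"
      have eq: "kappa ^ sum_list ks * g0 (zip ks as) = h_coeff N q as ks" if "ks \<in> pos_lists (length as)" for ks
        using that kappa_nonzero by (simp add: g0_def pos_lists_def)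
      have "((\<lambda>ks. h_coeff N q as ks * (\<Prod>j<length as. xs ! j ^ (ks ! j - 1))) has_sum
          h_series N q (rev (diffs as)) (rev (diffs xs))) (pos_lists (length as))"
        using xs by (intro h_series_expansion q) auto
      then show "((\<lambda>ks. kappa ^ sum_list ks * g0 (zip ks as) * (\<Prod>j<length as. xs ! j ^ (ks ! j - 1)))
           has_sum h_series N q (rev (diffs as)) (rev (diffs xs))) (pos_lists (length as))"
        by (rule has_sum_cong[THEN iffD1, rotated]) (simp add: eq)
    qed
  qed
  then have "?P (SOME g. ?P g)" by (rule someI[of ?P])
  then have P: "?P (g_sh N q)" unfolding g_sh_def kappa_def pos_lists_def .
  then obtain e where e: "e > 0" and g: "\<And>xs. length xs = length as \<and> (\<forall>x\<in>set xs. norm x < e) \<Longrightarrow>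
      ((\<lambda>ks. kappa ^ sum_list ks * g_sh N q (zip ks as) * (\<Prod>j<length as. xs ! j ^ (ks ! j - 1)))
        has_sum h_series N q (rev (diffs as)) (rev (diffs xs))) (pos_lists (length as))"
    using as by meson
  have "kappa ^ sum_list ks * g_sh N q (zip ks as) - h_coeff N q as ks = 0"
  proof (rule multi_power_series_zero[where e = "min e (radius q)" and r = "length as", OF _ _ ks])
    fix xs :: "complex list" assume xs: "length xs = length as" "\<forall>x\<in>set xs. norm x < min e (radius q)"
    have "((\<lambda>ks. kappa ^ sum_list ks * g_sh N q (zip ks as) * (\<Prod>j<length as. xs ! j ^ (ks ! j - 1))
         + - 1 * (h_coeff N q as ks * (\<Prod>j<length as. xs ! j ^ (ks ! j - 1)))) has_sum
        (h_series N q (rev (diffs as)) (rev (diffs xs)) + - 1 * h_series N q (rev (diffs as)) (rev (diffs xs)))) (pos_lists (length as))"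
      by (intro has_sum_add has_sum_cmult_right g h_series_expansion q) (use xs in auto)
    then show "((\<lambda>ks. (kappa ^ sum_list ks * g_sh N q (zip ks as) - h_coeff N q as ks) *
        (\<Prod>j<length as. xs ! j ^ (ks ! j - 1))) has_sum 0) (pos_lists (length as))"
      by (simp add: left_diff_distrib)
  qed (use e radius_pos[OF q] in simp)
  then show ?thesis by simp
qed

lemma exponents_scale:
  assumes "length is = length d"
  shows "exponents is (map (\<lambda>x. n * x) d) = map (\<lambda>m. int n * m) (exponents is d)"
proof -
  have "expand is (map int (map (\<lambda>x. n * x) d)) = map (\<lambda>m. int n * m) (expand is (map int d))"
    using assms by (simp add: map_expand comp_def)
  then show ?thesis unfolding exponents_def by (simp add: rev_map tail_diffs_scale)
qed

lemma multiples_inc_lists: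
  "{d \<in> inc_lists l. \<forall>x\<in>set d. N dvd x} = map (\<lambda>x. N * x) ` inc_lists l"
proof (intro equalityI subsetI)
  fix d assume d: "d \<in> {d \<in> inc_lists l. \<forall>x\<in>set d. N dvd x}"
  have len: "length d = l" and sorted: "sorted_wrt (<) d" and pos: "\<And>x. x \<in> set d \<Longrightarrow> 0 < x"
    and dvd: "\<And>x. x \<in> set d \<Longrightarrow> N dvd x"
    using d by (simp_all add: inc_lists_def)
  have "d = map (\<lambda>x. N * x) (map (\<lambda>x. x div N) d)"
    unfolding map_map comp_def by (rule map_idI[symmetric]) (simp add: dvd)
  moreover have "map (\<lambda>x. x div N) d \<in> inc_lists l"
  proof -
    have lt: "x div N < y div N" if "N dvd x" "N dvd y" "x < y" for x y
      using that N by (auto elim!: dvdE)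
    have "sorted_wrt (\<lambda>x y. x div N < y div N) d"
      by (rule sorted_wrt_mono_rel[OF _ sorted]) (intro lt dvd)
    moreover have "0 < x div N" if "x \<in> set d" for x
      using dvd_imp_le[OF dvd[OF that] pos[OF that]] N by (simp add: div_greater_zero_iff)
    ultimately show ?thesis by (simp add: inc_lists_def sorted_wrt_map len)
  qed
  ultimately show "d \<in> map (\<lambda>x. N * x) ` inc_lists l" by blast
next
  fix d assume "d \<in> map (\<lambda>x. N * x) ` inc_lists l"
  then show "d \<in> {d \<in> inc_lists l. \<forall>x\<in>set d. N dvd x}"
    using N by (auto simp: inc_lists_def sorted_wrt_map)
qed

text \<open>All dependence on the lower indices sits in one character, so for each composition
  summing over them leaves the d whose exponents are divisible by N. Rescaling d multiplies every
  exponent by N.\<close>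

lemma sum_h_coeff:
  assumes q: "norm q < 1" and ks: "ks \<in> pos_lists r"
  shows "(\<Sum>as\<in>index_lists N r. h_coeff N q as ks) = of_nat N ^ sum_list ks * h_coeff 1 (q ^ N) (replicate r 0) ks"
proof -
  let ?t = "\<lambda>is as d. weight q is d * \<eta> N powi dot (exponents is d) as * monomial_coeff ks (exponents is d)"
  let ?u = "\<lambda>is d. weight (q ^ N) is d * monomial_coeff ks (exponents is d)"
  have lk: "length ks = r" and kpos: "\<And>j. j < r \<Longrightarrow> ks ! j \<ge> 1" using ks by (auto simp: pos_lists_def)
  \<comment> \<open>The r factors N of the character sum complete the powers N^(k_j - 1) that come
    from the rescaled exponents.\<close>
  have pow: "(\<Prod>j<r. of_nat N * of_nat N ^ (ks ! j - 1)) = (of_nat N ^ sum_list ks :: complex)"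
  proof -
    have "(\<Prod>j<r. of_nat N * of_nat N ^ (ks ! j - 1)) = (\<Prod>j<r. of_nat N ^ (ks ! j) :: complex)"
      using kpos by (intro prod.cong refl) (metis One_nat_def Suc_le_D diff_Suc_1 lessThan_iff power_Suc)
    also have "\<dots> = of_nat N ^ (\<Sum>j<r. ks ! j)" by (simp add: power_sum)
    finally show ?thesis using lk by (simp add: sum_list_sum_nth atLeast0LessThan)
  qed
  have inner: "(\<Sum>as\<in>index_lists N r. infsum (?t is as) (inc_lists (length is))) =
      of_nat N ^ sum_list ks * infsum (?u is) (inc_lists (length is))" if comp: "is \<in> compositions r" for "is"
  proof -
    let ?A = "inc_lists (length is)"
    have sum: "sum_list is = r" and ipos: "\<forall>i\<in>set is. 1 \<le> i" using comp by (auto simp: compositions_def)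
    have hs: "((\<lambda>d. \<Sum>as\<in>index_lists N r. ?t is as d) has_sum (\<Sum>as\<in>index_lists N r. infsum (?t is as) ?A)) ?A"
    proof (intro has_sum_finite_sum finite_index_lists has_sum_infsum)
      fix as assume "as \<in> index_lists N r"
      then have "length as = r" by (simp add: index_lists_def)
      then show "?t is as summable_on ?A" using H_coeff_summable[OF q, of "is" as ks] comp ks by simp
    qed
    have orth: "(\<Sum>as\<in>index_lists N r. ?t is as d) = weight q is d * monomial_coeff ks (exponents is d) *
        (if \<forall>x\<in>set d. N dvd x then of_nat N ^ r else 0)" if d: "d \<in> ?A" for d
    proof -
      have len: "length is = length d" using d by (simp add: inc_lists_def)
      have le: "length (exponents is d) = r" using sum len by (simp add: length_exponents)
      \<comment> \<open>Divisibility passes from the exponents to the expanded list by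
        \<open>dvd_tail_diffs\<close>, and from there to d because no block is empty.\<close>
      have "(\<forall>m\<in>set (exponents is d). int N dvd m) \<longleftrightarrow> (\<forall>x\<in>set d. N dvd x)"
        unfolding exponents_def dvd_tail_diffs using len ipos by (simp add: set_expand)
      then show ?thesis
        using sum_eta_dot'[of "exponents is d"] le
        by (simp add: sum_distrib_left[symmetric] sum_distrib_right[symmetric] mult_ac)
    qed
    have "(\<Sum>as\<in>index_lists N r. infsum (?t is as) ?A) = infsum (\<lambda>d. \<Sum>as\<in>index_lists N r. ?t is as d) ?A"
      using infsumI[OF hs] by simp
    also have "\<dots> = infsum (\<lambda>d. weight q is d * monomial_coeff ks (exponents is d) * of_nat N ^ r)
        {d \<in> ?A. \<forall>x\<in>set d. N dvd x}"
      by (intro infsum_cong_neutral) (auto simp: orth)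
    also have "\<dots> = infsum (\<lambda>d. of_nat N ^ sum_list ks * ?u is d) ?A"
    proof -
      have inj: "inj_on (map (\<lambda>x. N * x)) ?A"
        using N by (intro inj_on_mapI) (auto simp: inj_on_def)
      have "weight q is (map (\<lambda>x. N * x) d) * monomial_coeff ks (exponents is (map (\<lambda>x. N * x) d)) * of_nat N ^ r =
          of_nat N ^ sum_list ks * ?u is d" if d: "d \<in> ?A" for d
      proof -
        have len: "length is = length d" using d by (simp add: inc_lists_def)
        have le: "length (exponents is d) = r" using sum len by (simp add: length_exponents)
        have "weight q is (map (\<lambda>x. N * x) d) = weight (q ^ N) is d"
          unfolding weight_def using len by (intro prod.cong refl) (simp add: power_mult)
        moreover have "monomial_coeff ks (exponents is (map (\<lambda>x. N * x) d)) * of_nat N ^ r =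
            (\<Prod>j<r. of_nat N * of_nat N ^ (ks ! j - 1)) * monomial_coeff ks (exponents is d)"
        proof -
          have "monomial_coeff ks (exponents is (map (\<lambda>x. N * x) d)) * of_nat N ^ r =
              (\<Prod>j<r. of_int (int N * exponents is d ! j) ^ (ks ! j - 1) / fact (ks ! j - 1) * of_nat N)"
            unfolding monomial_coeff_def exponents_scale[OF len] lk prod.distrib using le by simp
          also have "\<dots> = (\<Prod>j<r. of_nat N * of_nat N ^ (ks ! j - 1) * (of_int (exponents is d ! j) ^ (ks ! j - 1) / fact (ks ! j - 1)))"
            by (intro prod.cong refl) (simp add: power_mult_distrib)
          finally show ?thesis unfolding monomial_coeff_def lk by (simp only: prod.distrib)
        qed
        ultimately show ?thesis unfolding pow by (simp add: mult_ac)
      qed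
      then show ?thesis
        unfolding multiples_inc_lists infsum_reindex[OF inj] by (intro infsum_cong) simp
    qed
    also have "\<dots> = of_nat N ^ sum_list ks * infsum (?u is) ?A" by (rule infsum_cmult_right')
    finally show ?thesis .
  qed
  have eta1: "\<eta> 1 powi k = 1" for k using level.eta_powi_eq_1[of 1 k] by (simp add: level_def)
  have "(\<Sum>as\<in>index_lists N r. h_coeff N q as ks) =
      (\<Sum>as\<in>index_lists N r. \<Sum>is\<in>compositions r. 1 / (\<Prod>i\<leftarrow>is. fact i) * infsum (?t is as) (inc_lists (length is)))"
    unfolding h_coeff_def by (intro sum.cong refl) (auto simp: index_lists_def)
  also have "\<dots> = (\<Sum>is\<in>compositions r. 1 / (\<Prod>i\<leftarrow>is. fact i) * (\<Sum>as\<in>index_lists N r. infsum (?t is as) (inc_lists (length is))))"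
    unfolding sum_distrib_left by (rule sum.swap)
  also have "\<dots> = (\<Sum>is\<in>compositions r. 1 / (\<Prod>i\<leftarrow>is. fact i) * (of_nat N ^ sum_list ks * infsum (?u is) (inc_lists (length is))))"
    by (intro sum.cong refl) (simp only: inner)
  also have "\<dots> = of_nat N ^ sum_list ks * h_coeff 1 (q ^ N) (replicate r 0) ks"
    unfolding h_coeff_def eta1 by (simp add: sum_distrib_left mult_ac)
  finally show ?thesis .
qed

lemma sum_g_sh:
  assumes q: "norm q < 1" and ns: "\<forall>n\<in>set ns. n \<ge> 1"
  shows "(\<Sum>as\<in>index_lists N (length ns). g_sh N q (zip ns as)) = g_sh 1 (q ^ N) (map (\<lambda>n. (n, 0)) ns)"
proof -
  interpret L1: level 1 by standard simp
  let ?r = "length ns" and ?s = "sum_list ns"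
  have pos: "ns \<in> pos_lists ?r" using ns by (simp add: pos_lists_def)
  have q1: "norm (q ^ N) < 1" using q N by (simp add: norm_power power_less_one_iff)
  have "kappa ^ ?s * (\<Sum>as\<in>index_lists N ?r. g_sh N q (zip ns as)) = (\<Sum>as\<in>index_lists N ?r. h_coeff N q as ns)"
    unfolding sum_distrib_left
    by (intro sum.cong refl g_sh_coeff q) (use pos in \<open>auto simp: index_lists_def\<close>)
  also have "\<dots> = of_nat N ^ ?s * h_coeff 1 (q ^ N) (replicate ?r 0) ns" by (rule sum_h_coeff[OF q pos])
  also have "h_coeff 1 (q ^ N) (replicate ?r 0) ns = L1.kappa ^ ?s * g_sh 1 (q ^ N) (zip ns (replicate ?r 0))"
    by (rule L1.g_sh_coeff[OF q1, symmetric]) (use pos in \<open>auto simp: residues_mod_def\<close>)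
  also have "zip ns (replicate ?r (0 :: int)) = map (\<lambda>n. (n, 0)) ns" by (rule zip_replicate_0)
  also have "of_nat N ^ ?s * (L1.kappa ^ ?s * g_sh 1 (q ^ N) (map (\<lambda>n. (n, 0)) ns)) =
      kappa ^ ?s * g_sh 1 (q ^ N) (map (\<lambda>n. (n, 0)) ns)"
  proof -
    have "kappa = of_nat N * L1.kappa" unfolding kappa_def L1.kappa_def by simp
    then show ?thesis by (simp add: power_mult_distrib)
  qed
  finally show ?thesis using kappa_nonzero by simp
qed

end

theorem theorem6p1:
  fixes N :: nat and ns :: "nat list" and \<tau> :: complex
  assumes "N \<ge> 1"
    and "\<forall>n\<in>set ns. n \<ge> 1"
    and "Im \<tau> > 0"
  shows "(\<Sum>as\<in>index_lists N (length ns). G_sh N (zip ns as) \<tau>) = G_sh_level1 ns (of_nat N * \<tau>)"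
proof -
  interpret level N by standard (rule assms(1))
  define q where "q = exp (2 * of_real pi * \<i> * \<tau>)"
  have q: "norm q < 1"
    using assms(3) by (simp add: q_def)
  have qN: "exp (2 * of_real pi * \<i> * (of_nat N * \<tau>)) = q ^ N"
    by (simp add: q_def exp_of_nat_mult[symmetric] mult_ac)
  show ?thesis
    unfolding G_sh_def G_sh_level1_def qN q_def[symmetric]
    by (rule sum_convolution[OF assms(2) sum_zeta sum_g_sh[OF q]])
qed


end
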